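(* Let $\mathbb{E}$ be a finitely complete category with suprema of chains of subobjects which are stable under pullback along split epimorphisms and stable under intersection with subobjects. Let $\mathbb{T}$ be the theory of any finitary algebraic structure. Then the category $\mathbb{T}(\mathbb{E})$ has suprema of chains of subobjects which are stable under intersection with subobjects and which are preserved, and thus reflected, by the conservative forgetful functor $U_{\mathbb{T}}^{\mathbb{E}}:\mathbb{T}(\mathbb{E})\to\mathbb{E}$. When, moreover, $\mathbb{E}$ is regular, for any preorders (resp. equivalence relations) $T,S,R$ on an object $X$ of $\mathbb{E}$ we get $$(T\vee S)\cap R=\Sigma_{i\in\mathbb{N}}\big((T,S)_i\cap R\big)$$ in $PrO\,\mathbb{E}$ (resp. in $Equ\,\mathbb{E}$), where $T\vee S$ is the supremum among the preorders (resp. the equivalence relations) on $X$; and this property is transferred to any category $\mathbb{T}(\mathbb{E})$, i.e. the same formula holds for preorders (resp. equivalence relations) in $\mathbb{T}(\mathbb{E})$. This is the case, in particular, for any topos $\mathbb{E}$ with suprema of chains of subobjects.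
   Context: $\mathbb{T}(\mathbb{E})$ is the category of internal $\mathbb{T}$-algebras in $\mathbb{E}$, and $U_{\mathbb{T}}^{\mathbb{E}}$ is the left exact conservative functor sending an internal algebra to its underlying object. A chain of subobjects of $X$ is an increasing sequence $(A_i)_{i\in\mathbb{N}}$ of subobjects of $X$; its supremum $\Sigma_{i\in\mathbb{N}}A_i$ is taken in the ordered set of subobjects of $X$. Stability under pullback along split epimorphisms means that $g^{*}(\Sigma_iA_i)=\Sigma_i g^{*}(A_i)$ for every split epimorphism $g$ with codomain $X$; stability under intersection with subobjects means that $\Sigma_i(A_i\cap U)=(\Sigma_iA_i)\cap U$ for every subobject $U$ of $X$. A relation on $X$ is (a class up to isomorphism of) a subobject $R\rightarrowtail X\times X$, ordered by inclusion. In a regular category relations compose: $SR=S\circ R$ is the usual composite relation ($x(SR)z$ iff there is $y$ with $xRy$ and $ySz$), defined by a pullback followed by the regular epi–mono factorization. $R$ is reflexive if $\Delta_X\subset R$, symmetric if $R^{op}\subset R$, transitive if $R\circ R\subset R$; a preorder is a reflexive transitive relation, an equivalence relation is a symmetric preorder. $PrO$ and $Equ$ refer to the categories of internal preorders and of internal equivalence relations. For reflexive relations $T,S$ on $X$, $(T,S)_i$ is the alternating product of $i$ factors beginning with $T$: $(T,S)_0=\Delta_X$, $(T,S)_1=T$, $(T,S)_2=TS$, $(T,S)_3=TST$, etc.; these form an increasing chain. $\Sigma_{i\in\mathbb{N}}$ of a chain of reflexive relations is its supremum among the reflexive relations on $X$. *)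

theory Defs
  imports Main
begin

section \<open>Categories, finite limits and regularity\<close>

record ('o, 'a) cat =
  Obj :: "'o set"
  Arr :: "'a set"
  Dom :: "'a \<Rightarrow> 'o"
  Cod :: "'a \<Rightarrow> 'o"
  Id :: "'o \<Rightarrow> 'a"
  Comp :: "'a \<Rightarrow> 'a \<Rightarrow> 'a" (infixr "\<cdot>\<index>" 75)

definition Hom :: "('o, 'a) cat \<Rightarrow> 'o \<Rightarrow> 'o \<Rightarrow> 'a set" where
  "Hom C a b = {f \<in> Arr C. Dom C f = a \<and> Cod C f = b}"

locale category =
  fixes C :: "('o, 'a) cat" (structure)
  assumes dom_obj: "f \<in> Arr C \<Longrightarrow> Dom C f \<in> Obj C"
    and cod_obj: "f \<in> Arr C \<Longrightarrow> Cod C f \<in> Obj C"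
    and id_hom: "a \<in> Obj C \<Longrightarrow> Id C a \<in> Hom C a a"
    and comp_hom: "f \<in> Hom C a b \<Longrightarrow> g \<in> Hom C b c \<Longrightarrow> g \<cdot> f \<in> Hom C a c"
    and id_left: "f \<in> Hom C a b \<Longrightarrow> Id C b \<cdot> f = f"
    and id_right: "f \<in> Hom C a b \<Longrightarrow> f \<cdot> Id C a = f"
    and assoc: "f \<in> Hom C a b \<Longrightarrow> g \<in> Hom C b c \<Longrightarrow> h \<in> Hom C c d \<Longrightarrow>
      h \<cdot> (g \<cdot> f) = (h \<cdot> g) \<cdot> f"

definition is_mono :: "('o, 'a) cat \<Rightarrow> 'a \<Rightarrow> bool" where
  "is_mono C m \<longleftrightarrow> m \<in> Arr C \<and>
    (\<forall>Z. \<forall>u \<in> Hom C Z (Dom C m). \<forall>v \<in> Hom C Z (Dom C m).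
      m \<cdot>\<^bsub>C\<^esub> u = m \<cdot>\<^bsub>C\<^esub> v \<longrightarrow> u = v)"

definition is_split_epi :: "('o, 'a) cat \<Rightarrow> 'a \<Rightarrow> bool" where
  "is_split_epi C g \<longleftrightarrow> g \<in> Arr C \<and>
    (\<exists>s \<in> Hom C (Cod C g) (Dom C g). g \<cdot>\<^bsub>C\<^esub> s = Id C (Cod C g))"

definition is_coequalizer :: "('o, 'a) cat \<Rightarrow> 'a \<Rightarrow> 'a \<Rightarrow> 'a \<Rightarrow> bool" where
  "is_coequalizer C f g e \<longleftrightarrow>
    f \<in> Arr C \<and> g \<in> Hom C (Dom C f) (Cod C f) \<and> e \<in> Arr C \<and> Dom C e = Cod C f \<and>
    e \<cdot>\<^bsub>C\<^esub> f = e \<cdot>\<^bsub>C\<^esub> g \<and>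
    (\<forall>Z. \<forall>h \<in> Hom C (Cod C f) Z. h \<cdot>\<^bsub>C\<^esub> f = h \<cdot>\<^bsub>C\<^esub> g \<longrightarrow>
      (\<exists>!k. k \<in> Hom C (Cod C e) Z \<and> k \<cdot>\<^bsub>C\<^esub> e = h))"

definition is_regular_epi :: "('o, 'a) cat \<Rightarrow> 'a \<Rightarrow> bool" where
  "is_regular_epi C e \<longleftrightarrow> (\<exists>f g. is_coequalizer C f g e)"

definition is_terminal :: "('o, 'a) cat \<Rightarrow> 'o \<Rightarrow> bool" where
  "is_terminal C t \<longleftrightarrow> t \<in> Obj C \<and> (\<forall>Z \<in> Obj C. \<exists>!h. h \<in> Hom C Z t)"

definition is_pullback :: "('o, 'a) cat \<Rightarrow> 'a \<Rightarrow> 'a \<Rightarrow> 'o \<Rightarrow> 'a \<Rightarrow> 'a \<Rightarrow> bool" where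
  "is_pullback C f g P p q \<longleftrightarrow>
    f \<in> Arr C \<and> g \<in> Arr C \<and> Cod C f = Cod C g \<and>
    p \<in> Hom C P (Dom C f) \<and> q \<in> Hom C P (Dom C g) \<and> f \<cdot>\<^bsub>C\<^esub> p = g \<cdot>\<^bsub>C\<^esub> q \<and>
    (\<forall>Z. \<forall>u \<in> Hom C Z (Dom C f). \<forall>v \<in> Hom C Z (Dom C g).
      f \<cdot>\<^bsub>C\<^esub> u = g \<cdot>\<^bsub>C\<^esub> v \<longrightarrow>
      (\<exists>!h. h \<in> Hom C Z P \<and> p \<cdot>\<^bsub>C\<^esub> h = u \<and> q \<cdot>\<^bsub>C\<^esub> h = v))"

definition is_product :: "('o, 'a) cat \<Rightarrow> 'o \<Rightarrow> 'o \<Rightarrow> 'o \<Rightarrow> 'a \<Rightarrow> 'a \<Rightarrow> bool" where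
  "is_product C A B P p q \<longleftrightarrow> p \<in> Hom C P A \<and> q \<in> Hom C P B \<and>
    (\<forall>Z. \<forall>u \<in> Hom C Z A. \<forall>v \<in> Hom C Z B.
      (\<exists>!h. h \<in> Hom C Z P \<and> p \<cdot>\<^bsub>C\<^esub> h = u \<and> q \<cdot>\<^bsub>C\<^esub> h = v))"

text \<open>Diagrams are indexed by directed graphs with vertices \<open>V\<close>, edges \<open>W\<close>, source \<open>s\<close> and
  target \<open>t\<close>; a functor on a small category has the same cones as the diagram on its underlying
  graph.\<close>

definition is_diagram ::
  "('o, 'a) cat \<Rightarrow> nat set \<Rightarrow> nat set \<Rightarrow> (nat \<Rightarrow> nat) \<Rightarrow> (nat \<Rightarrow> nat) \<Rightarrow> (nat \<Rightarrow> 'o) \<Rightarrow> (nat \<Rightarrow> 'a) \<Rightarrow> bool"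
  where
  "is_diagram C V W s t D M \<longleftrightarrow> (\<forall>v \<in> V. D v \<in> Obj C) \<and>
    (\<forall>e \<in> W. s e \<in> V \<and> t e \<in> V \<and> M e \<in> Hom C (D (s e)) (D (t e)))"

definition is_cone ::
  "('o, 'a) cat \<Rightarrow> nat set \<Rightarrow> nat set \<Rightarrow> (nat \<Rightarrow> nat) \<Rightarrow> (nat \<Rightarrow> nat) \<Rightarrow> (nat \<Rightarrow> 'o) \<Rightarrow> (nat \<Rightarrow> 'a) \<Rightarrow>
    'o \<Rightarrow> (nat \<Rightarrow> 'a) \<Rightarrow> bool" where
  "is_cone C V W s t D M L p \<longleftrightarrow> L \<in> Obj C \<and> (\<forall>v \<in> V. p v \<in> Hom C L (D v)) \<and>
    (\<forall>e \<in> W. M e \<cdot>\<^bsub>C\<^esub> p (s e) = p (t e))"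

definition is_limit ::
  "('o, 'a) cat \<Rightarrow> nat set \<Rightarrow> nat set \<Rightarrow> (nat \<Rightarrow> nat) \<Rightarrow> (nat \<Rightarrow> nat) \<Rightarrow> (nat \<Rightarrow> 'o) \<Rightarrow> (nat \<Rightarrow> 'a) \<Rightarrow>
    'o \<Rightarrow> (nat \<Rightarrow> 'a) \<Rightarrow> bool" where
  "is_limit C V W s t D M L p \<longleftrightarrow> is_cone C V W s t D M L p \<and>
    (\<forall>K q. is_cone C V W s t D M K q \<longrightarrow>
      (\<exists>!h. h \<in> Hom C K L \<and> (\<forall>v \<in> V. p v \<cdot>\<^bsub>C\<^esub> h = q v)))"

definition finitely_complete :: "('o, 'a) cat \<Rightarrow> bool" where
  "finitely_complete C \<longleftrightarrow>
    (\<forall>V W s t D M. finite V \<and> finite W \<and> is_diagram C V W s t D M \<longrightarrow>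
      (\<exists>L p. is_limit C V W s t D M L p))"

definition regular_category :: "('o, 'a) cat \<Rightarrow> bool" where
  "regular_category C \<longleftrightarrow> finitely_complete C \<and>
    (\<forall>f \<in> Arr C. \<exists>m e. is_mono C m \<and> is_regular_epi C e \<and> Cod C e = Dom C m \<and> m \<cdot>\<^bsub>C\<^esub> e = f) \<and>
    (\<forall>f e P p q. is_regular_epi C e \<and> is_pullback C f e P p q \<longrightarrow> is_regular_epi C p)"

text \<open>The limits below are determined up to isomorphism only; a representative is selected by
  \<open>SOME\<close>, and is meaningful whenever the limit exists.\<close>

definition some_pullback :: "('o, 'a) cat \<Rightarrow> 'a \<Rightarrow> 'a \<Rightarrow> 'o \<times> 'a \<times> 'a" where
  "some_pullback C f g = (SOME (P, p, q). is_pullback C f g P p q)"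

definition pb1 :: "('o, 'a) cat \<Rightarrow> 'a \<Rightarrow> 'a \<Rightarrow> 'a" where
  "pb1 C f g = fst (snd (some_pullback C f g))"

definition pb2 :: "('o, 'a) cat \<Rightarrow> 'a \<Rightarrow> 'a \<Rightarrow> 'a" where
  "pb2 C f g = snd (snd (some_pullback C f g))"

definition some_product :: "('o, 'a) cat \<Rightarrow> 'o \<Rightarrow> 'o \<Rightarrow> 'o \<times> 'a \<times> 'a" where
  "some_product C A B = (SOME (P, p, q). is_product C A B P p q)"

definition prod_obj :: "('o, 'a) cat \<Rightarrow> 'o \<Rightarrow> 'o \<Rightarrow> 'o" where
  "prod_obj C A B = fst (some_product C A B)"

definition pr1 :: "('o, 'a) cat \<Rightarrow> 'o \<Rightarrow> 'o \<Rightarrow> 'a" where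
  "pr1 C A B = fst (snd (some_product C A B))"

definition pr2 :: "('o, 'a) cat \<Rightarrow> 'o \<Rightarrow> 'o \<Rightarrow> 'a" where
  "pr2 C A B = snd (snd (some_product C A B))"

definition pairing :: "('o, 'a) cat \<Rightarrow> 'a \<Rightarrow> 'a \<Rightarrow> 'a" where
  "pairing C f g = (THE h. h \<in> Hom C (Dom C f) (prod_obj C (Cod C f) (Cod C g)) \<and>
    pr1 C (Cod C f) (Cod C g) \<cdot>\<^bsub>C\<^esub> h = f \<and> pr2 C (Cod C f) (Cod C g) \<cdot>\<^bsub>C\<^esub> h = g)"

definition image :: "('o, 'a) cat \<Rightarrow> 'a \<Rightarrow> 'a" where
  "image C f = (SOME m. is_mono C m \<and>
    (\<exists>e. is_regular_epi C e \<and> Cod C e = Dom C m \<and> m \<cdot>\<^bsub>C\<^esub> e = f))"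

section \<open>Subobjects and suprema of chains\<close>

text \<open>A subobject is represented by a monomorphism; isomorphic representatives are those that
  are below each other in the preorder \<open>sub_le\<close>, and all notions below are invariant under
  change of representative.\<close>

definition Subobjects :: "('o, 'a) cat \<Rightarrow> 'o \<Rightarrow> 'a set" where
  "Subobjects C X = {m. is_mono C m \<and> Cod C m = X}"

definition sub_le :: "('o, 'a) cat \<Rightarrow> 'a \<Rightarrow> 'a \<Rightarrow> bool" where
  "sub_le C m n \<longleftrightarrow> (\<exists>k \<in> Hom C (Dom C m) (Dom C n). n \<cdot>\<^bsub>C\<^esub> k = m)"

definition sub_meet :: "('o, 'a) cat \<Rightarrow> 'a \<Rightarrow> 'a \<Rightarrow> 'a" where
  "sub_meet C m n = m \<cdot>\<^bsub>C\<^esub> pb1 C m n"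

definition inverse_image :: "('o, 'a) cat \<Rightarrow> 'a \<Rightarrow> 'a \<Rightarrow> 'a" where
  "inverse_image C g m = pb1 C g m"

definition is_supremum :: "('o, 'a) cat \<Rightarrow> 'a set \<Rightarrow> 'a set \<Rightarrow> 'a \<Rightarrow> bool" where
  "is_supremum C \<K> \<A> s \<longleftrightarrow> s \<in> \<K> \<and> (\<forall>a \<in> \<A>. sub_le C a s) \<and>
    (\<forall>u \<in> \<K>. (\<forall>a \<in> \<A>. sub_le C a u) \<longrightarrow> sub_le C s u)"

definition is_chain :: "('o, 'a) cat \<Rightarrow> 'o \<Rightarrow> (nat \<Rightarrow> 'a) \<Rightarrow> bool" where
  "is_chain C X A \<longleftrightarrow> (\<forall>i. A i \<in> Subobjects C X \<and> sub_le C (A i) (A (Suc i)))"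

definition is_chain_sup :: "('o, 'a) cat \<Rightarrow> 'o \<Rightarrow> (nat \<Rightarrow> 'a) \<Rightarrow> 'a \<Rightarrow> bool" where
  "is_chain_sup C X A s \<longleftrightarrow> is_supremum C (Subobjects C X) (range A) s"

definition has_chain_sups :: "('o, 'a) cat \<Rightarrow> bool" where
  "has_chain_sups C \<longleftrightarrow> (\<forall>X \<in> Obj C. \<forall>A. is_chain C X A \<longrightarrow> (\<exists>s. is_chain_sup C X A s))"

definition chain_sups_stable_split_epi :: "('o, 'a) cat \<Rightarrow> bool" where
  "chain_sups_stable_split_epi C \<longleftrightarrow>
    (\<forall>X \<in> Obj C. \<forall>A s g. is_chain C X A \<and> is_chain_sup C X A s \<and> is_split_epi C g \<and> Cod C g = X \<longrightarrow>
      is_chain_sup C (Dom C g) (\<lambda>i. inverse_image C g (A i)) (inverse_image C g s))"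

definition chain_sups_stable_meet :: "('o, 'a) cat \<Rightarrow> bool" where
  "chain_sups_stable_meet C \<longleftrightarrow>
    (\<forall>X \<in> Obj C. \<forall>A s. \<forall>U \<in> Subobjects C X. is_chain C X A \<and> is_chain_sup C X A s \<longrightarrow>
      is_chain_sup C X (\<lambda>i. sub_meet C (A i) U) (sub_meet C s U))"

text \<open>In the next two definitions \<open>Fo\<close> and \<open>Fa\<close> are the object and arrow parts of a functor
  from \<open>C\<close> to \<open>D\<close>.\<close>

definition preserves_chain_sups ::
  "('o, 'a) cat \<Rightarrow> ('p, 'b) cat \<Rightarrow> ('o \<Rightarrow> 'p) \<Rightarrow> ('a \<Rightarrow> 'b) \<Rightarrow> bool" where
  "preserves_chain_sups C D Fo Fa \<longleftrightarrow>
    (\<forall>X \<in> Obj C. \<forall>A s. is_chain C X A \<and> is_chain_sup C X A s \<longrightarrow>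
      is_chain D (Fo X) (\<lambda>i. Fa (A i)) \<and> is_chain_sup D (Fo X) (\<lambda>i. Fa (A i)) (Fa s))"

definition reflects_chain_sups ::
  "('o, 'a) cat \<Rightarrow> ('p, 'b) cat \<Rightarrow> ('o \<Rightarrow> 'p) \<Rightarrow> ('a \<Rightarrow> 'b) \<Rightarrow> bool" where
  "reflects_chain_sups C D Fo Fa \<longleftrightarrow>
    (\<forall>X \<in> Obj C. \<forall>A. \<forall>s \<in> Subobjects C X.
      is_chain C X A \<and> is_chain_sup D (Fo X) (\<lambda>i. Fa (A i)) (Fa s) \<longrightarrow> is_chain_sup C X A s)"

section \<open>Internal relations\<close>

definition Relations :: "('o, 'a) cat \<Rightarrow> 'o \<Rightarrow> 'a set" where
  "Relations C X = Subobjects C (prod_obj C X X)"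

definition diag :: "('o, 'a) cat \<Rightarrow> 'o \<Rightarrow> 'a" where
  "diag C X = pairing C (Id C X) (Id C X)"

definition rel_op :: "('o, 'a) cat \<Rightarrow> 'o \<Rightarrow> 'a \<Rightarrow> 'a" where
  "rel_op C X r = pairing C (pr2 C X X \<cdot>\<^bsub>C\<^esub> r) (pr1 C X X \<cdot>\<^bsub>C\<^esub> r)"

text \<open>\<open>rel_comp C X s r\<close> is the composite \<open>s \<circ> r\<close>: first \<open>r\<close>, then \<open>s\<close>.\<close>

definition rel_comp :: "('o, 'a) cat \<Rightarrow> 'o \<Rightarrow> 'a \<Rightarrow> 'a \<Rightarrow> 'a" where
  "rel_comp C X s r =
    (let f = pr2 C X X \<cdot>\<^bsub>C\<^esub> r; g = pr1 C X X \<cdot>\<^bsub>C\<^esub> s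
     in image C (pairing C (pr1 C X X \<cdot>\<^bsub>C\<^esub> r \<cdot>\<^bsub>C\<^esub> pb1 C f g) (pr2 C X X \<cdot>\<^bsub>C\<^esub> s \<cdot>\<^bsub>C\<^esub> pb2 C f g)))"

definition Reflexive_Relations :: "('o, 'a) cat \<Rightarrow> 'o \<Rightarrow> 'a set" where
  "Reflexive_Relations C X = {r \<in> Relations C X. sub_le C (diag C X) r}"

definition Preorders :: "('o, 'a) cat \<Rightarrow> 'o \<Rightarrow> 'a set" where
  "Preorders C X = {r \<in> Reflexive_Relations C X. sub_le C (rel_comp C X r r) r}"

definition Equivalences :: "('o, 'a) cat \<Rightarrow> 'o \<Rightarrow> 'a set" where
  "Equivalences C X = {r \<in> Preorders C X. sub_le C (rel_op C X r) r}"

fun alternating :: "('o, 'a) cat \<Rightarrow> 'o \<Rightarrow> 'a \<Rightarrow> 'a \<Rightarrow> nat \<Rightarrow> 'a" where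
  "alternating C X t s 0 = diag C X"
| "alternating C X t s (Suc 0) = t"
| "alternating C X t s (Suc (Suc n)) = rel_comp C X t (alternating C X s t (Suc n))"

text \<open>The formula \<open>(T \<or> S) \<inter> R = \<Sigma>\<^sub>i ((T,S)\<^sub>i \<inter> R)\<close> for relations in a class
  \<open>K X\<close> (preorders or equivalence relations): the join \<open>T \<or> S\<close> in \<open>K X\<close> exists, and its
  meet with \<open>R\<close>, which is again in \<open>K X\<close>, is the supremum on the right-hand side.\<close>

definition alternating_join_formula :: "('o, 'a) cat \<Rightarrow> ('o \<Rightarrow> 'a set) \<Rightarrow> bool" where
  "alternating_join_formula C K \<longleftrightarrow>
    (\<forall>X \<in> Obj C. \<forall>T \<in> K X. \<forall>S \<in> K X. \<forall>R \<in> K X.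
      (\<exists>J. is_supremum C (K X) {T, S} J) \<and>
      (\<forall>J. is_supremum C (K X) {T, S} J \<longrightarrow>
        sub_meet C J R \<in> K X \<and>
        is_supremum C (Reflexive_Relations C X)
          (range (\<lambda>i. sub_meet C (alternating C X T S i) R)) (sub_meet C J R)))"

section \<open>Internal algebras of a finitary theory\<close>

datatype 'f trm = Var nat | Op 'f "'f trm list"

text \<open>An equation \<open>(n, s, t)\<close> is the identity \<open>s = t\<close> in the context of the \<open>n\<close> variables
  \<open>Var 0, \<dots>, Var (n - 1)\<close>. The context is explicit since an internal algebra need not
  have global support.\<close>

record 'f alg_theory =
  Ops :: "'f set"
  arity :: "'f \<Rightarrow> nat"
  Eqs :: "(nat \<times> 'f trm \<times> 'f trm) set"

inductive wf_trm :: "'f alg_theory \<Rightarrow> nat \<Rightarrow> 'f trm \<Rightarrow> bool" for Th n where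
  "i < n \<Longrightarrow> wf_trm Th n (Var i)"
| "f \<in> Ops Th \<Longrightarrow> length ts = arity Th f \<Longrightarrow> (\<And>t. t \<in> set ts \<Longrightarrow> wf_trm Th n t) \<Longrightarrow>
    wf_trm Th n (Op f ts)"

definition is_alg_theory :: "'f alg_theory \<Rightarrow> bool" where
  "is_alg_theory Th \<longleftrightarrow> (\<forall>(n, s, t) \<in> Eqs Th. wf_trm Th n s \<and> wf_trm Th n t)"

definition is_power :: "('o, 'a) cat \<Rightarrow> 'o \<Rightarrow> nat \<Rightarrow> 'o \<Rightarrow> (nat \<Rightarrow> 'a) \<Rightarrow> bool" where
  "is_power C X n P \<pi> \<longleftrightarrow> P \<in> Obj C \<and> (\<forall>i < n. \<pi> i \<in> Hom C P X) \<and>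
    (\<forall>Z \<in> Obj C. \<forall>u. (\<forall>i < n. u i \<in> Hom C Z X) \<longrightarrow>
      (\<exists>!h. h \<in> Hom C Z P \<and> (\<forall>i < n. \<pi> i \<cdot>\<^bsub>C\<^esub> h = u i)))"

definition some_power :: "('o, 'a) cat \<Rightarrow> 'o \<Rightarrow> nat \<Rightarrow> 'o \<times> (nat \<Rightarrow> 'a)" where
  "some_power C X n = (SOME (P, \<pi>). is_power C X n P \<pi>)"

definition pow_obj :: "('o, 'a) cat \<Rightarrow> 'o \<Rightarrow> nat \<Rightarrow> 'o" where
  "pow_obj C X n = fst (some_power C X n)"

definition pow_proj :: "('o, 'a) cat \<Rightarrow> 'o \<Rightarrow> nat \<Rightarrow> nat \<Rightarrow> 'a" where
  "pow_proj C X n = snd (some_power C X n)"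

definition tupling :: "('o, 'a) cat \<Rightarrow> 'o \<Rightarrow> 'o \<Rightarrow> nat \<Rightarrow> (nat \<Rightarrow> 'a) \<Rightarrow> 'a" where
  "tupling C Z X n u = (THE h. h \<in> Hom C Z (pow_obj C X n) \<and>
    (\<forall>i < n. pow_proj C X n i \<cdot>\<^bsub>C\<^esub> h = u i))"

definition pow_map :: "('o, 'a) cat \<Rightarrow> nat \<Rightarrow> 'a \<Rightarrow> 'a" where
  "pow_map C n h = tupling C (pow_obj C (Dom C h) n) (Cod C h) n
    (\<lambda>i. h \<cdot>\<^bsub>C\<^esub> pow_proj C (Dom C h) n i)"

primrec trm_arrow ::
  "('o, 'a) cat \<Rightarrow> 'f alg_theory \<Rightarrow> 'o \<Rightarrow> ('f \<Rightarrow> 'a) \<Rightarrow> nat \<Rightarrow> 'f trm \<Rightarrow> 'a" where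
  "trm_arrow C Th X \<alpha> n (Var i) = pow_proj C X n i"
| "trm_arrow C Th X \<alpha> n (Op f ts) =
    \<alpha> f \<cdot>\<^bsub>C\<^esub> tupling C (pow_obj C X n) X (arity Th f) (\<lambda>i. map (trm_arrow C Th X \<alpha> n) ts ! i)"

definition is_algebra :: "('o, 'a) cat \<Rightarrow> 'f alg_theory \<Rightarrow> 'o \<times> ('f \<Rightarrow> 'a) \<Rightarrow> bool" where
  "is_algebra C Th = (\<lambda>(X, \<alpha>). X \<in> Obj C \<and>
    (\<forall>f \<in> Ops Th. \<alpha> f \<in> Hom C (pow_obj C X (arity Th f)) X) \<and>
    (\<forall>f. f \<notin> Ops Th \<longrightarrow> \<alpha> f = undefined) \<and>
    (\<forall>(n, s, t) \<in> Eqs Th. trm_arrow C Th X \<alpha> n s = trm_arrow C Th X \<alpha> n t))"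

definition is_algebra_hom ::
  "('o, 'a) cat \<Rightarrow> 'f alg_theory \<Rightarrow> 'o \<times> ('f \<Rightarrow> 'a) \<Rightarrow> 'a \<Rightarrow> 'o \<times> ('f \<Rightarrow> 'a) \<Rightarrow> bool" where
  "is_algebra_hom C Th A h B \<longleftrightarrow> h \<in> Hom C (fst A) (fst B) \<and>
    (\<forall>f \<in> Ops Th. h \<cdot>\<^bsub>C\<^esub> snd A f = snd B f \<cdot>\<^bsub>C\<^esub> pow_map C (arity Th f) h)"

type_synonym ('o, 'a, 'f) alg = "'o \<times> ('f \<Rightarrow> 'a)"

type_synonym ('o, 'a, 'f) alg_arr = "('o, 'a, 'f) alg \<times> 'a \<times> ('o, 'a, 'f) alg"

definition Alg ::
  "'f alg_theory \<Rightarrow> ('o, 'a) cat \<Rightarrow> (('o, 'a, 'f) alg, ('o, 'a, 'f) alg_arr) cat" where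
  "Alg Th C = \<lparr>
    Obj = {A. is_algebra C Th A},
    Arr = {(A, h, B). is_algebra C Th A \<and> is_algebra C Th B \<and> is_algebra_hom C Th A h B},
    Dom = (\<lambda>(A, h, B). A),
    Cod = (\<lambda>(A, h, B). B),
    Id = (\<lambda>A. (A, Id C (fst A), A)),
    Comp = (\<lambda>(B, g, D) (A, h, B'). (A, g \<cdot>\<^bsub>C\<^esub> h, D))\<rparr>"

definition U_obj :: "('o, 'a, 'f) alg \<Rightarrow> 'o" where
  "U_obj A = fst A"

definition U_arr :: "('o, 'a, 'f) alg_arr \<Rightarrow> 'a" where
  "U_arr h = fst (snd h)"

section \<open>Elementary toposes\<close>

definition is_exponential :: "('o, 'a) cat \<Rightarrow> 'o \<Rightarrow> 'o \<Rightarrow> 'o \<Rightarrow> 'a \<Rightarrow> bool" where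
  "is_exponential C A B Y ev \<longleftrightarrow> Y \<in> Obj C \<and> ev \<in> Hom C (prod_obj C Y A) B \<and>
    (\<forall>Z \<in> Obj C. \<forall>f \<in> Hom C (prod_obj C Z A) B.
      (\<exists>!h. h \<in> Hom C Z Y \<and> ev \<cdot>\<^bsub>C\<^esub> pairing C (h \<cdot>\<^bsub>C\<^esub> pr1 C Z A) (pr2 C Z A) = f))"

definition is_subobject_classifier :: "('o, 'a) cat \<Rightarrow> 'o \<Rightarrow> 'a \<Rightarrow> bool" where
  "is_subobject_classifier C \<Omega> tr \<longleftrightarrow>
    tr \<in> Arr C \<and> Cod C tr = \<Omega> \<and> is_terminal C (Dom C tr) \<and>
    (\<forall>m. is_mono C m \<longrightarrow>
      (\<exists>!\<chi>. \<chi> \<in> Hom C (Cod C m) \<Omega> \<and> (\<exists>b. is_pullback C \<chi> tr (Dom C m) m b)))"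

definition elementary_topos :: "('o, 'a) cat \<Rightarrow> bool" where
  "elementary_topos C \<longleftrightarrow> finitely_complete C \<and>
    (\<forall>A \<in> Obj C. \<forall>B \<in> Obj C. \<exists>Y ev. is_exponential C A B Y ev) \<and>
    (\<exists>\<Omega> tr. is_subobject_classifier C \<Omega> tr)"

end

theory Submission
  imports Defs
begin

text \<open>Everything is argued with generalized elements: for an arbitrary arrow \<open>x\<close>, \<open>sub_le C x m\<close> says
  that \<open>x\<close> belongs to \<open>m\<close>, and subobjects are compared through the elements they contain.

  The key step is that for finitely many split epimorphisms \<open>g\<^sub>1, \<dots>, g\<^sub>n\<close> on \<open>P\<close> the intersection of
  the subobjects \<open>g\<^sub>k\<^sup>*(\<Sigma>\<^sub>i A\<^sub>i)\<close> is the supremum of the intersections of the \<open>g\<^sub>k\<^sup>*(A\<^sub>i)\<close>. For the projections of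
  \<open>X\<^sup>n\<close> it shows that the supremum of a chain of subalgebras is closed under the operations, whence the
  claims on \<open>\<T>(\<E>)\<close>. For the two projections \<open>X \<times> X \<times> X \<rightarrow> X \<times> X\<close> it shows that the supremum of the
  relations \<open>(T,S)\<^sub>i\<close> is transitive; this supremum is therefore \<open>T \<or> S\<close>, and stability under
  intersection gives the formula. Regularity passes to algebras because finite powers of a regular
  epimorphism are locally surjective.

  In a topos, universal quantification along an arbitrary arrow makes inverse images preserve suprema
  and makes strong epimorphisms stable under pullback; images are obtained impredicatively from
  power objects, and every strong epimorphism is then the coequalizer of its kernel pair.\<close>

section \<open>Generalized elements and finite limits\<close>

text \<open>A supremum \<open>s\<close> of a chain has no pointwise description here: a generalized
  element of \<open>s\<close> need not lie in some \<open>A i\<close>, not even after passing to a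
  cover. So facts about the elements of \<open>s\<close> cannot be proved by choosing a stage; a
  property is instead encoded as a subobject \<open>v\<close>, and the inclusion in \<open>v\<close>
  is checked on the stages. The hypotheses exchange suprema only with split epimorphisms and
  intersections, never with an operation X^n -> X; operations enter through an inverse image of
  \<open>s\<close> alone, whose formation asks for no stability. Finiteness of arities matters
  because finitely many stages have a common upper bound. The formula for algebras is not obtained
  by carrying relations along the forgetful functor. The argument for a regular category is run a
  second time with \<T>(\<E>) in place of \<E>, which requires \<T>(\<E>) to be regular and its
  suprema to be stable along split epimorphisms as well.\<close>

context category begin

abbreviation le (infix "\<sqsubseteq>" 50) where "x \<sqsubseteq> m \<equiv> sub_le C x m"

lemma Hom_iff [simp]: "f \<in> Hom C a b \<longleftrightarrow> f \<in> Arr C \<and> Dom C f = a \<and> Cod C f = b"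
  by (simp add: Hom_def)

lemma arr_obj [simp]:
  assumes "f \<in> Arr C"
  shows "Dom C f \<in> Obj C" "Cod C f \<in> Obj C"
  using assms dom_obj cod_obj by auto

lemma id_arr [simp]:
  assumes "a \<in> Obj C"
  shows "Id C a \<in> Arr C" "Dom C (Id C a) = a" "Cod C (Id C a) = a"
  using id_hom[OF assms] by auto

lemma comp_arr [simp]:
  assumes "f \<in> Arr C" "g \<in> Arr C" "Cod C f = Dom C g"
  shows "g \<cdot> f \<in> Arr C" "Dom C (g \<cdot> f) = Dom C f" "Cod C (g \<cdot> f) = Cod C g"
  using comp_hom[of f "Dom C f" "Cod C f" g "Cod C g"] assms by auto

lemma comp_id [simp]:
  assumes "f \<in> Arr C"
  shows "Cod C f = b \<Longrightarrow> Id C b \<cdot> f = f" "Dom C f = a \<Longrightarrow> f \<cdot> Id C a = f"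
  using id_left[of f "Dom C f" b] id_right[of f a "Cod C f"] assms by auto

lemma comp_assoc [simp]:
  assumes "f \<in> Arr C" "g \<in> Arr C" "h \<in> Arr C" "Cod C f = Dom C g" "Cod C g = Dom C h"
  shows "(h \<cdot> g) \<cdot> f = h \<cdot> g \<cdot> f"
  using assoc[of f "Dom C f" "Dom C g" g "Dom C h" h "Cod C h"] assms by auto

text \<open>Composites are normalized to right-nested form, so an equation between two-fold
  composites has to be applied at the head of a longer one. This lemma and
  \<open>square_comp\<close> do that.\<close>

lemma comp_assoc_subst:
  assumes "h \<cdot> g = k" "f \<in> Arr C" "g \<in> Arr C" "h \<in> Arr C" "Cod C f = Dom C g" "Cod C g = Dom C h"
  shows "h \<cdot> g \<cdot> f = k \<cdot> f"
  using assms comp_assoc by metis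

lemma square_comp:
  assumes "f \<cdot> a = g \<cdot> b" "w \<in> Arr C" "a \<in> Arr C" "b \<in> Arr C" "f \<in> Arr C" "g \<in> Arr C"
    "Cod C w = Dom C a" "Cod C w = Dom C b" "Cod C a = Dom C f" "Cod C b = Dom C g"
  shows "f \<cdot> a \<cdot> w = g \<cdot> b \<cdot> w"
  using assms comp_assoc by metis

lemma monoD [simp]: "is_mono C m \<Longrightarrow> m \<in> Arr C"
  by (simp add: is_mono_def)

lemma mono_cancel:
  assumes "is_mono C m" "m \<cdot> u = m \<cdot> v" "u \<in> Arr C" "v \<in> Arr C" "Dom C u = Dom C v"
    "Cod C u = Dom C m" "Cod C v = Dom C m"
  shows "u = v"
  using assms unfolding is_mono_def by auto

lemma mono_comp:
  assumes "is_mono C m" "is_mono C n" "Cod C n = Dom C m"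
  shows "is_mono C (m \<cdot> n)"
  unfolding is_mono_def
proof (intro conjI allI ballI impI)
  show "m \<cdot> n \<in> Arr C" using assms by simp
  fix Z u v assume *: "u \<in> Hom C Z (Dom C (m \<cdot> n))" "v \<in> Hom C Z (Dom C (m \<cdot> n))"
    "(m \<cdot> n) \<cdot> u = (m \<cdot> n) \<cdot> v"
  have "n \<cdot> u = n \<cdot> v"
    by (rule mono_cancel[OF assms(1)]) (use * assms in simp_all)
  show "u = v"
    by (rule mono_cancel[OF assms(2)]) (use * assms \<open>n \<cdot> u = n \<cdot> v\<close> in simp_all)
qed

lemma mono_id [simp]: "a \<in> Obj C \<Longrightarrow> is_mono C (Id C a)"
  unfolding is_mono_def by auto

lemma mono_left_cancel:
  assumes "is_mono C (g \<cdot> f)" "f \<in> Arr C" "g \<in> Arr C" "Cod C f = Dom C g"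
  shows "is_mono C f"
  unfolding is_mono_def
proof (intro conjI allI ballI impI)
  show "f \<in> Arr C" by fact
  fix Z u v assume *: "u \<in> Hom C Z (Dom C f)" "v \<in> Hom C Z (Dom C f)" "f \<cdot> u = f \<cdot> v"
  have "(g \<cdot> f) \<cdot> u = (g \<cdot> f) \<cdot> v" using * assms by simp
  show "u = v"
    by (rule mono_cancel[OF assms(1)]) (use * \<open>(g \<cdot> f) \<cdot> u = (g \<cdot> f) \<cdot> v\<close> assms in simp_all)
qed

lemma sub_leI:
  assumes "k \<in> Arr C" "Cod C k = Dom C n" "n \<in> Arr C"
  shows "n \<cdot> k \<sqsubseteq> n"
  using assms unfolding sub_le_def by (intro bexI[of _ k]) simp_all

lemma sub_leE:
  assumes "x \<sqsubseteq> m" "m \<in> Arr C"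
  obtains k where "k \<in> Arr C" "Dom C k = Dom C x" "Cod C k = Dom C m" "m \<cdot> k = x"
    "x \<in> Arr C" "Cod C x = Cod C m"
proof -
  obtain k where "k \<in> Hom C (Dom C x) (Dom C m)" "m \<cdot> k = x"
    using assms unfolding sub_le_def by blast
  with assms show ?thesis by (intro that[of k]) auto
qed

lemma sub_leD:
  assumes "x \<sqsubseteq> m" "m \<in> Arr C"
  shows "x \<in> Arr C" "Cod C x = Cod C m"
  using assms by (metis sub_leE)+

lemma sub_le_refl [simp]: "m \<in> Arr C \<Longrightarrow> m \<sqsubseteq> m"
  using sub_leI[of "Id C (Dom C m)" m] by simp

lemma sub_le_comp:
  assumes "x \<sqsubseteq> m" "m \<in> Arr C" "z \<in> Arr C" "Cod C z = Dom C x"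
  shows "x \<cdot> z \<sqsubseteq> m"
  using assms(1,2)
proof (rule sub_leE)
  fix k assume k: "k \<in> Arr C" "Dom C k = Dom C x" "Cod C k = Dom C m" "m \<cdot> k = x"
  then have "x \<cdot> z = m \<cdot> (k \<cdot> z)" using assms by (metis comp_assoc)
  then show ?thesis using assms k by (simp add: sub_leI)
qed

lemma sub_le_trans:
  assumes "x \<sqsubseteq> m" "m \<sqsubseteq> n" "n \<in> Arr C"
  shows "x \<sqsubseteq> n"
proof -
  have m: "m \<in> Arr C" using assms sub_leD by blast
  obtain k where "k \<in> Arr C" "Dom C k = Dom C x" "Cod C k = Dom C m" "m \<cdot> k = x"
    using assms(1) m by (rule sub_leE)
  then show ?thesis using sub_le_comp[OF assms(2,3), of k] by simp
qed

lemma split_epiI: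
  assumes "g \<in> Arr C" "s \<in> Hom C (Cod C g) (Dom C g)" "g \<cdot> s = Id C (Cod C g)"
  shows "is_split_epi C g"
  using assms unfolding is_split_epi_def by blast

lemma pullbackD:
  assumes "is_pullback C f g P p q"
  shows "f \<in> Arr C" "g \<in> Arr C" "Cod C f = Cod C g" "p \<in> Arr C" "q \<in> Arr C" "Dom C p = P" "Dom C q = P"
    "Cod C p = Dom C f" "Cod C q = Dom C g" "f \<cdot> p = g \<cdot> q" "P \<in> Obj C"
  using assms by (auto simp: is_pullback_def)

lemma pullback_comm:
  assumes "is_pullback C f g P p q" "w \<in> Arr C" "Cod C w = P"
  shows "f \<cdot> p \<cdot> w = g \<cdot> q \<cdot> w"
  using comp_assoc_subst[OF pullbackD(10)[OF assms(1)], of w] pullbackD[OF assms(1)] assms by auto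

lemma pullback_lift:
  assumes "is_pullback C f g P p q" "u \<in> Arr C" "v \<in> Arr C" "Dom C u = Dom C v" "Cod C u = Dom C f"
    "Cod C v = Dom C g" "f \<cdot> u = g \<cdot> v"
  obtains h where "h \<in> Arr C" "Dom C h = Dom C u" "Cod C h = P" "p \<cdot> h = u" "q \<cdot> h = v"
  using assms unfolding is_pullback_def by (metis Hom_iff)

lemma pullback_unique:
  assumes "is_pullback C f g P p q" "h \<in> Arr C" "k \<in> Arr C" "Dom C h = Dom C k" "Cod C h = P"
    "Cod C k = P" "p \<cdot> h = p \<cdot> k" "q \<cdot> h = q \<cdot> k"
  shows "h = k"
proof -
  note P = pullbackD[OF assms(1)]
  have "f \<cdot> (p \<cdot> k) = g \<cdot> (q \<cdot> k)"
    using assms by (intro pullback_comm) auto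
  moreover have "p \<cdot> k \<in> Hom C (Dom C k) (Dom C f)" "q \<cdot> k \<in> Hom C (Dom C k) (Dom C g)"
    using assms P by auto
  ultimately have "\<exists>!h. h \<in> Hom C (Dom C k) P \<and> p \<cdot> h = p \<cdot> k \<and> q \<cdot> h = q \<cdot> k"
    using assms(1) unfolding is_pullback_def by blast
  then show ?thesis using assms by auto
qed

lemma pullback_mono:
  assumes "is_pullback C g m P p q" "is_mono C m"
  shows "is_mono C p"
  unfolding is_mono_def
proof (intro conjI allI ballI impI)
  note P = pullbackD[OF assms(1)]
  show "p \<in> Arr C" using P by simp
  fix Z u v assume *: "u \<in> Hom C Z (Dom C p)" "v \<in> Hom C Z (Dom C p)" "p \<cdot> u = p \<cdot> v"
  have "m \<cdot> (q \<cdot> u) = m \<cdot> (q \<cdot> v)"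
    using * P pullback_comm[OF assms(1), of u] pullback_comm[OF assms(1), of v] by auto
  have "q \<cdot> u = q \<cdot> v"
    by (rule mono_cancel[OF assms(2)]) (use * P \<open>m \<cdot> (q \<cdot> u) = m \<cdot> (q \<cdot> v)\<close> in simp_all)
  show "u = v"
    by (rule pullback_unique[OF assms(1)]) (use * P \<open>q \<cdot> u = q \<cdot> v\<close> in simp_all)
qed

text \<open>Membership in a pullback is the existence half of its universal property, hence makes
  sense for any arrow \<open>m\<close>. Inverse images, equalizers and inverse images of subalgebras
  are all reduced to it.\<close>

lemma pullback_sub_le:
  assumes "is_pullback C g m P p q"
  shows "x \<sqsubseteq> p \<longleftrightarrow> x \<in> Arr C \<and> Cod C x = Dom C g \<and> g \<cdot> x \<sqsubseteq> m"
proof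
  note P = pullbackD[OF assms(1)]
  assume x: "x \<sqsubseteq> p"
  obtain k where k: "k \<in> Arr C" "Dom C k = Dom C x" "Cod C k = Dom C p" "p \<cdot> k = x"
    "x \<in> Arr C" "Cod C x = Cod C p" by (rule sub_leE[OF x P(4)])
  have "g \<cdot> x = m \<cdot> (q \<cdot> k)" using pullback_comm[OF assms, of k] k P by auto
  then show "x \<in> Arr C \<and> Cod C x = Dom C g \<and> g \<cdot> x \<sqsubseteq> m"
    using k P by (auto intro: sub_leI)
next
  note P = pullbackD[OF assms(1)]
  assume x: "x \<in> Arr C \<and> Cod C x = Dom C g \<and> g \<cdot> x \<sqsubseteq> m"
  obtain k where k: "k \<in> Arr C" "Dom C k = Dom C (g \<cdot> x)" "Cod C k = Dom C m" "m \<cdot> k = g \<cdot> x"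
    using sub_leE[OF _ P(2)] x by metis
  obtain h where "h \<in> Arr C" "Dom C h = Dom C x" "Cod C h = P" "p \<cdot> h = x" "q \<cdot> h = k"
    by (rule pullback_lift[OF assms, of x k]) (use x k P in simp_all)
  then show "x \<sqsubseteq> p" using sub_leI[of h p] P by auto
qed

lemma pullback_meet_le:
  assumes "is_pullback C m n P p q"
  shows "x \<sqsubseteq> m \<cdot> p \<longleftrightarrow> x \<sqsubseteq> m \<and> x \<sqsubseteq> n"
proof
  note P = pullbackD[OF assms]
  have "m \<cdot> p \<sqsubseteq> m" "n \<cdot> q \<sqsubseteq> n" using P(1-9) by (simp_all add: sub_leI)
  then show "x \<sqsubseteq> m \<and> x \<sqsubseteq> n" if "x \<sqsubseteq> m \<cdot> p"
    using that P(1,2,10) sub_le_trans by metis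
next
  note P = pullbackD[OF assms]
  assume x: "x \<sqsubseteq> m \<and> x \<sqsubseteq> n"
  then obtain k where k: "k \<in> Arr C" "Dom C k = Dom C x" "Cod C k = Dom C m" "m \<cdot> k = x"
    using P(1) sub_leE by metis
  then have "k \<sqsubseteq> p"
    using x pullback_sub_le[OF assms, of k] by simp
  then obtain j where "j \<in> Arr C" "Cod C j = P" "p \<cdot> j = k"
    using P(4,6) sub_leE by metis
  then have "x = (m \<cdot> p) \<cdot> j" using P(1-9) k by simp
  then show "x \<sqsubseteq> m \<cdot> p"
    using P \<open>j \<in> Arr C\<close> \<open>Cod C j = P\<close> by (metis sub_leI comp_arr)
qed

text \<open>Monicity becomes a finite limit condition, which any functor preserving pullbacks
  carries along; see \<open>alg_mono_iff\<close>.\<close>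

lemma mono_iff_pullback:
  assumes "m \<in> Arr C"
  shows "is_mono C m \<longleftrightarrow> is_pullback C m m (Dom C m) (Id C (Dom C m)) (Id C (Dom C m))"
proof -
  have "(\<exists>!h. h \<in> Hom C Z (Dom C m) \<and> Id C (Dom C m) \<cdot> h = u \<and> Id C (Dom C m) \<cdot> h = v) \<longleftrightarrow> u = v"
    if "u \<in> Hom C Z (Dom C m)" "v \<in> Hom C Z (Dom C m)" for Z u v
    using that by (metis Hom_iff comp_id(1))
  moreover have "Id C (Dom C m) \<in> Hom C (Dom C m) (Dom C m)" "m \<cdot> Id C (Dom C m) = m \<cdot> Id C (Dom C m)"
    using assms by simp_all
  ultimately show ?thesis using assms unfolding is_mono_def is_pullback_def by blast
qed

text \<open>The vertices 0, 1, 2 carry the two domains and the common codomain; the edges 0 and 1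
  both end at 2. One direction extracts pullbacks from completeness, both together carry pullbacks
  of algebras to the base.\<close>

lemma pullback_iff_limit:
  assumes "f \<in> Arr C" "g \<in> Arr C" "Cod C f = Cod C g"
  shows "is_limit C {0,1,2} {0,1} (\<lambda>i. i) (\<lambda>_. 2)
      (\<lambda>i. if i = 0 then Dom C f else if i = 1 then Dom C g else Cod C f)
      (\<lambda>i. if i = 0 then f else g) P r \<longleftrightarrow>
    is_pullback C f g P (r 0) (r 1) \<and> r 2 = f \<cdot> r 0" (is "is_limit C ?V ?W ?s ?t ?D ?M P r \<longleftrightarrow> ?R")
proof -
  have cone: "is_cone C ?V ?W ?s ?t ?D ?M K q \<longleftrightarrow> q 0 \<in> Hom C K (Dom C f) \<and> q 1 \<in> Hom C K (Dom C g) \<and>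
    f \<cdot> q 0 = g \<cdot> q 1 \<and> q 2 = f \<cdot> q 0" for K q
    using assms by (auto simp: is_cone_def)
  show ?thesis
  proof
    assume L: "is_limit C ?V ?W ?s ?t ?D ?M P r"
    then have c: "is_cone C ?V ?W ?s ?t ?D ?M P r" by (simp add: is_limit_def)
    have "\<exists>!h. h \<in> Hom C Z P \<and> r 0 \<cdot> h = u \<and> r 1 \<cdot> h = v"
      if uv: "u \<in> Hom C Z (Dom C f)" "v \<in> Hom C Z (Dom C g)" "f \<cdot> u = g \<cdot> v" for Z u v
    proof -
      let ?q = "\<lambda>i::nat. if i = 0 then u else if i = 1 then v else f \<cdot> u"
      have "is_cone C ?V ?W ?s ?t ?D ?M Z ?q" using cone uv by auto
      then have "\<exists>!h. h \<in> Hom C Z P \<and> (\<forall>i\<in>?V. r i \<cdot> h = ?q i)"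
        using L unfolding is_limit_def by blast
      moreover have "(\<forall>i\<in>?V. r i \<cdot> h = ?q i) \<longleftrightarrow> r 0 \<cdot> h = u \<and> r 1 \<cdot> h = v" if "h \<in> Hom C Z P" for h
        using c that assms square_comp[of f "r 0" g "r 1" h] unfolding cone by auto
      ultimately show ?thesis by (metis (no_types, lifting))
    qed
    then show ?R using c assms unfolding cone is_pullback_def by blast
  next
    assume R: ?R
    have c: "is_cone C ?V ?W ?s ?t ?D ?M P r" using R unfolding cone is_pullback_def by blast
    have "\<exists>!h. h \<in> Hom C K P \<and> (\<forall>i\<in>?V. r i \<cdot> h = q i)" if q: "is_cone C ?V ?W ?s ?t ?D ?M K q" for K q
    proof -
      have "\<exists>!h. h \<in> Hom C K P \<and> r 0 \<cdot> h = q 0 \<and> r 1 \<cdot> h = q 1"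
        using R q unfolding cone is_pullback_def by blast
      moreover have "(\<forall>i\<in>?V. r i \<cdot> h = q i) \<longleftrightarrow> r 0 \<cdot> h = q 0 \<and> r 1 \<cdot> h = q 1" if "h \<in> Hom C K P" for h
        using c q that assms square_comp[of f "r 0" g "r 1" h] unfolding cone by auto
      ultimately show ?thesis by (metis (no_types, lifting))
    qed
    then show "is_limit C ?V ?W ?s ?t ?D ?M P r" using c unfolding is_limit_def by blast
  qed
qed

end

lemma (in category) mem_Subobjects [simp]: "m \<in> Subobjects C X \<longleftrightarrow> is_mono C m \<and> Cod C m = X"
  by (simp add: Subobjects_def)

section \<open>Chosen pullbacks, products and powers\<close>

locale complete_category = category +
  assumes finitely_complete: "finitely_complete C"
begin

lemma ex_limit:
  assumes "finite V" "finite W" "is_diagram C V W s t D M"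
  obtains L p where "is_limit C V W s t D M L p"
  using assms finitely_complete unfolding finitely_complete_def by blast

lemma ex_pullback:
  assumes "f \<in> Arr C" "g \<in> Arr C" "Cod C f = Cod C g"
  obtains P p q where "is_pullback C f g P p q"
proof -
  have d: "is_diagram C {0,1,2} {0,1} (\<lambda>i. i) (\<lambda>_. 2)
      (\<lambda>i. if i = 0 then Dom C f else if i = 1 then Dom C g else Cod C f)
      (\<lambda>i. if i = 0 then f else g)"
    using assms by (simp add: is_diagram_def)
  obtain L r where "is_limit C {0,1,2} {0,1} (\<lambda>i. i) (\<lambda>_. 2)
      (\<lambda>i. if i = 0 then Dom C f else if i = 1 then Dom C g else Cod C f)
      (\<lambda>i. if i = 0 then f else g) L r"
    using ex_limit[OF _ _ d] by blast
  then show ?thesis using that assms pullback_iff_limit by blast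
qed

lemma pb_pullback:
  assumes "f \<in> Arr C" "g \<in> Arr C" "Cod C f = Cod C g"
  shows "is_pullback C f g (Dom C (pb1 C f g)) (pb1 C f g) (pb2 C f g)"
proof -
  have "\<exists>x. case x of (P, p, q) \<Rightarrow> is_pullback C f g P p q"
    using ex_pullback[OF assms] by (metis case_prod_conv)
  from someI_ex[OF this] have "case some_pullback C f g of (P, p, q) \<Rightarrow> is_pullback C f g P p q"
    unfolding some_pullback_def .
  then have "is_pullback C f g (fst (some_pullback C f g)) (pb1 C f g) (pb2 C f g)"
    unfolding pb1_def pb2_def by (simp add: case_prod_beta)
  then show ?thesis using pullbackD(6) by metis
qed

lemma pb_arr [simp]:
  assumes "f \<in> Arr C" "g \<in> Arr C" "Cod C f = Cod C g"
  shows "pb1 C f g \<in> Arr C" "pb2 C f g \<in> Arr C" "Dom C (pb2 C f g) = Dom C (pb1 C f g)"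
    "Cod C (pb1 C f g) = Dom C f" "Cod C (pb2 C f g) = Dom C g"
  using pullbackD[OF pb_pullback[OF assms]] by simp_all

lemma inverse_image_le:
  assumes "g \<in> Arr C" "m \<in> Arr C" "Cod C g = Cod C m"
  shows "x \<sqsubseteq> inverse_image C g m \<longleftrightarrow> x \<in> Arr C \<and> Cod C x = Dom C g \<and> g \<cdot> x \<sqsubseteq> m"
  unfolding inverse_image_def by (rule pullback_sub_le[OF pb_pullback[OF assms]])

lemma inverse_image_mono:
  assumes "g \<in> Arr C" "is_mono C m" "Cod C g = Cod C m"
  shows "is_mono C (inverse_image C g m)" "Cod C (inverse_image C g m) = Dom C g"
  unfolding inverse_image_def using pullback_mono[OF pb_pullback] assms by simp_all

lemma sub_meet_le:
  assumes "m \<in> Arr C" "n \<in> Arr C" "Cod C m = Cod C n"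
  shows "x \<sqsubseteq> sub_meet C m n \<longleftrightarrow> x \<sqsubseteq> m \<and> x \<sqsubseteq> n"
  unfolding sub_meet_def by (rule pullback_meet_le[OF pb_pullback[OF assms]])

lemma sub_meet_mono:
  assumes "is_mono C m" "is_mono C n" "Cod C m = Cod C n"
  shows "is_mono C (sub_meet C m n)" "Cod C (sub_meet C m n) = Cod C m"
  unfolding sub_meet_def
  using assms by (simp_all add: mono_comp inverse_image_mono[unfolded inverse_image_def])

lemma ex_product:
  assumes "A \<in> Obj C" "B \<in> Obj C"
  obtains P p q where "is_product C A B P p q"
proof -
  let ?D = "\<lambda>i::nat. if i = 0 then A else B"
  have d: "is_diagram C {0,1} {} (\<lambda>i. i) (\<lambda>i. i) ?D (\<lambda>_. undefined)"
    using assms by (simp add: is_diagram_def)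
  obtain L r where L: "is_limit C {0,1} {} (\<lambda>i. i) (\<lambda>i. i) ?D (\<lambda>_. undefined) L r"
    using ex_limit[OF _ _ d] by blast
  have cone: "is_cone C {0,1} {} (\<lambda>i. i) (\<lambda>i. i) ?D (\<lambda>_. undefined) K q \<longleftrightarrow>
      q 0 \<in> Hom C K A \<and> q 1 \<in> Hom C K B" for K q
    by (auto simp: is_cone_def)
  have "is_product C A B L (r 0) (r 1)"
    unfolding is_product_def
  proof (intro conjI allI ballI)
    have c: "is_cone C {0,1} {} (\<lambda>i. i) (\<lambda>i. i) ?D (\<lambda>_. undefined) L r"
      using L by (simp add: is_limit_def)
    then show "r 0 \<in> Hom C L A" "r 1 \<in> Hom C L B" unfolding cone by blast+
    fix Z u v assume uv: "u \<in> Hom C Z A" "v \<in> Hom C Z B"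
    let ?q = "\<lambda>i::nat. if i = 0 then u else v"
    have "is_cone C {0,1} {} (\<lambda>i. i) (\<lambda>i. i) ?D (\<lambda>_. undefined) Z ?q" using uv unfolding cone by simp
    then have "\<exists>!h. h \<in> Hom C Z L \<and> (\<forall>i\<in>{0,1}. r i \<cdot> h = ?q i)"
      using L unfolding is_limit_def by blast
    then show "\<exists>!h. h \<in> Hom C Z L \<and> r 0 \<cdot> h = u \<and> r 1 \<cdot> h = v"
      by (simp del: Hom_iff)
  qed
  then show ?thesis by (rule that)
qed

lemma prod_product:
  assumes "A \<in> Obj C" "B \<in> Obj C"
  shows "is_product C A B (prod_obj C A B) (pr1 C A B) (pr2 C A B)"
proof -
  have "\<exists>x. case x of (P, p, q) \<Rightarrow> is_product C A B P p q"
    using ex_product[OF assms] by (metis case_prod_conv)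
  from someI_ex[OF this] have "case some_product C A B of (P, p, q) \<Rightarrow> is_product C A B P p q"
    unfolding some_product_def .
  then show ?thesis
    unfolding prod_obj_def pr1_def pr2_def by (simp add: case_prod_beta)
qed

lemma pr_arr [simp]:
  assumes "A \<in> Obj C" "B \<in> Obj C"
  shows "pr1 C A B \<in> Arr C" "Dom C (pr1 C A B) = prod_obj C A B" "Cod C (pr1 C A B) = A"
    "pr2 C A B \<in> Arr C" "Dom C (pr2 C A B) = prod_obj C A B" "Cod C (pr2 C A B) = B"
  using prod_product[OF assms] unfolding is_product_def by auto

lemma prod_obj_Obj [simp]:
  assumes "A \<in> Obj C" "B \<in> Obj C"
  shows "prod_obj C A B \<in> Obj C"
  using arr_obj(1)[OF pr_arr(1)[OF assms]] pr_arr(2)[OF assms] by simp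

lemma pairing_spec:
  assumes "f \<in> Arr C" "g \<in> Arr C" "Dom C f = Dom C g"
  shows "pairing C f g \<in> Hom C (Dom C f) (prod_obj C (Cod C f) (Cod C g)) \<and>
    pr1 C (Cod C f) (Cod C g) \<cdot> pairing C f g = f \<and> pr2 C (Cod C f) (Cod C g) \<cdot> pairing C f g = g"
proof -
  have "\<exists>!h. h \<in> Hom C (Dom C f) (prod_obj C (Cod C f) (Cod C g)) \<and>
    pr1 C (Cod C f) (Cod C g) \<cdot> h = f \<and> pr2 C (Cod C f) (Cod C g) \<cdot> h = g"
  proof -
    have "f \<in> Hom C (Dom C f) (Cod C f)" "g \<in> Hom C (Dom C f) (Cod C g)" using assms by simp_all
    then show ?thesis
      using prod_product[of "Cod C f" "Cod C g"] arr_obj(2)[OF assms(1)] arr_obj(2)[OF assms(2)]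
      unfolding is_product_def by blast
  qed
  from theI'[OF this] show ?thesis unfolding pairing_def .
qed

lemma pairing_arr [simp]:
  assumes "f \<in> Arr C" "g \<in> Arr C" "Dom C f = Dom C g"
  shows "pairing C f g \<in> Arr C" "Dom C (pairing C f g) = Dom C f"
    "Cod C (pairing C f g) = prod_obj C (Cod C f) (Cod C g)"
  using pairing_spec[OF assms] by auto

lemma pr_pairing [simp]:
  assumes "f \<in> Arr C" "g \<in> Arr C" "Dom C f = Dom C g" "Cod C f = A" "Cod C g = B"
  shows "pr1 C A B \<cdot> pairing C f g = f" "pr2 C A B \<cdot> pairing C f g = g"
  using pairing_spec[OF assms(1-3)] assms by auto

lemma prod_ext:
  assumes "u \<in> Arr C" "v \<in> Arr C" "Dom C u = Dom C v" "Cod C u = prod_obj C A B" "Cod C v = prod_obj C A B"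
    "A \<in> Obj C" "B \<in> Obj C" "pr1 C A B \<cdot> u = pr1 C A B \<cdot> v" "pr2 C A B \<cdot> u = pr2 C A B \<cdot> v"
  shows "u = v"
proof -
  have "pr1 C A B \<cdot> v \<in> Hom C (Dom C v) A" "pr2 C A B \<cdot> v \<in> Hom C (Dom C v) B" using assms by simp_all
  then have "\<exists>!h. h \<in> Hom C (Dom C v) (prod_obj C A B) \<and> pr1 C A B \<cdot> h = pr1 C A B \<cdot> v \<and>
      pr2 C A B \<cdot> h = pr2 C A B \<cdot> v"
    using prod_product[OF assms(6,7)] unfolding is_product_def by blast
  moreover have "u \<in> Hom C (Dom C v) (prod_obj C A B)" "v \<in> Hom C (Dom C v) (prod_obj C A B)"
    using assms by simp_all
  ultimately show ?thesis using assms(8,9) by blast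
qed

lemma pairing_eta:
  assumes "w \<in> Arr C" "Cod C w = prod_obj C A B" "A \<in> Obj C" "B \<in> Obj C"
  shows "pairing C (pr1 C A B \<cdot> w) (pr2 C A B \<cdot> w) = w"
  by (rule prod_ext[of _ _ A B]) (use assms in simp_all)

lemma pairing_comp [simp]:
  assumes "f \<in> Arr C" "g \<in> Arr C" "Dom C f = Dom C g" "w \<in> Arr C" "Cod C w = Dom C g"
  shows "pairing C f g \<cdot> w = pairing C (f \<cdot> w) (g \<cdot> w)"
proof (rule prod_ext[of _ _ "Cod C f" "Cod C g"])
  show "pr1 C (Cod C f) (Cod C g) \<cdot> pairing C f g \<cdot> w = pr1 C (Cod C f) (Cod C g) \<cdot> pairing C (f \<cdot> w) (g \<cdot> w)"
    using assms comp_assoc_subst[of "pr1 C (Cod C f) (Cod C g)" "pairing C f g" f w] by simp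
  show "pr2 C (Cod C f) (Cod C g) \<cdot> pairing C f g \<cdot> w = pr2 C (Cod C f) (Cod C g) \<cdot> pairing C (f \<cdot> w) (g \<cdot> w)"
    using assms comp_assoc_subst[of "pr2 C (Cod C f) (Cod C g)" "pairing C f g" g w] by simp
qed (use assms in simp_all)

lemma pairing_inject [simp]:
  assumes "f \<in> Arr C" "g \<in> Arr C" "Dom C f = Dom C g" "f' \<in> Arr C" "g' \<in> Arr C" "Dom C f' = Dom C g'"
    "Cod C f = Cod C f'" "Cod C g = Cod C g'"
  shows "pairing C f g = pairing C f' g' \<longleftrightarrow> f = f' \<and> g = g'"
  using assms pr_pairing by metis

lemma pairing_cases:
  assumes "w \<in> Arr C" "Cod C w = prod_obj C A B" "A \<in> Obj C" "B \<in> Obj C"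
  obtains f g where "f \<in> Arr C" "g \<in> Arr C" "Dom C f = Dom C w" "Dom C g = Dom C w"
    "Cod C f = A" "Cod C g = B" "w = pairing C f g"
  by (rule that[of "pr1 C A B \<cdot> w" "pr2 C A B \<cdot> w"]) (use assms in \<open>simp_all add: pairing_eta\<close>)

lemma diag_mono [simp]:
  assumes "X \<in> Obj C"
  shows "is_mono C (diag C X)" "Cod C (diag C X) = prod_obj C X X" "Dom C (diag C X) = X"
proof -
  have "pr1 C X X \<cdot> diag C X = Id C X" using assms by (simp add: diag_def)
  then have "is_mono C (pr1 C X X \<cdot> diag C X)" using assms by simp
  then show "is_mono C (diag C X)"
    by (rule mono_left_cancel) (use assms in \<open>simp_all add: diag_def\<close>)
qed (use assms in \<open>simp_all add: diag_def\<close>)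

lemma le_diag:
  assumes "x \<in> Arr C" "y \<in> Arr C" "Dom C x = Dom C y" "Cod C x = X" "Cod C y = X"
  shows "pairing C x y \<sqsubseteq> diag C X \<longleftrightarrow> x = y"
proof
  have X: "X \<in> Obj C" using assms by auto
  have dk: "diag C X \<cdot> k = pairing C k k" if "k \<in> Arr C" "Cod C k = X" for k
    using that X by (simp add: diag_def)
  { assume "pairing C x y \<sqsubseteq> diag C X"
    then obtain k where "k \<in> Arr C" "Dom C k = Dom C (pairing C x y)" "Cod C k = Dom C (diag C X)"
      "diag C X \<cdot> k = pairing C x y"
      using X diag_mono(1) monoD sub_leE by metis
    then have k: "k \<in> Arr C" "Cod C k = X" and "pairing C k k = pairing C x y"
      using X dk[of k] by simp_all
    then show "x = y"
      using assms by (metis pairing_inject) }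
  { assume "x = y"
    then show "pairing C x y \<sqsubseteq> diag C X"
      using sub_leI[of x "diag C X"] dk[of x] assms X by simp }
qed

text \<open>Take the inverse image of the diagonal along the pair \<open>(u, v)\<close>.\<close>

lemma ex_equalizer:
  assumes "u \<in> Arr C" "v \<in> Arr C" "Dom C u = Dom C v" "Cod C u = Cod C v"
  obtains m where "is_mono C m" "Cod C m = Dom C u"
    "\<And>x. x \<sqsubseteq> m \<longleftrightarrow> x \<in> Arr C \<and> Cod C x = Dom C u \<and> u \<cdot> x = v \<cdot> x"
proof
  let ?m = "inverse_image C (pairing C u v) (diag C (Cod C u))"
  show "is_mono C ?m" "Cod C ?m = Dom C u"
    using inverse_image_mono[of "pairing C u v" "diag C (Cod C u)"] assms by simp_all
  show "x \<sqsubseteq> ?m \<longleftrightarrow> x \<in> Arr C \<and> Cod C x = Dom C u \<and> u \<cdot> x = v \<cdot> x" for x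
  proof (cases "x \<in> Arr C \<and> Cod C x = Dom C u")
    case True
    then show ?thesis
      using inverse_image_le[of "pairing C u v" "diag C (Cod C u)" x] assms by (simp add: le_diag)
  next
    case False
    then show ?thesis
      using inverse_image_le[of "pairing C u v" "diag C (Cod C u)" x] assms by auto
  qed
qed

text \<open>The empty meet is the identity of \<open>P\<close>, so the typing of \<open>x\<close>
  has to stand beside the quantifier.\<close>

lemma ex_finite_meet:
  fixes n :: nat
  assumes "P \<in> Obj C" "\<And>i. i < n \<Longrightarrow> U i \<in> Subobjects C P"
  obtains m where "m \<in> Subobjects C P"
    "\<And>x. x \<sqsubseteq> m \<longleftrightarrow> x \<in> Arr C \<and> Cod C x = P \<and> (\<forall>i<n. x \<sqsubseteq> U i)"
proof -
  have "\<exists>m. m \<in> Subobjects C P \<and> (\<forall>x. x \<sqsubseteq> m \<longleftrightarrow> x \<in> Arr C \<and> Cod C x = P \<and> (\<forall>i<n. x \<sqsubseteq> U i))"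
    using assms(2)
  proof (induction n)
    case 0
    have "x \<sqsubseteq> Id C P \<longleftrightarrow> x \<in> Arr C \<and> Cod C x = P" for x
      using sub_leI[of x "Id C P"] sub_leD[of x "Id C P"] assms(1) by auto
    then show ?case using assms(1) by (intro exI[of _ "Id C P"]) simp
  next
    case (Suc n)
    have "\<And>i. i < n \<Longrightarrow> U i \<in> Subobjects C P" and U: "U n \<in> Subobjects C P"
      using Suc.prems less_SucI lessI by blast+
    with Suc.IH obtain m where m: "m \<in> Subobjects C P"
      "\<And>x. x \<sqsubseteq> m \<longleftrightarrow> x \<in> Arr C \<and> Cod C x = P \<and> (\<forall>i<n. x \<sqsubseteq> U i)" by blast
    have "x \<sqsubseteq> sub_meet C m (U n) \<longleftrightarrow> x \<in> Arr C \<and> Cod C x = P \<and> (\<forall>i<Suc n. x \<sqsubseteq> U i)" for x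
      using m U sub_meet_le[of m "U n" x] by (metis (no_types, lifting) less_Suc_eq mem_Subobjects monoD)
    moreover have "sub_meet C m (U n) \<in> Subobjects C P"
      using m(1) U by (simp add: sub_meet_mono)
    ultimately show ?case by blast
  qed
  then show ?thesis using that by blast
qed

lemma ex_power:
  assumes "X \<in> Obj C"
  obtains P \<pi> where "is_power C X n P \<pi>"
proof -
  let ?L = "is_limit C {..<n} {} (\<lambda>i. i) (\<lambda>i. i) (\<lambda>_. X) (\<lambda>_. undefined)"
  let ?K = "is_cone C {..<n} {} (\<lambda>i. i) (\<lambda>i. i) (\<lambda>_. X) (\<lambda>_. undefined)"
  have d: "is_diagram C {..<n} {} (\<lambda>i. i) (\<lambda>i. i) (\<lambda>_. X) (\<lambda>_. undefined)"
    using assms by (simp add: is_diagram_def)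
  obtain L r where L: "?L L r"
    using ex_limit[OF _ _ d] by blast
  have cone: "?K K q \<longleftrightarrow> K \<in> Obj C \<and> (\<forall>i<n. q i \<in> Hom C K X)" for K q
    unfolding is_cone_def by blast
  have "is_power C X n L r"
    unfolding is_power_def
  proof (intro conjI allI impI ballI)
    have c: "?K L r" using L by (simp add: is_limit_def)
    then show "L \<in> Obj C" "\<And>i. i < n \<Longrightarrow> r i \<in> Hom C L X" unfolding cone by blast+
    fix Z u assume "Z \<in> Obj C" "\<forall>i<n. u i \<in> Hom C Z X"
    then have "?K Z u" unfolding cone by blast
    then have "\<exists>!h. h \<in> Hom C Z L \<and> (\<forall>i\<in>{..<n}. r i \<cdot> h = u i)"
      using L unfolding is_limit_def by blast
    then show "\<exists>!h. h \<in> Hom C Z L \<and> (\<forall>i<n. r i \<cdot> h = u i)"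
      by (simp only: Ball_def lessThan_iff)
  qed
  then show ?thesis by (rule that)
qed

lemma pow_power:
  assumes "X \<in> Obj C"
  shows "is_power C X n (pow_obj C X n) (pow_proj C X n)"
proof -
  have "\<exists>x. case x of (P, \<pi>) \<Rightarrow> is_power C X n P \<pi>"
    using ex_power[OF assms] by (metis case_prod_conv)
  from someI_ex[OF this] have "case some_power C X n of (P, \<pi>) \<Rightarrow> is_power C X n P \<pi>"
    unfolding some_power_def .
  then show ?thesis unfolding pow_obj_def pow_proj_def by (simp add: case_prod_beta)
qed

lemma pow_arr [simp]:
  assumes "X \<in> Obj C"
  shows "pow_obj C X n \<in> Obj C"
    "i < n \<Longrightarrow> pow_proj C X n i \<in> Arr C" "i < n \<Longrightarrow> Dom C (pow_proj C X n i) = pow_obj C X n"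
    "i < n \<Longrightarrow> Cod C (pow_proj C X n i) = X"
  using pow_power[OF assms, of n] unfolding is_power_def by auto

lemma tupling_spec:
  assumes "Z \<in> Obj C" "X \<in> Obj C" "\<And>i. i < n \<Longrightarrow> u i \<in> Hom C Z X"
  shows "tupling C Z X n u \<in> Hom C Z (pow_obj C X n) \<and> (\<forall>i<n. pow_proj C X n i \<cdot> tupling C Z X n u = u i)"
proof -
  have "\<exists>!h. h \<in> Hom C Z (pow_obj C X n) \<and> (\<forall>i<n. pow_proj C X n i \<cdot> h = u i)"
    using pow_power[OF assms(2), of n] assms(1,3) unfolding is_power_def by blast
  from theI'[OF this] show ?thesis unfolding tupling_def .
qed

lemma tupling_arr [simp]:
  assumes "Z \<in> Obj C" "X \<in> Obj C" "\<And>i. i < n \<Longrightarrow> u i \<in> Hom C Z X"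
  shows "tupling C Z X n u \<in> Arr C" "Dom C (tupling C Z X n u) = Z"
    "Cod C (tupling C Z X n u) = pow_obj C X n"
    "i < n \<Longrightarrow> pow_proj C X n i \<cdot> tupling C Z X n u = u i"
  using tupling_spec[OF assms] by auto


lemma pow_ext:
  assumes "a \<in> Arr C" "b \<in> Arr C" "Dom C a = Dom C b" "Cod C a = pow_obj C X n" "Cod C b = pow_obj C X n"
    "X \<in> Obj C" "\<And>i. i < n \<Longrightarrow> pow_proj C X n i \<cdot> a = pow_proj C X n i \<cdot> b"
  shows "a = b"
proof -
  define u where "u i = pow_proj C X n i \<cdot> b" for i
  have "\<forall>i<n. u i \<in> Hom C (Dom C b) X" using assms(2,5,6) by (simp add: u_def)
  then have "\<exists>!h. h \<in> Hom C (Dom C b) (pow_obj C X n) \<and> (\<forall>i<n. pow_proj C X n i \<cdot> h = u i)"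
    using pow_power[OF assms(6), of n] arr_obj(1)[OF assms(2)] unfolding is_power_def by blast
  moreover have "a \<in> Hom C (Dom C b) (pow_obj C X n)" "b \<in> Hom C (Dom C b) (pow_obj C X n)"
    using assms(1-5) by simp_all
  moreover have "\<forall>i<n. pow_proj C X n i \<cdot> a = u i" "\<forall>i<n. pow_proj C X n i \<cdot> b = u i"
    using assms(7) unfolding u_def by blast+
  ultimately show ?thesis by blast
qed

lemma pow_map_arr [simp]:
  assumes "h \<in> Arr C"
  shows "pow_map C n h \<in> Arr C" "Dom C (pow_map C n h) = pow_obj C (Dom C h) n"
    "Cod C (pow_map C n h) = pow_obj C (Cod C h) n"
    "i < n \<Longrightarrow> Cod C h = X \<Longrightarrow> Dom C h = Y \<Longrightarrow> pow_proj C X n i \<cdot> pow_map C n h = h \<cdot> pow_proj C Y n i"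
  using assms by (auto simp: pow_map_def)

lemma proj_pow_map_comp [simp]:
  assumes "h \<in> Arr C" "i < n" "Cod C h = X" "w \<in> Arr C" "Cod C w = pow_obj C (Dom C h) n"
  shows "pow_proj C X n i \<cdot> pow_map C n h \<cdot> w = h \<cdot> pow_proj C (Dom C h) n i \<cdot> w"
  by (rule square_comp) (use assms in auto)

lemma pow_map_comp:
  assumes "g \<in> Arr C" "h \<in> Arr C" "Cod C h = Dom C g"
  shows "pow_map C n (g \<cdot> h) = pow_map C n g \<cdot> pow_map C n h"
  by (rule pow_ext[of _ _ "Cod C g" n]) (use assms in \<open>simp_all del: Hom_iff\<close>)

lemma pow_map_id:
  assumes "X \<in> Obj C"
  shows "pow_map C n (Id C X) = Id C (pow_obj C X n)"
  by (rule pow_ext[of _ _ X n]) (use assms in simp_all)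

end

section \<open>Strong epimorphisms and suprema of chains\<close>

context category begin

text \<open>Strong epimorphisms serve as the covers over which generalized elements exist locally: unlike
  regular epimorphisms they compose without any assumption on the category.\<close>

definition strong :: "'a \<Rightarrow> bool" where
  "strong e \<longleftrightarrow> e \<in> Arr C \<and>
    (\<forall>u m. is_mono C m \<and> u \<in> Arr C \<and> Dom C u = Cod C e \<and> u \<cdot> e \<sqsubseteq> m \<longrightarrow> u \<sqsubseteq> m)"

lemma strong_arr [simp]: "strong e \<Longrightarrow> e \<in> Arr C"
  unfolding strong_def by blast

lemma strongD:
  assumes "strong e" "is_mono C m" "u \<in> Arr C" "Dom C u = Cod C e" "u \<cdot> e \<sqsubseteq> m"
  shows "u \<sqsubseteq> m"
  using assms unfolding strong_def by blast

lemma strongI: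
  assumes "e \<in> Arr C"
    "\<And>u m. is_mono C m \<Longrightarrow> u \<in> Arr C \<Longrightarrow> Dom C u = Cod C e \<Longrightarrow> u \<cdot> e \<sqsubseteq> m \<Longrightarrow> u \<sqsubseteq> m"
  shows "strong e"
  using assms unfolding strong_def by blast

lemma strong_id [simp]:
  assumes "X \<in> Obj C"
  shows "strong (Id C X)"
  by (rule strongI) (use assms in simp_all)

lemma strong_comp:
  assumes "strong e" "strong d" "Cod C d = Dom C e"
  shows "strong (e \<cdot> d)"
proof (rule strongI)
  show "e \<cdot> d \<in> Arr C" using assms by simp
  fix u m assume *: "is_mono C m" "u \<in> Arr C" "Dom C u = Cod C (e \<cdot> d)" "u \<cdot> e \<cdot> d \<sqsubseteq> m"
  have "u \<cdot> e \<sqsubseteq> m"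
    by (rule strongD[OF assms(2) *(1)]) (use * assms in simp_all)
  then show "u \<sqsubseteq> m"
    using strongD[OF assms(1) *(1), of u] * assms by simp
qed

lemma coequalizerD:
  assumes "is_coequalizer C f g e"
  shows "f \<in> Arr C" "g \<in> Arr C" "e \<in> Arr C" "Dom C g = Dom C f" "Cod C g = Cod C f"
    "Dom C e = Cod C f" "e \<cdot> f = e \<cdot> g"
  using assms unfolding is_coequalizer_def by auto

lemma coequalizer_universal:
  assumes "is_coequalizer C f g e" "h \<in> Hom C (Cod C f) Z" "h \<cdot> f = h \<cdot> g"
  shows "\<exists>!k. k \<in> Hom C (Cod C e) Z \<and> k \<cdot> e = h"
proof -
  have "\<forall>Z. \<forall>h \<in> Hom C (Cod C f) Z. h \<cdot> f = h \<cdot> g \<longrightarrow> (\<exists>!k. k \<in> Hom C (Cod C e) Z \<and> k \<cdot> e = h)"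
    using assms(1)[unfolded is_coequalizer_def] by (elim conjE)
  with assms(2,3) show ?thesis by blast
qed

lemma coequalizer_lift:
  assumes "is_coequalizer C f g e" "h \<in> Arr C" "Dom C h = Dom C e" "h \<cdot> f = h \<cdot> g"
  obtains k where "k \<in> Arr C" "Dom C k = Cod C e" "Cod C k = Cod C h" "k \<cdot> e = h"
proof -
  have "h \<in> Hom C (Cod C f) (Cod C h)" using assms coequalizerD[OF assms(1)] by simp
  then have "\<exists>!k. k \<in> Hom C (Cod C e) (Cod C h) \<and> k \<cdot> e = h"
    using coequalizer_universal[OF assms(1) _ assms(4)] by blast
  then obtain k where "k \<in> Hom C (Cod C e) (Cod C h)" "k \<cdot> e = h" by blast
  then show ?thesis using that[of k] by simp
qed

lemma regular_epi_arr: "is_regular_epi C e \<Longrightarrow> e \<in> Arr C"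
  unfolding is_regular_epi_def using coequalizerD(3) by blast

lemma regular_epi_cancel:
  assumes "is_regular_epi C e" "u \<in> Arr C" "v \<in> Arr C" "Dom C u = Cod C e" "Dom C v = Cod C e"
    "u \<cdot> e = v \<cdot> e"
  shows "u = v"
proof -
  obtain f g where fg: "is_coequalizer C f g e" using assms(1) unfolding is_regular_epi_def by blast
  note c = coequalizerD[OF fg]
  have eq: "Cod C u = Cod C v"
    using assms c comp_arr(3)[of e u] comp_arr(3)[of e v] by simp
  have "(u \<cdot> e) \<cdot> f = (u \<cdot> e) \<cdot> g" using c assms(2,4) by simp
  moreover have "u \<cdot> e \<in> Hom C (Cod C f) (Cod C u)" using c assms(2,4) by simp
  ultimately have "\<exists>!k. k \<in> Hom C (Cod C e) (Cod C u) \<and> k \<cdot> e = u \<cdot> e"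
    using coequalizer_universal[OF fg] by blast
  moreover have "u \<in> Hom C (Cod C e) (Cod C u)" "v \<in> Hom C (Cod C e) (Cod C u)"
    using assms(2-5) eq by simp_all
  ultimately show ?thesis using assms(6) by metis
qed

text \<open>If \<open>u \<cdot> e = m \<cdot> k\<close>, monicity of \<open>m\<close> makes
  \<open>k\<close> coequalize the pair of which \<open>e\<close> is the coequalizer; the induced
  arrow \<open>t\<close> satisfies \<open>m \<cdot> t = u\<close> since \<open>e\<close> is
  epic.\<close>

lemma regular_epi_strong:
  assumes "is_regular_epi C e"
  shows "strong e"
proof (rule strongI)
  obtain f g where fg: "is_coequalizer C f g e" using assms unfolding is_regular_epi_def by blast
  note c = coequalizerD[OF fg]
  show "e \<in> Arr C" by fact
  fix u m assume *: "is_mono C m" "u \<in> Arr C" "Dom C u = Cod C e" "u \<cdot> e \<sqsubseteq> m"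
  then obtain k where k: "k \<in> Arr C" "Dom C k = Dom C (u \<cdot> e)" "Cod C k = Dom C m" "m \<cdot> k = u \<cdot> e"
    using monoD sub_leE by metis
  have m: "m \<in> Arr C" using *(1) by simp
  have dk: "Dom C k = Dom C e" using k(2) c * by simp
  have "m \<cdot> k \<cdot> f = u \<cdot> e \<cdot> f" "m \<cdot> k \<cdot> g = u \<cdot> e \<cdot> g"
    by (rule square_comp[OF k(4)]; use k(1,3) dk m *(2,3) c(1-6) in simp)+
  then have "m \<cdot> k \<cdot> f = m \<cdot> k \<cdot> g" using c(7) by simp
  then have "k \<cdot> f = k \<cdot> g"
    by (rule mono_cancel[OF *(1)]) (use k(1,3) dk m c in simp_all)
  with dk obtain t where t: "t \<in> Arr C" "Dom C t = Cod C e" "Cod C t = Cod C k" "t \<cdot> e = k"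
    using coequalizer_lift[OF fg k(1)] by metis
  have "m \<cdot> t = u"
    by (rule regular_epi_cancel[OF assms]) (use t(1-3) k(1,3) dk c * m in \<open>simp_all add: t(4) k(4)\<close>)
  then show "u \<sqsubseteq> m" using sub_leI[of t m] t k m by simp
qed

lemma chain_mono:
  assumes "is_chain C X A" "i \<le> j"
  shows "A i \<sqsubseteq> A j"
  using assms(2)
proof (induction j rule: dec_induct)
  case base
  then show ?case using assms(1) unfolding is_chain_def by simp
next
  case (step n)
  have "A n \<sqsubseteq> A (Suc n)" "A (Suc n) \<in> Arr C" using assms(1) unfolding is_chain_def by simp_all
  then show ?case using step sub_le_trans by blast
qed

lemma chainD:
  assumes "is_chain C X A"
  shows "is_mono C (A i)" "A i \<in> Arr C" "Cod C (A i) = X"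
  using assms unfolding is_chain_def by simp_all

lemma chain_supD:
  assumes "is_chain_sup C X A s"
  shows "is_mono C s" "s \<in> Arr C" "Cod C s = X" "A i \<sqsubseteq> s"
  using assms unfolding is_chain_sup_def is_supremum_def by simp_all

lemma chain_sup_least:
  assumes "is_chain_sup C X A s" "is_mono C u" "Cod C u = X" "\<And>i. A i \<sqsubseteq> u"
  shows "s \<sqsubseteq> u"
  using assms unfolding is_chain_sup_def is_supremum_def by (simp add: image_iff)

text \<open>A supremum depends only on which elements the subobjects contain. Chosen pullbacks of
  algebras and chosen pullbacks of their underlying arrows agree only in this sense.\<close>

lemma chain_sup_cong:
  assumes "is_chain_sup C X A s" "is_chain C X A" "\<And>i x. x \<sqsubseteq> B i \<longleftrightarrow> x \<sqsubseteq> A i" "\<And>x. x \<sqsubseteq> t \<longleftrightarrow> x \<sqsubseteq> s"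
    "\<And>i. B i \<in> Arr C" "is_mono C t"
  shows "is_chain_sup C X B t"
  unfolding is_chain_sup_def is_supremum_def
proof (intro conjI ballI impI)
  note s = chain_supD[OF assms(1)]
  have "t \<sqsubseteq> s" using assms(4)[of t] assms(6) by simp
  then show "t \<in> Subobjects C X" using assms(6) s sub_leD(2) by simp
  fix a assume "a \<in> range B"
  then obtain i where a: "a = B i" by blast
  have "B i \<sqsubseteq> A i" using assms(3)[of "B i" i] assms(5)[of i] by simp
  then show "a \<sqsubseteq> t" using sub_le_trans[OF _ s(4) s(2)] assms(4) a by blast
next
  note s = chain_supD[OF assms(1)]
  fix u assume u: "u \<in> Subobjects C X" "\<forall>a\<in>range B. a \<sqsubseteq> u"
  have "A i \<sqsubseteq> B i" for i using assms(3)[of "A i" i] chainD(2)[OF assms(2)] by simp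
  then have "A i \<sqsubseteq> u" for i using sub_le_trans[of "A i" "B i" u] u by simp
  then have "s \<sqsubseteq> u" using chain_sup_least[OF assms(1)] u(1) by simp
  moreover have "t \<sqsubseteq> s" using assms(4)[of t] assms(6) by simp
  ultimately show "t \<sqsubseteq> u" using sub_le_trans[of t s u] u(1) by simp
qed

end

context complete_category begin

text \<open>A strong epimorphism factors through the equalizer of \<open>u\<close> and
  \<open>v\<close>, which therefore contains the identity.\<close>

lemma strong_cancel:
  assumes "strong e" "u \<in> Arr C" "v \<in> Arr C" "Dom C u = Cod C e" "Dom C v = Cod C e" "u \<cdot> e = v \<cdot> e"
  shows "u = v"
proof -
  have e: "e \<in> Arr C" using assms(1) by simp
  have eq: "Cod C u = Cod C v"
    using assms(2-6) e comp_arr(3)[of e u] comp_arr(3)[of e v] by simp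
  obtain m where m: "is_mono C m" "Cod C m = Dom C u"
    "\<And>x. x \<sqsubseteq> m \<longleftrightarrow> x \<in> Arr C \<and> Cod C x = Dom C u \<and> u \<cdot> x = v \<cdot> x"
    using ex_equalizer[of u v] assms(2-5) eq by metis
  have i: "Id C (Cod C e) \<in> Arr C" "Dom C (Id C (Cod C e)) = Cod C e" using e by simp_all
  have "Id C (Cod C e) \<cdot> e \<sqsubseteq> m" using assms(2-6) e unfolding m(3) by simp
  from strongD[OF assms(1) m(1) i this] show ?thesis
    using assms(2-6) e unfolding m(3) by simp
qed

lemma inverse_image_chain:
  assumes A: "is_chain C X A" and g: "g \<in> Arr C" "Cod C g = X"
  shows "is_chain C (Dom C g) (\<lambda>i. inverse_image C g (A i))"
  unfolding is_chain_def
proof (intro allI conjI)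
  note Ad = chainD[OF A]
  have iA: "is_mono C (inverse_image C g (A i))" "Cod C (inverse_image C g (A i)) = Dom C g"
    "\<And>x. x \<sqsubseteq> inverse_image C g (A i) \<longleftrightarrow> x \<in> Arr C \<and> Cod C x = Dom C g \<and> g \<cdot> x \<sqsubseteq> A i" for i
    using inverse_image_mono[OF g(1) Ad(1)] inverse_image_le[OF g(1) Ad(2)] g(2) Ad(3) by simp_all
  fix i
  show "inverse_image C g (A i) \<in> Subobjects C (Dom C g)" using iA by simp
  have "inverse_image C g (A i) \<sqsubseteq> inverse_image C g (A i)" using iA(1) by simp
  then show "inverse_image C g (A i) \<sqsubseteq> inverse_image C g (A (Suc i))"
    unfolding iA(3) using sub_le_trans[OF _ chain_mono[OF A] Ad(2)] le_SucI by blast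
qed

lemma sub_meet_chain:
  assumes A: "is_chain C X A" and U: "is_mono C U" "Cod C U = X"
  shows "is_chain C X (\<lambda>i. sub_meet C (A i) U)"
  unfolding is_chain_def
proof (intro allI conjI)
  note Ad = chainD[OF A]
  have iA: "is_mono C (sub_meet C (A i) U)" "Cod C (sub_meet C (A i) U) = X"
    "\<And>x. x \<sqsubseteq> sub_meet C (A i) U \<longleftrightarrow> x \<sqsubseteq> A i \<and> x \<sqsubseteq> U" for i
    using sub_meet_mono[OF Ad(1) U(1)] sub_meet_le[OF Ad(2) monoD[OF U(1)]] U(2) Ad(3) by simp_all
  fix i
  show "sub_meet C (A i) U \<in> Subobjects C X" using iA by simp
  have "sub_meet C (A i) U \<sqsubseteq> sub_meet C (A i) U" using iA(1) by simp
  then show "sub_meet C (A i) U \<sqsubseteq> sub_meet C (A (Suc i)) U"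
    unfolding iA(3) using sub_le_trans[OF _ chain_mono[OF A] Ad(2)] le_SucI by blast
qed

text \<open>The induction replaces the stage \<open>A j\<close> by the supremum \<open>s\<close> in one coordinate at a time; the other
  coordinates are collected in a subobject \<open>U\<close>, to which stability under intersection is applied.\<close>

lemma chain_sup_finite:
  fixes n :: nat
  assumes stS: "chain_sups_stable_split_epi C" and stM: "chain_sups_stable_meet C"
    and A: "is_chain C X A" "is_chain_sup C X A s" and P: "P \<in> Obj C"
    and g: "\<And>i. i < n \<Longrightarrow> is_split_epi C (g i) \<and> Dom C (g i) = P \<and> Cod C (g i) = X"
    and v: "v \<in> Subobjects C P"
    and base: "\<And>j x. x \<in> Arr C \<Longrightarrow> Cod C x = P \<Longrightarrow> (\<forall>i<n. g i \<cdot> x \<sqsubseteq> A j) \<Longrightarrow> x \<sqsubseteq> v"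
    and x: "x \<in> Arr C" "Cod C x = P" "\<forall>i<n. g i \<cdot> x \<sqsubseteq> s"
  shows "x \<sqsubseteq> v"
proof -
  have X: "X \<in> Obj C" using chainD[OF A(1), of 0] arr_obj(2) by metis
  have gA: "g i \<in> Arr C" if "i < n" for i using g[OF that] unfolding is_split_epi_def by blast
  note s = chain_supD[OF A(2)]
  \<comment> \<open>The stage \<open>j\<close> is quantified inside the induction because the step
    has to move to a later one; for \<open>k = n\<close> the condition on the remaining coordinates
    is vacuous.\<close>
  have "\<forall>j x. x \<in> Arr C \<longrightarrow> Cod C x = P \<longrightarrow> (\<forall>i<k. g i \<cdot> x \<sqsubseteq> s) \<longrightarrow>
      (\<forall>i<n. k \<le> i \<longrightarrow> g i \<cdot> x \<sqsubseteq> A j) \<longrightarrow> x \<sqsubseteq> v" if "k \<le> n" for k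
    using that
  proof (induction k)
    case 0
    then show ?case using base by blast
  next
    case (Suc k)
    show ?case
    proof (intro allI impI)
      fix j x assume x: "x \<in> Arr C" "Cod C x = P" "\<forall>i<Suc k. g i \<cdot> x \<sqsubseteq> s"
        "\<forall>i<n. Suc k \<le> i \<longrightarrow> g i \<cdot> x \<sqsubseteq> A j"
      have k: "k < n" using Suc by simp
      \<comment> \<open>Coordinate \<open>k\<close> is left free by the identity: it is the one in
        which the supremum is about to be formed.\<close>
      define V where "V i = (if i < k then inverse_image C (g i) s
        else if i = k then Id C P else inverse_image C (g i) (A j))" for i
      have V: "V i \<in> Subobjects C P" if "i < n" for i
        unfolding V_def using g[OF that] gA[OF that] s P chainD[OF A(1)]
        by (auto simp: inverse_image_mono)
      obtain U where U: "U \<in> Subobjects C P"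
        "\<And>x. x \<sqsubseteq> U \<longleftrightarrow> x \<in> Arr C \<and> Cod C x = P \<and> (\<forall>i<n. x \<sqsubseteq> V i)"
        using ex_finite_meet[where U = V and n = n, OF P V] by blast
      have U': "y \<sqsubseteq> U \<longleftrightarrow> (\<forall>i<k. g i \<cdot> y \<sqsubseteq> s) \<and> (\<forall>i<n. k < i \<longrightarrow> g i \<cdot> y \<sqsubseteq> A j)"
        if y: "y \<in> Arr C" "Cod C y = P" for y
      proof -
        have "y \<sqsubseteq> V i \<longleftrightarrow> (if i < k then g i \<cdot> y \<sqsubseteq> s else if i = k then True else g i \<cdot> y \<sqsubseteq> A j)"
          if "i < n" for i
          unfolding V_def using g[OF that] gA[OF that] s chainD[OF A(1)] y P sub_leI[of y "Id C P"]
          by (simp add: inverse_image_le)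
        with k show ?thesis unfolding U(2) using y
          by (smt (verit) linorder_neqE_nat not_less_iff_gr_or_eq order_less_trans)
      qed
      define B where "B i = inverse_image C (g k) (A i)" for i
      define t where "t = inverse_image C (g k) s"
      have B: "y \<sqsubseteq> B i \<longleftrightarrow> y \<in> Arr C \<and> Cod C y = P \<and> g k \<cdot> y \<sqsubseteq> A i" for y i
        unfolding B_def using inverse_image_le[of "g k" "A i"] gA[OF k] g[OF k] chainD[OF A(1)] by simp
      have t: "y \<sqsubseteq> t \<longleftrightarrow> y \<in> Arr C \<and> Cod C y = P \<and> g k \<cdot> y \<sqsubseteq> s" for y
        unfolding t_def using inverse_image_le[of "g k" s] gA[OF k] g[OF k] s by simp
      have Bm: "is_mono C (B i)" "Cod C (B i) = P" for i
        unfolding B_def using inverse_image_mono[of "g k" "A i"] gA[OF k] g[OF k] chainD[OF A(1)] by simp_all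
      have tm: "is_mono C t" "Cod C t = P"
        unfolding t_def using inverse_image_mono[of "g k" s] gA[OF k] g[OF k] s by simp_all
      have "is_chain_sup C P B t"
        using stS A X g[OF k] unfolding chain_sups_stable_split_epi_def B_def t_def by blast
      moreover have "is_chain C P B"
        using inverse_image_chain[OF A(1) gA[OF k]] g[OF k] unfolding B_def by simp
      ultimately have sup: "is_chain_sup C P (\<lambda>i. sub_meet C (B i) U) (sub_meet C t U)"
        using stM P U(1) unfolding chain_sups_stable_meet_def by blast
      have Um: "U \<in> Arr C" "Cod C U = P" "is_mono C U" using U(1) by simp_all
      have BU: "y \<sqsubseteq> sub_meet C (B i) U \<longleftrightarrow> y \<sqsubseteq> B i \<and> y \<sqsubseteq> U" for y i
        using sub_meet_le[of "B i" U] Bm Um by simp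
      have "sub_meet C (B i) U \<sqsubseteq> v" for i
      proof -
        let ?y = "sub_meet C (B i) U"
        have "?y \<in> Arr C" using sub_meet_mono[of "B i" U] Bm Um by simp
        then have "?y \<sqsubseteq> ?y" by simp
        then have y: "?y \<sqsubseteq> B i" "?y \<sqsubseteq> U" unfolding BU by blast+
        then have y1: "?y \<in> Arr C" "Cod C ?y = P" "g k \<cdot> ?y \<sqsubseteq> A i" unfolding B by blast+
        have y2: "\<forall>i<k. g i \<cdot> ?y \<sqsubseteq> s" "\<forall>i<n. k < i \<longrightarrow> g i \<cdot> ?y \<sqsubseteq> A j"
          using y(2) U'[OF y1(1,2)] by blast+
        \<comment> \<open>Coordinate \<open>k\<close> lies in stage \<open>i\<close> and the later
          ones in stage \<open>j\<close>; the larger stage serves them all, so the induction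
          hypothesis applies.\<close>
        have "g k \<cdot> ?y \<sqsubseteq> A (max i j)"
          using sub_le_trans[OF y1(3) chain_mono[OF A(1), of i "max i j"]] chainD(2)[OF A(1)] by simp
        moreover have "g l \<cdot> ?y \<sqsubseteq> A (max i j)" if "l < n" "k < l" for l
          using sub_le_trans[OF _ chain_mono[OF A(1), of j "max i j"]] y2(2) that chainD(2)[OF A(1)] by simp
        ultimately have "\<forall>l<n. k \<le> l \<longrightarrow> g l \<cdot> ?y \<sqsubseteq> A (max i j)"
          using order_le_less by metis
        then show ?thesis using Suc.IH k y1 y2(1) by (metis less_imp_le)
      qed
      then have "sub_meet C t U \<sqsubseteq> v"
        using chain_sup_least[OF sup] v by simp
      moreover have "x \<sqsubseteq> sub_meet C t U"
        using sub_meet_le[of t U x] tm Um x t U'[OF x(1,2)] by auto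
      ultimately show "x \<sqsubseteq> v" using sub_le_trans v by auto
    qed
  qed
  from this[of n] x show ?thesis by auto
qed

end

section \<open>Relations in a regular category\<close>

locale regular_complete = complete_category +
  assumes regular: "regular_category C"
begin

lemma regular_factorization:
  assumes "f \<in> Arr C"
  obtains m e where "is_mono C m" "is_regular_epi C e" "Cod C e = Dom C m" "m \<cdot> e = f"
  using regular assms unfolding regular_category_def by blast

lemma regular_epi_pullback:
  assumes "is_regular_epi C e" "is_pullback C f e P p q"
  shows "is_regular_epi C p"
  using regular assms unfolding regular_category_def by blast

lemma image_spec:
  assumes "f \<in> Arr C"
  shows "is_mono C (image C f) \<and>
    (\<exists>e. is_regular_epi C e \<and> Cod C e = Dom C (image C f) \<and> image C f \<cdot> e = f)"
  unfolding image_def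
  by (rule someI_ex) (use regular_factorization[OF assms] in metis)

text \<open>Regular epimorphisms are locally surjective: the cover \<open>w\<close> is the pullback
  of \<open>e\<close> along \<open>u\<close>.\<close>

lemma cover_lift:
  assumes "is_regular_epi C e" "u \<in> Arr C" "Cod C u = Cod C e"
  obtains w a where "is_regular_epi C w" "strong w" "Cod C w = Dom C u" "a \<in> Arr C"
    "Dom C a = Dom C w" "Cod C a = Dom C e" "u \<cdot> w = e \<cdot> a"
proof -
  obtain P p q where P: "is_pullback C u e P p q"
    using ex_pullback[of u e] assms regular_epi_arr by metis
  then show ?thesis
    using that[of p q] pullbackD[OF P] regular_epi_pullback[OF assms(1) P] regular_epi_strong by simp
qed

end

section \<open>Relations tested on pairs of generalized elements\<close>

context complete_category begin

text \<open>The internal statement that \<open>x\<close> is related to \<open>y\<close> at stage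
  \<open>Dom C x\<close>. The typing is bundled in because \<open>pairing\<close> carries
  information only for arrows with a common domain.\<close>

definition elt :: "'b \<Rightarrow> 'a \<Rightarrow> 'b \<Rightarrow> 'b \<Rightarrow> bool" where
  "elt r X x y \<longleftrightarrow> x \<in> Hom C (Dom C x) X \<and> y \<in> Hom C (Dom C x) X \<and> pairing C x y \<sqsubseteq> r"

lemma RelationsD:
  assumes "r \<in> Relations C X"
  shows "is_mono C r" "r \<in> Arr C" "Cod C r = prod_obj C X X"
  using assms unfolding Relations_def by simp_all

lemma eltD:
  assumes "elt r X x y"
  shows "x \<in> Arr C" "y \<in> Arr C" "Dom C y = Dom C x" "Cod C x = X" "Cod C y = X"
    "pairing C x y \<sqsubseteq> r" "X \<in> Obj C"
  using assms unfolding elt_def by auto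

lemma eltI:
  assumes "x \<in> Arr C" "y \<in> Arr C" "Dom C y = Dom C x" "Cod C x = X" "Cod C y = X"
    "pairing C x y \<sqsubseteq> r"
  shows "elt r X x y"
  using assms unfolding elt_def by simp

lemma elt_comp:
  assumes "r \<in> Relations C X" "elt r X x y" "w \<in> Arr C" "Cod C w = Dom C x"
  shows "elt r X (x \<cdot> w) (y \<cdot> w)"
proof (rule eltI)
  note e = eltD[OF assms(2)]
  have "pairing C x y \<cdot> w \<sqsubseteq> r"
    by (rule sub_le_comp[OF e(6)]) (use e assms(3,4) RelationsD[OF assms(1)] in simp_all)
  then show "pairing C (x \<cdot> w) (y \<cdot> w) \<sqsubseteq> r" using e assms(3,4) by simp
qed (use eltD[OF assms(2)] assms in simp_all)

text \<open>Being related is a local property: this is orthogonality of the cover \<open>w\<close>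
  to the monomorphism \<open>r\<close>.\<close>

lemma elt_strong:
  assumes "r \<in> Relations C X" "strong w" "elt r X (x \<cdot> w) (y \<cdot> w)" "x \<in> Hom C (Cod C w) X"
    "y \<in> Hom C (Cod C w) X"
  shows "elt r X x y"
proof (rule eltI)
  have "pairing C x y \<cdot> w \<sqsubseteq> r" using eltD(6)[OF assms(3)] assms(2,4,5) by simp
  then show "pairing C x y \<sqsubseteq> r"
    by (rule strongD[OF assms(2) RelationsD(1)[OF assms(1)], rotated -1]) (use assms(2,4,5) in simp_all)
qed (use assms in simp_all)

lemma elt_mono:
  assumes "r \<sqsubseteq> s" "s \<in> Relations C X" "elt r X x y"
  shows "elt s X x y"
  using eltD[OF assms(3)] sub_le_trans[OF _ assms(1)] RelationsD(2)[OF assms(2)]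
  by (intro eltI) simp_all

text \<open>The two projections of \<open>r\<close> form the universal related pair; evaluating at
  it reduces inclusions of relations to elements in \<open>rel_leI\<close>.\<close>

lemma generic_elt:
  assumes "X \<in> Obj C" "r \<in> Arr C" "Cod C r = prod_obj C X X"
  shows "elt r X (pr1 C X X \<cdot> r) (pr2 C X X \<cdot> r)" "pairing C (pr1 C X X \<cdot> r) (pr2 C X X \<cdot> r) = r"
proof -
  show p: "pairing C (pr1 C X X \<cdot> r) (pr2 C X X \<cdot> r) = r"
    using assms by (simp add: pairing_eta)
  show "elt r X (pr1 C X X \<cdot> r) (pr2 C X X \<cdot> r)"
    by (rule eltI) (use assms p in simp_all)
qed

lemma elt_of_le:
  assumes "X \<in> Obj C" "t \<in> Arr C" "Cod C t = prod_obj C X X" "t \<sqsubseteq> r"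
  shows "elt r X (pr1 C X X \<cdot> t) (pr2 C X X \<cdot> t)"
  using generic_elt[OF assms(1-3)] assms(4) unfolding elt_def by simp

lemma rel_leI:
  assumes "X \<in> Obj C" "r \<in> Arr C" "Cod C r = prod_obj C X X" "\<And>x y. elt r X x y \<Longrightarrow> elt s X x y"
  shows "r \<sqsubseteq> s"
  using eltD(6)[OF assms(4)[OF generic_elt(1)[OF assms(1-3)]]] generic_elt(2)[OF assms(1-3)] by simp

lemma elt_meet:
  assumes "r \<in> Relations C X" "s \<in> Relations C X"
  shows "elt (sub_meet C r s) X x y \<longleftrightarrow> elt r X x y \<and> elt s X x y"
  using sub_meet_le[of r s] RelationsD[OF assms(1)] RelationsD[OF assms(2)] unfolding elt_def by auto

lemma meet_Relations:
  assumes "r \<in> Relations C X" "s \<in> Relations C X"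
  shows "sub_meet C r s \<in> Relations C X"
  using sub_meet_mono[of r s] RelationsD[OF assms(1)] RelationsD[OF assms(2)]
  unfolding Relations_def by simp

lemma reflexive_iff:
  assumes "X \<in> Obj C"
  shows "r \<in> Reflexive_Relations C X \<longleftrightarrow>
    r \<in> Relations C X \<and> (\<forall>x \<in> Arr C. Cod C x = X \<longrightarrow> elt r X x x)"
proof (intro iffI conjI ballI impI)
  assume r: "r \<in> Reflexive_Relations C X"
  then show R: "r \<in> Relations C X" unfolding Reflexive_Relations_def by blast
  fix x assume x: "x \<in> Arr C" "Cod C x = X"
  have "diag C X \<sqsubseteq> r" using r unfolding Reflexive_Relations_def by blast
  then have "diag C X \<cdot> x \<sqsubseteq> r" using x assms RelationsD[OF R] by (intro sub_le_comp) simp_all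
  then show "elt r X x x" using x assms by (intro eltI) (simp_all add: diag_def)
next
  assume r: "r \<in> Relations C X \<and> (\<forall>x\<in>Arr C. Cod C x = X \<longrightarrow> elt r X x x)"
  then have "elt r X (Id C X) (Id C X)" using assms by simp
  from eltD(6)[OF this] r show "r \<in> Reflexive_Relations C X"
    unfolding Reflexive_Relations_def diag_def by simp
qed

lemma elt_rel_op:
  assumes "r \<in> Relations C X" "X \<in> Obj C"
  shows "rel_op C X r \<in> Arr C" "Cod C (rel_op C X r) = prod_obj C X X"
    "rel_op C X r \<sqsubseteq> r \<longleftrightarrow> (\<forall>x y. elt r X x y \<longrightarrow> elt r X y x)"
proof -
  note R = RelationsD[OF assms(1)]
  let ?a = "pr1 C X X \<cdot> r" and ?b = "pr2 C X X \<cdot> r"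
  show "rel_op C X r \<in> Arr C" "Cod C (rel_op C X r) = prod_obj C X X"
    unfolding rel_op_def using assms(2) R by simp_all
  have g: "elt r X ?a ?b" using generic_elt(1)[OF assms(2) R(2,3)] .
  show "rel_op C X r \<sqsubseteq> r \<longleftrightarrow> (\<forall>x y. elt r X x y \<longrightarrow> elt r X y x)"
  proof (intro iffI allI impI)
    fix x y assume le: "rel_op C X r \<sqsubseteq> r" and xy: "elt r X x y"
    note e = eltD[OF xy]
    obtain k where k: "k \<in> Arr C" "Dom C k = Dom C (pairing C x y)" "Cod C k = Dom C r" "r \<cdot> k = pairing C x y"
      using sub_leE[OF e(6) R(2)] by metis
    have ak: "?a \<cdot> k = x" "?b \<cdot> k = y" using k R assms(2) e by simp_all
    have "rel_op C X r \<cdot> k \<sqsubseteq> r"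
      by (rule sub_le_comp[OF le R(2) k(1)]) (use k R assms(2) in \<open>simp add: rel_op_def\<close>)
    moreover have "rel_op C X r \<cdot> k = pairing C (?b \<cdot> k) (?a \<cdot> k)"
      unfolding rel_op_def by (rule pairing_comp) (use k R assms(2) in simp_all)
    ultimately have "pairing C y x \<sqsubseteq> r" using ak by metis
    then show "elt r X y x" using e by (intro eltI) simp_all
  next
    assume "\<forall>x y. elt r X x y \<longrightarrow> elt r X y x"
    then have "elt r X ?b ?a" using g by blast
    from eltD(6)[OF this] show "rel_op C X r \<sqsubseteq> r" unfolding rel_op_def .
  qed
qed

end

context regular_complete begin

text \<open>The middle point of a composite exists only over a cover, since the composite is an
  image. Forwards, an element of the image lifts over a cover to the pullback of composable pairs;
  backwards, a composable pair over \<open>w\<close> puts the restriction of \<open>(x, z)\<close>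
  along \<open>w\<close> into the image, and strength of \<open>w\<close> lets this descend.\<close>

lemma rel_comp_spec:
  assumes "r \<in> Relations C X" "s \<in> Relations C X" "X \<in> Obj C"
  shows "rel_comp C X s r \<in> Relations C X"
    "elt (rel_comp C X s r) X x z \<longleftrightarrow> x \<in> Hom C (Dom C x) X \<and> z \<in> Hom C (Dom C x) X \<and>
      (\<exists>w y. strong w \<and> Cod C w = Dom C x \<and> elt r X (x \<cdot> w) y \<and> elt s X y (z \<cdot> w))" (is "?L \<longleftrightarrow> ?R")
proof -
  note R = RelationsD[OF assms(1)] and S = RelationsD[OF assms(2)]
  let ?f = "pr2 C X X \<cdot> r" and ?g = "pr1 C X X \<cdot> s"
  let ?p = "pb1 C ?f ?g" and ?q = "pb2 C ?f ?g"
  let ?h = "pairing C (pr1 C X X \<cdot> r \<cdot> ?p) (pr2 C X X \<cdot> s \<cdot> ?q)"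
  have fg: "?f \<in> Arr C" "?g \<in> Arr C" "Cod C ?f = X" "Cod C ?g = X" "Dom C ?f = Dom C r" "Dom C ?g = Dom C s"
    using R S assms(3) by simp_all
  have pq: "?p \<in> Arr C" "?q \<in> Arr C" "Dom C ?q = Dom C ?p" "Cod C ?p = Dom C r" "Cod C ?q = Dom C s"
    using pb_arr[of ?f ?g] fg by simp_all
  have pb: "is_pullback C ?f ?g (Dom C ?p) ?p ?q" by (rule pb_pullback) (use fg in simp_all)
  have ab: "pr1 C X X \<cdot> r \<cdot> ?p \<in> Hom C (Dom C ?p) X" "pr2 C X X \<cdot> s \<cdot> ?q \<in> Hom C (Dom C ?p) X"
    using R S assms(3) pq by simp_all
  have h: "?h \<in> Arr C" "Dom C ?h = Dom C ?p" "Cod C ?h = prod_obj C X X"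
    using pairing_arr[of "pr1 C X X \<cdot> r \<cdot> ?p" "pr2 C X X \<cdot> s \<cdot> ?q"] ab by simp_all
  define m where "m = rel_comp C X s r"
  have m_im: "m = image C ?h" unfolding m_def rel_comp_def Let_def ..
  obtain e where m: "is_mono C m" and e: "is_regular_epi C e" "Cod C e = Dom C m" "m \<cdot> e = ?h"
    using image_spec[OF h(1)] unfolding m_im by blast
  have mA: "m \<in> Arr C" and eA: "e \<in> Arr C" using m regular_epi_arr[OF e(1)] by simp_all
  have mc: "Cod C m = prod_obj C X X" using comp_arr(3)[OF eA mA e(2)] e(3) h(3) by simp
  have de: "Dom C e = Dom C ?p" using comp_arr(2)[OF eA mA e(2)] e(3) h(2) by simp
  show rel: "rel_comp C X s r \<in> Relations C X"
    using m mc unfolding m_def Relations_def by simp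
  show "?L \<longleftrightarrow> ?R"
  proof
    assume L: ?L
    note xz = eltD[OF L]
    have "pairing C x z \<sqsubseteq> m" using xz(6) unfolding m_def .
    then obtain k where k: "k \<in> Arr C" "Dom C k = Dom C (pairing C x z)" "Cod C k = Dom C m" "m \<cdot> k = pairing C x z"
      using sub_leE[OF _ mA] by metis
    have dk: "Dom C k = Dom C x" using k(2) xz by simp
    obtain w a where w: "strong w" "Cod C w = Dom C k" "a \<in> Arr C"
      "Dom C a = Dom C w" "Cod C a = Dom C e" "k \<cdot> w = e \<cdot> a"
      using cover_lift[OF e(1) k(1)] k(3) e(2) by metis
    have wA: "w \<in> Arr C" using w by simp
    have "pairing C (x \<cdot> w) (z \<cdot> w) = pairing C x z \<cdot> w" using xz w wA dk by simp
    also have "\<dots> = m \<cdot> k \<cdot> w"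
      by (rule comp_assoc_subst[OF k(4), symmetric]) (use k w wA mA in simp_all)
    also have "\<dots> = m \<cdot> e \<cdot> a" using w(6) by simp
    also have "\<dots> = ?h \<cdot> a"
      by (rule comp_assoc_subst[OF e(3)]) (use w eA mA e(2) in simp_all)
    also have "\<dots> = pairing C ((pr1 C X X \<cdot> r \<cdot> ?p) \<cdot> a) ((pr2 C X X \<cdot> s \<cdot> ?q) \<cdot> a)"
      by (rule pairing_comp) (use ab w de in simp_all)
    finally have "x \<cdot> w = (pr1 C X X \<cdot> r \<cdot> ?p) \<cdot> a \<and> z \<cdot> w = (pr2 C X X \<cdot> s \<cdot> ?q) \<cdot> a"
      by (subst (asm) pairing_inject) (use ab w de dk xz wA in simp_all)
    then have xw: "x \<cdot> w = pr1 C X X \<cdot> r \<cdot> ?p \<cdot> a" and zw: "z \<cdot> w = pr2 C X X \<cdot> s \<cdot> ?q \<cdot> a"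
      using w de pq R S assms(3) by simp_all
    have comm: "pr2 C X X \<cdot> r \<cdot> ?p \<cdot> a = pr1 C X X \<cdot> s \<cdot> ?q \<cdot> a"
      using pullback_comm[OF pb, of a] w de pq R S assms(3) by simp
    have r1: "r \<cdot> ?p \<cdot> a \<in> Arr C" "Cod C (r \<cdot> ?p \<cdot> a) = prod_obj C X X" "r \<cdot> ?p \<cdot> a \<sqsubseteq> r"
      and s1: "s \<cdot> ?q \<cdot> a \<in> Arr C" "Cod C (s \<cdot> ?q \<cdot> a) = prod_obj C X X" "s \<cdot> ?q \<cdot> a \<sqsubseteq> s"
      using w de pq R S by (simp_all add: sub_leI)
    have "elt r X (x \<cdot> w) (pr2 C X X \<cdot> r \<cdot> ?p \<cdot> a)"
      unfolding xw by (rule elt_of_le[OF assms(3) r1])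
    moreover have "elt s X (pr2 C X X \<cdot> r \<cdot> ?p \<cdot> a) (z \<cdot> w)"
      unfolding zw comm by (rule elt_of_le[OF assms(3) s1])
    moreover have "x \<in> Hom C (Dom C x) X" "z \<in> Hom C (Dom C x) X" "Cod C w = Dom C x"
      using xz w(2) dk by simp_all
    ultimately show ?R using w(1) by blast
  next
    assume ?R
    then obtain w y where xz: "x \<in> Arr C" "z \<in> Arr C" "Dom C z = Dom C x" "Cod C x = X" "Cod C z = X"
      and w: "strong w" "Cod C w = Dom C x"
      and r: "elt r X (x \<cdot> w) y" and s: "elt s X y (z \<cdot> w)" unfolding Hom_iff by blast
    have wA: "w \<in> Arr C" using w by simp
    note r' = eltD[OF r] and s' = eltD[OF s]
    obtain k where k: "k \<in> Arr C" "Dom C k = Dom C (pairing C (x \<cdot> w) y)" "Cod C k = Dom C r"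
      "r \<cdot> k = pairing C (x \<cdot> w) y" using sub_leE[OF r'(6) R(2)] by metis
    obtain l where l: "l \<in> Arr C" "Dom C l = Dom C (pairing C y (z \<cdot> w))" "Cod C l = Dom C s"
      "s \<cdot> l = pairing C y (z \<cdot> w)" using sub_leE[OF s'(6) S(2)] by metis
    have yw: "y \<in> Arr C" "Dom C y = Dom C w" "Cod C y = X" using r' xz w wA by simp_all
    have dkl: "Dom C k = Dom C w" "Dom C l = Dom C w" using k(2) l(2) xz w wA yw by simp_all
    have "?f \<cdot> k = y" using k R assms(3) xz w wA yw by simp
    moreover have "?g \<cdot> l = y" using l S assms(3) xz w wA yw by simp
    ultimately have fkgl: "?f \<cdot> k = ?g \<cdot> l" by simp
    obtain j where j: "j \<in> Arr C" "Dom C j = Dom C k" "Cod C j = Dom C ?p" "?p \<cdot> j = k" "?q \<cdot> j = l"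
      by (rule pullback_lift[OF pb k(1) l(1) _ _ _ fkgl]) (use dkl k l fg in simp_all)
    have "?h \<cdot> j = pairing C ((pr1 C X X \<cdot> r \<cdot> ?p) \<cdot> j) ((pr2 C X X \<cdot> s \<cdot> ?q) \<cdot> j)"
      by (rule pairing_comp) (use ab j in simp_all)
    also have "(pr1 C X X \<cdot> r \<cdot> ?p) \<cdot> j = x \<cdot> w"
      using j k R pq assms(3) xz w wA yw by simp
    also have "(pr2 C X X \<cdot> s \<cdot> ?q) \<cdot> j = z \<cdot> w"
      using j l S pq assms(3) xz w wA yw dkl by simp
    finally have "pairing C x z \<cdot> w = ?h \<cdot> j" using xz w wA by simp
    also have "\<dots> = m \<cdot> e \<cdot> j"
      by (rule comp_assoc_subst[OF e(3), symmetric]) (use j eA mA e(2) de in simp_all)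
    finally have "pairing C x z \<cdot> w \<sqsubseteq> m"
      using sub_leI[of "e \<cdot> j" m] j eA mA e(2) de by simp
    then have "pairing C x z \<sqsubseteq> m"
      by (rule strongD[OF w(1) m, rotated -1]) (use xz w in simp_all)
    then show ?L using xz unfolding m_def by (intro eltI) simp_all
  qed
qed

text \<open>The identity is an admissible cover, and conversely a middle point existing over a cover
  is enough because the conclusion \<open>elt r X x z\<close> descends.\<close>

lemma transitive_iff:
  assumes "r \<in> Relations C X" "X \<in> Obj C"
  shows "rel_comp C X r r \<sqsubseteq> r \<longleftrightarrow> (\<forall>x y z. elt r X x y \<longrightarrow> elt r X y z \<longrightarrow> elt r X x z)"
proof (intro iffI allI impI)
  fix x y z assume le: "rel_comp C X r r \<sqsubseteq> r" and xy: "elt r X x y" and yz: "elt r X y z"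
  note xy' = eltD[OF xy] and yz' = eltD[OF yz]
  have i: "strong (Id C (Dom C x))" "Cod C (Id C (Dom C x)) = Dom C x"
    "x \<cdot> Id C (Dom C x) = x" "z \<cdot> Id C (Dom C x) = z" using xy' yz' by simp_all
  have "elt (rel_comp C X r r) X x z"
    unfolding rel_comp_spec(2)[OF assms(1,1,2)]
    using i xy yz xy' yz' Hom_iff by metis
  then show "elt r X x z" by (rule elt_mono[OF le assms(1)])
next
  assume t: "\<forall>x y z. elt r X x y \<longrightarrow> elt r X y z \<longrightarrow> elt r X x z"
  note c = rel_comp_spec[OF assms(1,1,2)]
  show "rel_comp C X r r \<sqsubseteq> r"
  proof (rule rel_leI[OF assms(2)])
    show "rel_comp C X r r \<in> Arr C" "Cod C (rel_comp C X r r) = prod_obj C X X" using RelationsD[OF c(1)] by simp_all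
    fix x z assume "elt (rel_comp C X r r) X x z"
    then obtain w y where xz: "x \<in> Hom C (Dom C x) X" "z \<in> Hom C (Dom C x) X"
      and w: "strong w" "Cod C w = Dom C x" "elt r X (x \<cdot> w) y" "elt r X y (z \<cdot> w)"
      unfolding c(2) by blast
    then have "elt r X (x \<cdot> w) (z \<cdot> w)" using t by blast
    then show "elt r X x z" by (rule elt_strong[OF assms(1) w(1)]) (use xz w in simp_all)
  qed
qed

lemma Preorders_iff:
  assumes "X \<in> Obj C"
  shows "r \<in> Preorders C X \<longleftrightarrow> r \<in> Relations C X \<and> (\<forall>x \<in> Arr C. Cod C x = X \<longrightarrow> elt r X x x) \<and>
    (\<forall>x y z. elt r X x y \<longrightarrow> elt r X y z \<longrightarrow> elt r X x z)"
  unfolding Preorders_def using reflexive_iff[OF assms, of r] transitive_iff[OF _ assms, of r] by blast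

lemma Equivalences_iff:
  assumes "X \<in> Obj C"
  shows "r \<in> Equivalences C X \<longleftrightarrow> r \<in> Preorders C X \<and> (\<forall>x y. elt r X x y \<longrightarrow> elt r X y x)"
  unfolding Equivalences_def using Preorders_iff[OF assms, of r] elt_rel_op(3)[OF _ assms, of r] by blast


lemma elt_rel_compI:
  assumes "r \<in> Relations C X" "s \<in> Relations C X" "elt r X x y" "elt s X y z"
  shows "elt (rel_comp C X s r) X x z"
proof -
  note xy = eltD[OF assms(3)] and yz = eltD[OF assms(4)]
  have "strong (Id C (Dom C x))" "Cod C (Id C (Dom C x)) = Dom C x"
    "x \<cdot> Id C (Dom C x) = x" "z \<cdot> Id C (Dom C x) = z" using xy yz by simp_all
  then show ?thesis
    unfolding rel_comp_spec(2)[OF assms(1,2) xy(7)]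
    using assms(3,4) xy yz Hom_iff by metis
qed

lemma elt_rel_compE:
  assumes "elt (rel_comp C X s r) X x z" "r \<in> Relations C X" "s \<in> Relations C X"
  obtains w y where "strong w" "Cod C w = Dom C x" "elt r X (x \<cdot> w) y" "elt s X y (z \<cdot> w)"
    "x \<in> Hom C (Cod C w) X" "z \<in> Hom C (Cod C w) X"
  using assms(1) rel_comp_spec(2)[OF assms(2,3) eltD(7)[OF assms(1)], of x z] by metis

lemma rel_comp_mono:
  assumes "elt (rel_comp C X s r) X x z" "r \<in> Relations C X" "s \<in> Relations C X"
    "r' \<in> Relations C X" "s' \<in> Relations C X"
    "\<And>x y. elt r X x y \<Longrightarrow> elt r' X x y" "\<And>x y. elt s X x y \<Longrightarrow> elt s' X x y"
  shows "elt (rel_comp C X s' r') X x z"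
proof -
  have X: "X \<in> Obj C" using eltD(7)[OF assms(1)] .
  obtain w y where w: "strong w" "Cod C w = Dom C x" "elt r X (x \<cdot> w) y" "elt s X y (z \<cdot> w)"
    "x \<in> Hom C (Cod C w) X" "z \<in> Hom C (Cod C w) X"
    by (rule elt_rel_compE[OF assms(1-3)])
  have "elt (rel_comp C X s' r') X (x \<cdot> w) (z \<cdot> w)"
    by (rule elt_rel_compI[OF assms(4,5) assms(6)[OF w(3)] assms(7)[OF w(4)]])
  then show ?thesis
    by (rule elt_strong[OF rel_comp_spec(1)[OF assms(4,5) X] w(1) _ w(5,6)])
qed

section \<open>Alternating products of two reflexive relations\<close>

lemma elt_diag:
  "elt (diag C X) X x y \<longleftrightarrow> x \<in> Arr C \<and> Cod C x = X \<and> x = y"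
  unfolding elt_def using le_diag[of x y X] by (auto simp del: Hom_iff) (simp_all add: Hom_def)

text \<open>The recursion exchanges the two relations at each step, so here and in the later
  inductions on \<open>alternating\<close> they are allowed to vary.\<close>

lemma alternating_reflexive:
  assumes "X \<in> Obj C" "T \<in> Reflexive_Relations C X" "S \<in> Reflexive_Relations C X"
  shows "alternating C X T S n \<in> Reflexive_Relations C X"
  using assms(2,3)
proof (induction n arbitrary: T S rule: induct_nat_012)
  case 0
  then show ?case using assms(1) unfolding Reflexive_Relations_def Relations_def by simp
next
  case 1
  then show ?case by simp
next
  case (ge2 n)
  have ST: "alternating C X S T (Suc n) \<in> Reflexive_Relations C X"
    using ge2 by blast
  then have R: "alternating C X S T (Suc n) \<in> Relations C X" and T: "T \<in> Relations C X"
    using ge2 unfolding Reflexive_Relations_def by blast+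
  have "elt (rel_comp C X T (alternating C X S T (Suc n))) X x x" if "x \<in> Arr C" "Cod C x = X" for x
    by (rule elt_rel_compI[OF R T]) (use ST ge2(3) that reflexive_iff[OF assms(1)] in blast)+
  then show ?case
    using reflexive_iff[OF assms(1)] rel_comp_spec(1)[OF R T assms(1)] by simp
qed

lemma alternating_Relations:
  assumes "X \<in> Obj C" "T \<in> Reflexive_Relations C X" "S \<in> Reflexive_Relations C X"
  shows "alternating C X T S n \<in> Relations C X" "alternating C X S T n \<in> Relations C X"
    "T \<in> Relations C X" "S \<in> Relations C X"
  using alternating_reflexive[OF assms] alternating_reflexive[OF assms(1,3,2)] assms(2,3)
  unfolding Reflexive_Relations_def by blast+

lemma alternating_Suc:
  assumes "X \<in> Obj C" "T \<in> Reflexive_Relations C X" "S \<in> Reflexive_Relations C X"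
    "elt (alternating C X T S n) X x y"
  shows "elt (alternating C X T S (Suc n)) X x y"
  using assms(2-4)
proof (induction n arbitrary: T S x y rule: induct_nat_012)
  case 0
  then show ?case using reflexive_iff[OF assms(1)] by (auto simp: elt_diag)
next
  case 1
  note R = alternating_Relations[OF assms(1) 1(1,2)]
  have "elt S X x x" using 1 reflexive_iff[OF assms(1)] eltD by blast
  moreover have "elt T X x y" using 1 by simp
  ultimately show ?case using elt_rel_compI[OF R(4,3)] by simp
next
  case (ge2 n)
  note R = alternating_Relations[OF assms(1) ge2(3,4)]
  have "elt (rel_comp C X T (alternating C X S T (Suc n))) X x y" using ge2(5) by simp
  then have "elt (rel_comp C X T (alternating C X S T (Suc (Suc n)))) X x y"
    by (rule rel_comp_mono[OF _ R(2) R(3) R(2) R(3)]) (use ge2(2)[OF ge2(4,3)] in blast)+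
  then show ?case by simp
qed

text \<open>Compose on the left with the reflexive relation \<open>S\<close>. At the cost of one
  factor a product may thus begin with either relation.\<close>

lemma alternating_swap:
  assumes "X \<in> Obj C" "T \<in> Reflexive_Relations C X" "S \<in> Reflexive_Relations C X"
    "elt (alternating C X T S n) X x y"
  shows "elt (alternating C X S T (Suc n)) X x y"
proof (cases n)
  case 0
  then show ?thesis using assms reflexive_iff[OF assms(1)] by (auto simp: elt_diag)
next
  case (Suc k)
  note R = alternating_Relations[OF assms(1-3)]
  have "elt S X y y" using assms reflexive_iff[OF assms(1)] eltD[OF assms(4)] by blast
  then show ?thesis using elt_rel_compI[OF R(1)[of n] R(4) assms(4)] Suc by simp
qed

text \<open>The leftmost factor is applied last, so appending a step \<open>Q\<close> means
  composing on the left, and the product must first be brought to begin with the other relation. For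
  \<open>Q = S\<close> a final swap returns to products beginning with \<open>T\<close>.\<close>

lemma alternating_step:
  assumes "X \<in> Obj C" "T \<in> Reflexive_Relations C X" "S \<in> Reflexive_Relations C X"
    "elt (alternating C X T S n) X x y" "Q = T \<or> Q = S" "elt Q X y z"
  shows "\<exists>k. elt (alternating C X T S k) X x z"
  using assms(5)
proof
  note R = alternating_Relations[OF assms(1-3)]
  { assume "Q = T"
    then have "elt (alternating C X T S (Suc (Suc n))) X x z"
      using elt_rel_compI[OF R(2) R(3) alternating_swap[OF assms(1-4)]] assms(6) by simp
    then show ?thesis by blast }
  \<comment> \<open>The extra factor from \<open>alternating_Suc\<close> makes the length positive,
    as the recursive equation of \<open>alternating\<close> requires.\<close>
  { assume "Q = S"
    then have "elt (alternating C X S T (Suc (Suc n))) X x z"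
      using elt_rel_compI[OF R(1) R(4) alternating_Suc[OF assms(1-4)]] assms(6) by simp
    then show ?thesis using alternating_swap[OF assms(1,3,2)] by blast }
qed

text \<open>The steps of the second product are appended to the first one by one. The middle points
  exist only over a cover, but the resulting pair lies in a single stage, and membership in a stage
  descends.\<close>

lemma alternating_trans:
  assumes "X \<in> Obj C" "T \<in> Reflexive_Relations C X" "S \<in> Reflexive_Relations C X"
    "\<exists>k. elt (alternating C X T S k) X x y" "Q = T \<or> Q = S" "Q' = T \<or> Q' = S"
    "elt (alternating C X Q Q' n) X y z"
  shows "\<exists>k. elt (alternating C X T S k) X x z"
  using assms(4-7)
proof (induction n arbitrary: Q Q' x y z rule: induct_nat_012)
  case 0
  then show ?case by (simp add: elt_diag)
next
  case 1
  then obtain k where k: "elt (alternating C X T S k) X x y" by blast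
  show ?case using alternating_step[OF assms(1-3) k 1(2)] 1(4) by simp
next
  case (ge2 n)
  have Q: "Q \<in> Reflexive_Relations C X" "Q' \<in> Reflexive_Relations C X" using ge2(4,5) assms(2,3) by blast+
  note R = alternating_Relations[OF assms(1) Q]
  obtain k where k: "elt (alternating C X T S k) X x y" using ge2(3) by blast
  note R' = alternating_Relations(1)[OF assms(1-3)]
  have "elt (rel_comp C X Q (alternating C X Q' Q (Suc n))) X y z" using ge2(6) by simp
  then obtain w v where w: "strong w" "Cod C w = Dom C y"
    "elt (alternating C X Q' Q (Suc n)) X (y \<cdot> w) v" "elt Q X v (z \<cdot> w)"
    "y \<in> Hom C (Cod C w) X" "z \<in> Hom C (Cod C w) X"
    using elt_rel_compE[OF _ R(2,3)] by metis
  note xy = eltD[OF k]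
  have "elt (alternating C X T S k) X (x \<cdot> w) (y \<cdot> w)"
    by (rule elt_comp[OF R' k]) (use w xy in simp_all)
  then obtain l where l: "elt (alternating C X T S l) X (x \<cdot> w) v"
    using ge2(2)[OF _ ge2(5,4) w(3)] by blast
  obtain i where i: "elt (alternating C X T S i) X (x \<cdot> w) (z \<cdot> w)"
    using alternating_step[OF assms(1-3) l ge2(4) w(4)] by blast
  have "elt (alternating C X T S i) X x z"
    by (rule elt_strong[OF R' w(1) i]) (use w xy in simp_all)
  then show ?case by blast
qed

text \<open>The product is read backwards: its last step is reversed by symmetry of
  \<open>Q\<close>, the earlier ones by induction, and \<open>alternating_trans\<close> joins them.
  Reversal can change the leading factor, so the length is left open.\<close>

lemma alternating_sym:
  assumes "X \<in> Obj C" "T \<in> Reflexive_Relations C X" "S \<in> Reflexive_Relations C X"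
    "\<And>x y. elt T X x y \<Longrightarrow> elt T X y x" "\<And>x y. elt S X x y \<Longrightarrow> elt S X y x"
    "Q = T \<or> Q = S" "Q' = T \<or> Q' = S" "elt (alternating C X Q Q' n) X x y"
  shows "\<exists>k. elt (alternating C X T S k) X y x"
  using assms(6-8)
proof (induction n arbitrary: Q Q' x y rule: induct_nat_012)
  case 0
  then show ?case by (intro exI[of _ 0]) (auto simp: elt_diag)
next
  case 1
  then have yx: "elt Q X y x" using assms(4,5) by auto
  then have "elt (alternating C X T S 0) X y y" using eltD[OF yx] by (simp add: elt_diag)
  from alternating_step[OF assms(1-3) this 1(1) yx] show ?case .
next
  case (ge2 n)
  have Q: "Q \<in> Reflexive_Relations C X" "Q' \<in> Reflexive_Relations C X" using ge2(3,4) assms(2,3) by blast+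
  note R = alternating_Relations[OF assms(1) Q]
  note R' = alternating_Relations(1)[OF assms(1-3)]
  have "elt (rel_comp C X Q (alternating C X Q' Q (Suc n))) X x y" using ge2(5) by simp
  then obtain w v where w: "strong w" "Cod C w = Dom C x"
    "elt (alternating C X Q' Q (Suc n)) X (x \<cdot> w) v" "elt Q X v (y \<cdot> w)"
    "x \<in> Hom C (Cod C w) X" "y \<in> Hom C (Cod C w) X"
    using elt_rel_compE[OF _ R(2,3)] by metis
  have yv: "elt Q X (y \<cdot> w) v" using w(4) assms(4,5) ge2(3) by blast
  then have "elt (alternating C X T S 0) X (y \<cdot> w) (y \<cdot> w)" using eltD[OF yv] by (simp add: elt_diag)
  then obtain k where k: "elt (alternating C X T S k) X (y \<cdot> w) v"
    using alternating_step[OF assms(1-3) _ ge2(3) yv] by blast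
  obtain l where l: "elt (alternating C X T S l) X v (x \<cdot> w)" using ge2(2)[OF ge2(4,3) w(3)] by blast
  have "\<exists>k. elt (alternating C X T S k) X (y \<cdot> w) v" using k by blast
  from alternating_trans[OF assms(1-3) this _ _ l] obtain i
    where i: "elt (alternating C X T S i) X (y \<cdot> w) (x \<cdot> w)" by blast
  have "elt (alternating C X T S i) X y x"
    by (rule elt_strong[OF R' w(1) i]) (use w in simp_all)
  then show ?case by blast
qed

lemma alternating_least:
  assumes "X \<in> Obj C" "T \<in> Reflexive_Relations C X" "S \<in> Reflexive_Relations C X"
    "u \<in> Preorders C X" "T \<sqsubseteq> u" "S \<sqsubseteq> u" "elt (alternating C X T S n) X x y"
  shows "elt u X x y"
  using assms(2,3,5-7)
proof (induction n arbitrary: T S x y rule: induct_nat_012)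
  case 0
  then show ?case using assms(1,4) Preorders_iff by (auto simp: elt_diag)
next
  case 1
  then show ?case using elt_mono[of T u] assms(4) Preorders_iff[OF assms(1)] by auto
next
  case (ge2 n)
  note R = alternating_Relations[OF assms(1) ge2(3,4)]
  note u = assms(4)[unfolded Preorders_iff[OF assms(1)]]
  have "elt (rel_comp C X T (alternating C X S T (Suc n))) X x y" using ge2(7) by simp
  then obtain w v where w: "strong w" "Cod C w = Dom C x"
    "elt (alternating C X S T (Suc n)) X (x \<cdot> w) v" "elt T X v (y \<cdot> w)"
    "x \<in> Hom C (Cod C w) X" "y \<in> Hom C (Cod C w) X"
    using elt_rel_compE[OF _ R(2,3)] by metis
  have "elt u X (x \<cdot> w) v" using ge2(2)[OF ge2(4,3,6,5) w(3)] .
  moreover have "elt u X v (y \<cdot> w)" using elt_mono[OF ge2(5) _ w(4)] u by blast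
  ultimately have "elt u X (x \<cdot> w) (y \<cdot> w)" using u by blast
  then show ?case by (rule elt_strong[OF conjunct1[OF u] w(1) _ w(5,6)])
qed

text \<open>\<open>X \<times> X \<times> X\<close> is rendered as \<open>(X \<times> X) \<times> X\<close>; a composable pair of elements of \<open>J\<close> is an element of it
  whose images under the split epimorphisms \<open>g 0\<close> and \<open>g 1\<close> lie in \<open>J\<close>.\<close>

lemma alternating_sup_trans:
  assumes st: "chain_sups_stable_split_epi C" "chain_sups_stable_meet C"
    and X: "X \<in> Obj C" and T: "T \<in> Reflexive_Relations C X" and S: "S \<in> Reflexive_Relations C X"
    and ch: "is_chain C (prod_obj C X X) (alternating C X T S)"
    and sup: "is_chain_sup C (prod_obj C X X) (alternating C X T S) J"
    and xy: "elt J X x y" and yz: "elt J X y z"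
  shows "elt J X x z"
proof -
  let ?Q = "prod_obj C X X"
  let ?P = "prod_obj C ?Q X"
  note J = chain_supD[OF sup]
  have Q: "?Q \<in> Obj C" using X by simp
  have P: "?P \<in> Obj C" using X Q by simp
  define g where "g i = (if i = 0 then pr1 C ?Q X else pairing C (pr2 C X X \<cdot> pr1 C ?Q X) (pr2 C ?Q X))"
    for i :: nat
  define p where "p = pairing C (pr1 C X X \<cdot> pr1 C ?Q X) (pr2 C ?Q X)"
  have p: "p \<in> Arr C" "Dom C p = ?P" "Cod C p = ?Q" unfolding p_def using X Q by simp_all
  have g0: "is_split_epi C (g 0)" "Dom C (g 0) = ?P" "Cod C (g 0) = ?Q"
  proof -
    \<comment> \<open>The section sends \<open>(a, b)\<close> to \<open>((a, b), b)\<close>.\<close>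
    have "pr1 C ?Q X \<cdot> pairing C (Id C ?Q) (pr2 C X X) = Id C ?Q" using X Q by simp
    moreover have "pairing C (Id C ?Q) (pr2 C X X) \<in> Hom C ?Q ?P" using X Q by simp
    ultimately show "is_split_epi C (g 0)" unfolding g_def using X Q
      by (intro split_epiI[of _ "pairing C (Id C ?Q) (pr2 C X X)"]) simp_all
  qed (use X Q in \<open>simp_all add: g_def\<close>)
  have g1: "is_split_epi C (g 1)" "Dom C (g 1) = ?P" "Cod C (g 1) = ?Q"
  proof -
    \<comment> \<open>This section sends \<open>(a, b)\<close> to \<open>((a, a), b)\<close>.
      Repeating a coordinate provides sections even if \<open>X\<close> has no global point.\<close>
    let ?s = "pairing C (pairing C (pr1 C X X) (pr1 C X X)) (pr2 C X X)"
    have s: "?s \<in> Hom C ?Q ?P" using X Q by simp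
    have g: "g 1 \<in> Arr C" "Dom C (g 1) = ?P" "Cod C (g 1) = ?Q" unfolding g_def using X Q by simp_all
    have "g 1 \<cdot> ?s = pairing C ((pr2 C X X \<cdot> pr1 C ?Q X) \<cdot> ?s) (pr2 C ?Q X \<cdot> ?s)"
      unfolding g_def using X Q s by simp
    also have "\<dots> = pairing C (pr1 C X X) (pr2 C X X)" using X Q by simp
    also have "\<dots> = Id C ?Q" using pairing_eta[of "Id C ?Q" X X] X Q by simp
    finally show "is_split_epi C (g 1)" "Dom C (g 1) = ?P" "Cod C (g 1) = ?Q"
      using split_epiI[OF g(1), of ?s] s g by simp_all
  qed
  have act: "g 0 \<cdot> pairing C (pairing C a b) c = pairing C a b"
    "g 1 \<cdot> pairing C (pairing C a b) c = pairing C b c"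
    "p \<cdot> pairing C (pairing C a b) c = pairing C a c"
    if "a \<in> Hom C Z X" "b \<in> Hom C Z X" "c \<in> Hom C Z X" for a b c Z
    unfolding g_def p_def using that X Q by simp_all
  \<comment> \<open>The triples \<open>((a, b), c)\<close> with \<open>(a, c)\<close> in
    \<open>J\<close>. Only the supremum itself is pulled back along \<open>p\<close>, never the
    chain.\<close>
  define v where "v = inverse_image C p J"
  have v: "u \<sqsubseteq> v \<longleftrightarrow> u \<in> Arr C \<and> Cod C u = ?P \<and> p \<cdot> u \<sqsubseteq> J" for u
    unfolding v_def using inverse_image_le[of p J] p J by simp
  have vm: "v \<in> Subobjects C ?P" unfolding v_def using inverse_image_mono[of p J] p J by simp
  note xy' = eltD[OF xy] and yz' = eltD[OF yz]
  let ?w = "pairing C (pairing C x y) z"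
  have "?w \<sqsubseteq> v"
  proof (rule chain_sup_finite[OF st ch sup P, where g = g and n = 2])
    show "is_split_epi C (g i) \<and> Dom C (g i) = ?P \<and> Cod C (g i) = ?Q" if "i < 2" for i
      using that g0 g1 by (auto simp: less_2_cases_iff)
    show "v \<in> Subobjects C ?P" by fact
    show "?w \<in> Arr C" "Cod C ?w = ?P" using xy' yz' by simp_all
    have "g 0 \<cdot> ?w \<sqsubseteq> J" "g 1 \<cdot> ?w \<sqsubseteq> J" using act[of x "Dom C x" y z] xy' yz' by simp_all
    then show "\<forall>i<2. g i \<cdot> ?w \<sqsubseteq> J" by (auto simp: less_2_cases_iff)
    fix j u assume u: "u \<in> Arr C" "Cod C u = ?P" and le: "\<forall>i<2. g i \<cdot> u \<sqsubseteq> alternating C X T S j"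
    obtain d c where d: "d \<in> Arr C" "c \<in> Arr C" "Dom C d = Dom C u" "Dom C c = Dom C u" "Cod C d = ?Q"
      "Cod C c = X" "u = pairing C d c" by (rule pairing_cases[OF u Q X])
    obtain a b where ab: "a \<in> Arr C" "b \<in> Arr C" "Dom C a = Dom C d" "Dom C b = Dom C d" "Cod C a = X"
      "Cod C b = X" "d = pairing C a b" by (rule pairing_cases[OF d(1,5) X X])
    have abc: "a \<in> Hom C (Dom C u) X" "b \<in> Hom C (Dom C u) X" "c \<in> Hom C (Dom C u) X" using ab(1-6) d(1-6) by simp_all
    have ueq: "u = pairing C (pairing C a b) c" using d(7) ab(7) by simp
    have le': "g 0 \<cdot> u \<sqsubseteq> alternating C X T S j" "g 1 \<cdot> u \<sqsubseteq> alternating C X T S j" using le by simp_all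
    have le2: "pairing C a b \<sqsubseteq> alternating C X T S j" "pairing C b c \<sqsubseteq> alternating C X T S j"
      using le' act(1,2)[OF abc] unfolding ueq by metis+
    have eab: "elt (alternating C X T S j) X a b" by (rule eltI) (use abc le2 in simp_all)
    have ebc: "elt (alternating C X T S j) X b c" by (rule eltI) (use abc le2 in simp_all)
    \<comment> \<open>Both pairs lie in the same stage, so their composite lies in some stage, hence
      in \<open>J\<close>.\<close>
    have "\<exists>k. elt (alternating C X T S k) X a b" using eab by blast
    from alternating_trans[OF X T S this _ _ ebc] obtain k
      where k: "elt (alternating C X T S k) X a c" by blast
    have "pairing C a c \<sqsubseteq> J" using sub_le_trans[OF eltD(6)[OF k] J(4) J(2)] .
    then have "p \<cdot> u \<sqsubseteq> J" using act(3)[OF abc] unfolding ueq by metis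
    then show "u \<sqsubseteq> v" unfolding v using u by blast
  qed
  then have "pairing C x z \<sqsubseteq> J"
    unfolding v using act(3)[of x "Dom C x" y z] xy' yz' by simp
  then show ?thesis using xy' yz' by (intro eltI) simp_all
qed


section \<open>The join and its intersection with a third relation\<close>

lemma alternating_chain:
  assumes "X \<in> Obj C" "T \<in> Reflexive_Relations C X" "S \<in> Reflexive_Relations C X"
  shows "is_chain C (prod_obj C X X) (alternating C X T S)"
  unfolding is_chain_def
proof (intro allI conjI)
  fix i
  note R = alternating_Relations(1)[OF assms]
  show "alternating C X T S i \<in> Subobjects C (prod_obj C X X)" using R unfolding Relations_def .
  show "alternating C X T S i \<sqsubseteq> alternating C X T S (Suc i)"
    by (rule rel_leI[OF assms(1) RelationsD(2,3)[OF R] alternating_Suc[OF assms]])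
qed

text \<open>The supremum is formed among all subobjects of the product and only then seen to be a
  preorder, and an equivalence relation if both factors are. One and the same \<open>J\<close>
  therefore serves as the join in both classes.\<close>

lemma alternating_join:
  assumes sups: "has_chain_sups C"
    and st: "chain_sups_stable_split_epi C" "chain_sups_stable_meet C"
    and X: "X \<in> Obj C" and T: "T \<in> Preorders C X" and S: "S \<in> Preorders C X"
  shows "\<exists>J. is_chain_sup C (prod_obj C X X) (alternating C X T S) J \<and> J \<in> Preorders C X \<and>
    T \<sqsubseteq> J \<and> S \<sqsubseteq> J \<and> (\<forall>u \<in> Preorders C X. T \<sqsubseteq> u \<longrightarrow> S \<sqsubseteq> u \<longrightarrow> J \<sqsubseteq> u) \<and>
    (T \<in> Equivalences C X \<longrightarrow> S \<in> Equivalences C X \<longrightarrow> J \<in> Equivalences C X)"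
proof -
  have TS: "T \<in> Reflexive_Relations C X" "S \<in> Reflexive_Relations C X"
    using T S unfolding Preorders_def by blast+
  note R = alternating_Relations[OF X TS]
  note ch = alternating_chain[OF X TS]
  obtain J where sup: "is_chain_sup C (prod_obj C X X) (alternating C X T S) J"
    using sups X ch prod_obj_Obj unfolding has_chain_sups_def by blast
  note J = chain_supD[OF sup]
  have JR: "J \<in> Relations C X" using J unfolding Relations_def by simp
  have in_J: "elt J X x y" if "elt (alternating C X T S n) X x y" for n x y
    by (rule elt_mono[OF J(4) JR that])
  have TJ: "T \<sqsubseteq> J" using J(4)[of "Suc 0"] by simp
  \<comment> \<open>As the products begin with \<open>T\<close>, the relation \<open>S\<close> is
    not itself taken as a stage; it lies in the product with two factors.\<close>
  have SJ: "S \<sqsubseteq> J"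
  proof (rule rel_leI[OF X RelationsD(2,3)[OF R(4)]])
    fix x y assume "elt S X x y"
    then have "elt (alternating C X S T (Suc 0)) X x y" by simp
    then show "elt J X x y" using in_J alternating_swap[OF X TS(2,1)] by blast
  qed
  have JP: "J \<in> Preorders C X"
    unfolding Preorders_iff[OF X]
  proof (intro conjI ballI allI impI)
    show "J \<in> Relations C X" by fact
    fix x assume "x \<in> Arr C" "Cod C x = X"
    then have "elt (alternating C X T S 0) X x x" by (simp add: elt_diag)
    then show "elt J X x x" by (rule in_J)
  next
    fix x y z assume "elt J X x y" "elt J X y z"
    then show "elt J X x z" by (rule alternating_sup_trans[OF st X TS ch sup])
  qed
  have least: "J \<sqsubseteq> u" if u: "u \<in> Preorders C X" "T \<sqsubseteq> u" "S \<sqsubseteq> u" for u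
  proof (rule chain_sup_least[OF sup])
    have "u \<in> Relations C X" using u(1) Preorders_iff[OF X] by blast
    then show "is_mono C u" "Cod C u = prod_obj C X X" using RelationsD by simp_all
    show "alternating C X T S i \<sqsubseteq> u" for i
      by (rule rel_leI[OF X RelationsD(2,3)[OF R(1)] alternating_least[OF X TS u]])
  qed
  have "J \<in> Equivalences C X" if eq: "T \<in> Equivalences C X" "S \<in> Equivalences C X"
  proof -
    have sym: "elt T X x y \<Longrightarrow> elt T X y x" "elt S X x y \<Longrightarrow> elt S X y x" for x y
      using eq Equivalences_iff[OF X] by blast+
    let ?Q = "prod_obj C X X"
    define g where "g = pairing C (pr2 C X X) (pr1 C X X)"
    have g: "g \<in> Arr C" "Dom C g = ?Q" "Cod C g = ?Q" unfolding g_def using X by simp_all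
    have act: "g \<cdot> pairing C x y = pairing C y x" if "x \<in> Hom C Z X" "y \<in> Hom C Z X" for x y Z
      unfolding g_def using that X by simp
    \<comment> \<open>\<open>v\<close> is the opposite of \<open>J\<close>, obtained by exchanging
      coordinates. Symmetry of \<open>J\<close> becomes the inclusion
      \<open>J \<sqsubseteq> v\<close>, which can be checked on the stages.\<close>
    define v where "v = inverse_image C g J"
    have v: "u \<sqsubseteq> v \<longleftrightarrow> u \<in> Arr C \<and> Cod C u = ?Q \<and> g \<cdot> u \<sqsubseteq> J" for u
      unfolding v_def using inverse_image_le[of g J] g J by simp
    have vm: "is_mono C v" "Cod C v = ?Q" unfolding v_def using inverse_image_mono[of g J] g J by simp_all
    have "J \<sqsubseteq> v"
    proof (rule chain_sup_least[OF sup vm])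
      fix i
      show "alternating C X T S i \<sqsubseteq> v"
      proof (rule rel_leI[OF X RelationsD(2,3)[OF R(1)]])
        fix x y assume xy: "elt (alternating C X T S i) X x y"
        note e = eltD[OF xy]
        obtain k where "elt (alternating C X T S k) X y x"
          using alternating_sym[OF X TS sym _ _ xy] by blast
        then have "pairing C y x \<sqsubseteq> J" using eltD(6)[OF in_J] by blast
        then have "pairing C x y \<sqsubseteq> v" unfolding v using act[of x "Dom C x" y] e by simp
        then show "elt v X x y" using e by (intro eltI) simp_all
      qed
    qed
    have "elt J X y x" if xy: "elt J X x y" for x y
    proof -
      note e = eltD[OF xy]
      have "pairing C x y \<sqsubseteq> v" using sub_le_trans[OF e(6) \<open>J \<sqsubseteq> v\<close>] vm by simp
      then show ?thesis unfolding v using act[of x "Dom C x" y] e by (intro eltI) simp_all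
    qed
    then show ?thesis unfolding Equivalences_iff[OF X] using JP by blast
  qed
  with sup JP TJ SJ least show ?thesis by blast
qed

text \<open>\<open>K\<close> stands for preorders or for equivalence relations. Its last condition
  lets it receive a preorder \<open>J\<close> built from two of its members, provided that
  \<open>J\<close> is an equivalence relation whenever both of them are.\<close>

lemma join_formula:
  assumes sups: "has_chain_sups C"
    and st: "chain_sups_stable_split_epi C" "chain_sups_stable_meet C"
    and K: "\<And>X. X \<in> Obj C \<Longrightarrow> K X \<subseteq> Preorders C X"
      "\<And>X r s. X \<in> Obj C \<Longrightarrow> r \<in> K X \<Longrightarrow> s \<in> K X \<Longrightarrow> sub_meet C r s \<in> K X"
      "\<And>X T S J. X \<in> Obj C \<Longrightarrow> T \<in> K X \<Longrightarrow> S \<in> K X \<Longrightarrow> J \<in> Preorders C X \<Longrightarrow>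
        (T \<in> Equivalences C X \<Longrightarrow> S \<in> Equivalences C X \<Longrightarrow> J \<in> Equivalences C X) \<Longrightarrow> J \<in> K X"
  shows "alternating_join_formula C K"
  unfolding alternating_join_formula_def
proof (intro ballI)
  fix X T S R assume X: "X \<in> Obj C" and T: "T \<in> K X" and S: "S \<in> K X" and R: "R \<in> K X"
  let ?A = "alternating C X T S"
  have TS: "T \<in> Preorders C X" "S \<in> Preorders C X" using T S K(1)[OF X] by blast+
  have Rel: "r \<in> Relations C X" if "r \<in> K X" for r
    using that K(1)[OF X] Preorders_iff[OF X] by blast
  have TS': "T \<in> Reflexive_Relations C X" "S \<in> Reflexive_Relations C X"
    using TS unfolding Preorders_def by blast+
  note A = alternating_Relations(1)[OF X TS']
  obtain J where sup: "is_chain_sup C (prod_obj C X X) ?A J" and JP: "J \<in> Preorders C X"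
    and TJ: "T \<sqsubseteq> J" "S \<sqsubseteq> J" and least: "\<And>u. u \<in> Preorders C X \<Longrightarrow> T \<sqsubseteq> u \<Longrightarrow> S \<sqsubseteq> u \<Longrightarrow> J \<sqsubseteq> u"
    and JE: "T \<in> Equivalences C X \<Longrightarrow> S \<in> Equivalences C X \<Longrightarrow> J \<in> Equivalences C X"
    using alternating_join[OF sups st X TS] by blast
  have JK: "J \<in> K X" by (rule K(3)[OF X T S JP JE])
  have Jsup: "is_supremum C (K X) {T, S} J"
    unfolding is_supremum_def using JK TJ least K(1)[OF X] by blast
  have "sub_meet C J' R \<in> K X \<and>
      is_supremum C (Reflexive_Relations C X) (range (\<lambda>i. sub_meet C (?A i) R)) (sub_meet C J' R)"
    if J': "is_supremum C (K X) {T, S} J'" for J'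
  proof
    \<comment> \<open>An arbitrary supremum \<open>J'\<close> differs from the constructed
      \<open>J\<close> only by an isomorphism, so the formula is proved for \<open>J\<close> and
      moved along the two inclusions.\<close>
    have J'K: "J' \<in> K X" and J'le: "J' \<sqsubseteq> J" and Jle: "J \<sqsubseteq> J'"
      using J' Jsup unfolding is_supremum_def by blast+
    show meet: "sub_meet C J' R \<in> K X" by (rule K(2)[OF X J'K R])
    note RR = Rel[OF R] and JR = Rel[OF JK] and J'R = Rel[OF J'K] and MR = Rel[OF meet]
    have AR: "sub_meet C (?A i) R \<in> Relations C X" for i by (rule meet_Relations[OF A RR])
    \<comment> \<open>This supremum is formed among all subobjects. Reflexive relations are
      subobjects and the intersection with \<open>R\<close> is reflexive, so it is the supremum
      among reflexive relations too.\<close>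
    have "is_chain_sup C (prod_obj C X X) (\<lambda>i. sub_meet C (?A i) R) (sub_meet C J R)"
      using st(2) alternating_chain[OF X TS'] sup X RR prod_obj_Obj
      unfolding chain_sups_stable_meet_def Relations_def by blast
    note least_meet = chain_sup_least[OF this]
    show "is_supremum C (Reflexive_Relations C X) (range (\<lambda>i. sub_meet C (?A i) R)) (sub_meet C J' R)"
      unfolding is_supremum_def
    proof (intro conjI ballI impI)
      show "sub_meet C J' R \<in> Reflexive_Relations C X"
        using meet K(1)[OF X] unfolding Preorders_def by blast
      fix a assume "a \<in> range (\<lambda>i. sub_meet C (?A i) R)"
      then obtain i where a: "a = sub_meet C (?A i) R" by blast
      have "?A i \<sqsubseteq> J'" by (rule sub_le_trans[OF chain_supD(4)[OF sup] Jle RelationsD(2)[OF J'R]])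
      then show "a \<sqsubseteq> sub_meet C J' R"
        unfolding a
        by (intro rel_leI[OF X RelationsD(2,3)[OF AR]])
          (use elt_meet[OF A RR] elt_meet[OF J'R RR] elt_mono[OF _ J'R] in blast)
    next
      fix u assume u: "u \<in> Reflexive_Relations C X" "\<forall>a\<in>range (\<lambda>i. sub_meet C (?A i) R). a \<sqsubseteq> u"
      then have uR: "u \<in> Relations C X" unfolding Reflexive_Relations_def by blast
      have Ju: "sub_meet C J R \<sqsubseteq> u"
        by (rule least_meet) (use u(2) RelationsD[OF uR] in auto)
      show "sub_meet C J' R \<sqsubseteq> u"
        by (intro rel_leI[OF X RelationsD(2,3)[OF MR]])
          (use elt_meet[OF JR RR] elt_meet[OF J'R RR] elt_mono[OF J'le JR] elt_mono[OF Ju uR] in blast)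
    qed
  qed
  with Jsup show "(\<exists>J. is_supremum C (K X) {T, S} J) \<and>
      (\<forall>J. is_supremum C (K X) {T, S} J \<longrightarrow> sub_meet C J R \<in> K X \<and>
        is_supremum C (Reflexive_Relations C X) (range (\<lambda>i. sub_meet C (?A i) R)) (sub_meet C J R))"
    by blast
qed

lemma join_formula_Preorders_Equivalences:
  assumes "has_chain_sups C" "chain_sups_stable_split_epi C" "chain_sups_stable_meet C"
  shows "alternating_join_formula C (Preorders C)" "alternating_join_formula C (Equivalences C)"
proof -
  have P: "sub_meet C r s \<in> Preorders C X"
    if "X \<in> Obj C" "r \<in> Preorders C X" "s \<in> Preorders C X" for X r s
  proof -
    have R: "r \<in> Relations C X" "s \<in> Relations C X" using that Preorders_iff by blast+
    show ?thesis
      using that meet_Relations[OF R] unfolding Preorders_iff[OF that(1)] elt_meet[OF R] by blast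
  qed
  show "alternating_join_formula C (Preorders C)"
    by (rule join_formula[OF assms]) (use P in auto)
  show "alternating_join_formula C (Equivalences C)"
  proof (rule join_formula[OF assms])
    fix X r s assume X: "X \<in> Obj C" and E: "r \<in> Equivalences C X" "s \<in> Equivalences C X"
    have R: "r \<in> Relations C X" "s \<in> Relations C X"
      using X E Preorders_iff Equivalences_iff by blast+
    show "sub_meet C r s \<in> Equivalences C X"
      using E P[OF X] unfolding Equivalences_iff[OF X] elt_meet[OF R] by blast
  qed (use Equivalences_iff in auto)
qed

end

section \<open>Internal algebras\<close>

locale algebras = complete_category +
  fixes Th :: "'f alg_theory"
  assumes wf_theory: "is_alg_theory Th"
begin

text \<open>An interpretation of the operations alone: terms must be evaluated in a lifted structure
  before its equations are known to hold.\<close>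

definition structure_on :: "'a \<Rightarrow> ('f \<Rightarrow> 'b) \<Rightarrow> bool" where
  "structure_on X \<alpha> \<longleftrightarrow> X \<in> Obj C \<and> (\<forall>f \<in> Ops Th. \<alpha> f \<in> Hom C (pow_obj C X (arity Th f)) X)"

lemma structure_onD:
  assumes "structure_on X \<alpha>"
  shows "X \<in> Obj C" "f \<in> Ops Th \<Longrightarrow> \<alpha> f \<in> Arr C"
    "f \<in> Ops Th \<Longrightarrow> Dom C (\<alpha> f) = pow_obj C X (arity Th f)" "f \<in> Ops Th \<Longrightarrow> Cod C (\<alpha> f) = X"
  using assms unfolding structure_on_def by simp_all

lemma algebra_structure: "is_algebra C Th A \<Longrightarrow> structure_on (fst A) (snd A)"
  unfolding is_algebra_def structure_on_def by (cases A) simp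

lemmas algD = structure_onD[OF algebra_structure]

lemma homD:
  assumes "is_algebra_hom C Th A h B"
  shows "h \<in> Arr C" "Dom C h = fst A" "Cod C h = fst B"
    "f \<in> Ops Th \<Longrightarrow> h \<cdot> snd A f = snd B f \<cdot> pow_map C (arity Th f) h"
  using assms unfolding is_algebra_hom_def by simp_all

lemma trm_arrow_arr:
  assumes "wf_trm Th n t" "structure_on X \<alpha>"
  shows "trm_arrow C Th X \<alpha> n t \<in> Hom C (pow_obj C X n) X"
  using assms(1)
proof induction
  case (1 i)
  then show ?case using structure_onD(1)[OF assms(2)] by simp
next
  case (2 f ts)
  note s = structure_onD[OF assms(2)]
  have "map (trm_arrow C Th X \<alpha> n) ts ! i \<in> Hom C (pow_obj C X n) X" if "i < arity Th f" for i
    using 2(2) 2(4)[of "ts ! i"] that by simp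
  then have "tupling C (pow_obj C X n) X (arity Th f) (\<lambda>i. map (trm_arrow C Th X \<alpha> n) ts ! i)
      \<in> Hom C (pow_obj C X n) (pow_obj C X (arity Th f))"
    using tupling_spec[of "pow_obj C X n" X "arity Th f"] s(1) pow_arr(1) by blast
  then show ?case using s 2(1) by simp
qed

text \<open>Carries equations through arrows compatible with the operations: the two sides of an
  equation are compared after composition with \<open>h\<close>.\<close>

lemma trm_arrow_natural:
  assumes "wf_trm Th n t" "structure_on X \<alpha>" "structure_on Y \<beta>" "h \<in> Hom C X Y"
    "\<And>f. f \<in> Ops Th \<Longrightarrow> h \<cdot> \<alpha> f = \<beta> f \<cdot> pow_map C (arity Th f) h"
  shows "h \<cdot> trm_arrow C Th X \<alpha> n t = trm_arrow C Th Y \<beta> n t \<cdot> pow_map C n h"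
  using assms(1)
proof induction
  case (1 i)
  then show ?case using structure_onD(1)[OF assms(2)] structure_onD(1)[OF assms(3)] assms(4) by simp
next
  case (2 f ts)
  note s = structure_onD[OF assms(2)] and s' = structure_onD[OF assms(3)]
  let ?n = "arity Th f"
  let ?a = "\<lambda>i. map (trm_arrow C Th X \<alpha> n) ts ! i" and ?b = "\<lambda>i. map (trm_arrow C Th Y \<beta> n) ts ! i"
  let ?ta = "tupling C (pow_obj C X n) X ?n ?a" and ?tb = "tupling C (pow_obj C Y n) Y ?n ?b"
  have h: "h \<in> Arr C" "Dom C h = X" "Cod C h = Y" using assms(4) by simp_all
  have wf: "wf_trm Th n (ts ! i)" if "i < ?n" for i using 2(2,3) that by simp
  have a: "?a i \<in> Hom C (pow_obj C X n) X" and b: "?b i \<in> Hom C (pow_obj C Y n) Y" if "i < ?n" for i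
    using trm_arrow_arr[OF wf[OF that]] assms(2,3) 2(2) that by simp_all
  have ta: "?ta \<in> Hom C (pow_obj C X n) (pow_obj C X ?n)" "\<And>i. i < ?n \<Longrightarrow> pow_proj C X ?n i \<cdot> ?ta = ?a i"
    using tupling_spec[where u = ?a, OF pow_arr(1)[OF s(1)] s(1) a] by blast+
  have tb: "?tb \<in> Hom C (pow_obj C Y n) (pow_obj C Y ?n)" "\<And>i. i < ?n \<Longrightarrow> pow_proj C Y ?n i \<cdot> ?tb = ?b i"
    using tupling_spec[where u = ?b, OF pow_arr(1)[OF s'(1)] s'(1) b] by blast+
  have "pow_map C ?n h \<cdot> ?ta = ?tb \<cdot> pow_map C n h"
  proof (rule pow_ext[of _ _ Y ?n])
    fix i assume i: "i < ?n"
    have "pow_proj C Y ?n i \<cdot> pow_map C ?n h \<cdot> ?ta = h \<cdot> pow_proj C X ?n i \<cdot> ?ta"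
      using proj_pow_map_comp[of h i ?n Y ?ta] h i ta(1) by simp
    also have "\<dots> = h \<cdot> ?a i" using ta(2)[OF i] by simp
    also have "\<dots> = ?b i \<cdot> pow_map C n h" using 2(2) 2(4)[of "ts ! i"] i by simp
    also have "\<dots> = pow_proj C Y ?n i \<cdot> ?tb \<cdot> pow_map C n h"
      by (rule comp_assoc_subst[OF tb(2)[OF i], symmetric]) (use tb(1) h s' i in simp_all)
    finally show "pow_proj C Y ?n i \<cdot> pow_map C ?n h \<cdot> ?ta = pow_proj C Y ?n i \<cdot> ?tb \<cdot> pow_map C n h" .
  qed (use ta(1) tb(1) h s' in simp_all)
  moreover have "h \<cdot> \<alpha> f \<cdot> ?ta = \<beta> f \<cdot> pow_map C ?n h \<cdot> ?ta"
    by (rule square_comp[OF assms(5)[OF 2(1)]]) (use h s s' 2(1) ta(1) in simp_all)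
  moreover have "(\<beta> f \<cdot> ?tb) \<cdot> pow_map C n h = \<beta> f \<cdot> ?tb \<cdot> pow_map C n h"
    by (rule comp_assoc) (use h s' 2(1) tb(1) in simp_all)
  ultimately show ?case by simp
qed

text \<open>Limits, suprema of subalgebras and images of algebras all arise by lifting operations along a
  jointly monic family into algebras.\<close>

lemma initial_algebra:
  assumes L: "L \<in> Obj C"
    and D: "\<And>v. v \<in> V \<Longrightarrow> is_algebra C Th (D v)"
    and p: "\<And>v. v \<in> V \<Longrightarrow> p v \<in> Hom C L (fst (D v))"
    and mono: "\<And>a b. a \<in> Arr C \<Longrightarrow> b \<in> Arr C \<Longrightarrow> Dom C a = Dom C b \<Longrightarrow> Cod C a = L \<Longrightarrow> Cod C b = L \<Longrightarrow>
      (\<And>v. v \<in> V \<Longrightarrow> p v \<cdot> a = p v \<cdot> b) \<Longrightarrow> a = b"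
    and ops: "\<And>f. f \<in> Ops Th \<Longrightarrow> \<exists>w \<in> Hom C (pow_obj C L (arity Th f)) L.
      \<forall>v \<in> V. p v \<cdot> w = snd (D v) f \<cdot> pow_map C (arity Th f) (p v)"
  shows "\<exists>\<alpha>. is_algebra C Th (L, \<alpha>) \<and> (\<forall>v \<in> V. is_algebra_hom C Th (L, \<alpha>) (p v) (D v))"
proof -
  obtain \<omega> where \<omega>: "\<And>f. f \<in> Ops Th \<Longrightarrow> \<omega> f \<in> Hom C (pow_obj C L (arity Th f)) L \<and>
      (\<forall>v \<in> V. p v \<cdot> \<omega> f = snd (D v) f \<cdot> pow_map C (arity Th f) (p v))"
    using ops by metis
  \<comment> \<open>Algebras take the value \<open>undefined\<close> outside the signature, so that
    the operations are determined by their restriction to \<open>Ops Th\<close>.\<close>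
  define \<alpha> where "\<alpha> f = (if f \<in> Ops Th then \<omega> f else undefined)" for f
  have \<alpha>: "\<alpha> f \<in> Hom C (pow_obj C L (arity Th f)) L"
    "\<And>v. v \<in> V \<Longrightarrow> p v \<cdot> \<alpha> f = snd (D v) f \<cdot> pow_map C (arity Th f) (p v)" if "f \<in> Ops Th" for f
    using \<omega>[OF that] that unfolding \<alpha>_def by (simp_all del: Hom_iff)
  have st: "structure_on L \<alpha>" unfolding structure_on_def using L \<alpha> by blast
  have "trm_arrow C Th L \<alpha> n s = trm_arrow C Th L \<alpha> n t" if eq: "(n, s, t) \<in> Eqs Th" for n s t
  proof -
    have wf: "wf_trm Th n s" "wf_trm Th n t" using wf_theory eq unfolding is_alg_theory_def by blast+
    note tr = trm_arrow_arr[OF wf(1) st] trm_arrow_arr[OF wf(2) st]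
    show ?thesis
    proof (rule mono)
      fix v assume v: "v \<in> V"
      have Dv: "trm_arrow C Th (fst (D v)) (snd (D v)) n s = trm_arrow C Th (fst (D v)) (snd (D v)) n t"
        using D[OF v] eq unfolding is_algebra_def by (cases "D v") auto
      have "p v \<cdot> trm_arrow C Th L \<alpha> n u = trm_arrow C Th (fst (D v)) (snd (D v)) n u \<cdot> pow_map C n (p v)"
        if "wf_trm Th n u" for u
        by (rule trm_arrow_natural[OF that st algebra_structure[OF D[OF v]] p[OF v] \<alpha>(2)[OF _ v]])
      then show "p v \<cdot> trm_arrow C Th L \<alpha> n s = p v \<cdot> trm_arrow C Th L \<alpha> n t" using wf Dv by simp
    qed (use tr in simp_all)
  qed
  then have "is_algebra C Th (L, \<alpha>)"
    unfolding is_algebra_def using st structure_on_def by (auto simp: \<alpha>_def simp del: Hom_iff)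
  moreover have "is_algebra_hom C Th (L, \<alpha>) (p v) (D v)" if "v \<in> V" for v
    unfolding is_algebra_hom_def using p[OF that] \<alpha>(2)[OF _ that] by simp
  ultimately show ?thesis by blast
qed

lemma hom_comp:
  assumes "is_algebra C Th A" "is_algebra C Th B" "is_algebra C Th D"
    "is_algebra_hom C Th A h B" "is_algebra_hom C Th B g D"
  shows "is_algebra_hom C Th A (g \<cdot> h) D"
proof -
  note h = homD[OF assms(4)] and g = homD[OF assms(5)]
  note A = algD[OF assms(1)] and B = algD[OF assms(2)] and D = algD[OF assms(3)]
  have "(g \<cdot> h) \<cdot> snd A f = snd D f \<cdot> pow_map C (arity Th f) (g \<cdot> h)" if f: "f \<in> Ops Th" for f
  proof -
    have "(g \<cdot> h) \<cdot> snd A f = g \<cdot> h \<cdot> snd A f" by (rule comp_assoc) (use h(1-3) g(1-3) A f in simp_all)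
    also have "\<dots> = g \<cdot> snd B f \<cdot> pow_map C (arity Th f) h" using h(4)[OF f] by simp
    also have "\<dots> = snd D f \<cdot> pow_map C (arity Th f) g \<cdot> pow_map C (arity Th f) h"
      by (rule square_comp[OF g(4)[OF f]]) (use h(1-3) g(1-3) A B D f in simp_all)
    also have "\<dots> = snd D f \<cdot> pow_map C (arity Th f) (g \<cdot> h)"
      using pow_map_comp[of g h] h(1-3) g(1-3) by simp
    finally show ?thesis .
  qed
  then show ?thesis unfolding is_algebra_hom_def using h(1-3) g(1-3) by simp
qed

lemma hom_id:
  assumes "is_algebra C Th A"
  shows "is_algebra_hom C Th A (Id C (fst A)) A"
  unfolding is_algebra_hom_def using algD[OF assms] by (simp add: pow_map_id)

text \<open>The other half of initiality: composing with the jointly monic \<open>p v\<close>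
  reduces compatibility of \<open>k\<close> with an operation to that of
  \<open>p v \<cdot> k\<close>.\<close>

lemma initial_hom:
  assumes A: "is_algebra C Th A" and K: "is_algebra C Th K" and k: "k \<in> Hom C (fst K) (fst A)"
    and D: "\<And>v. v \<in> V \<Longrightarrow> is_algebra C Th (D v)"
    and p: "\<And>v. v \<in> V \<Longrightarrow> is_algebra_hom C Th A (p v) (D v)"
    and mono: "\<And>a b. a \<in> Arr C \<Longrightarrow> b \<in> Arr C \<Longrightarrow> Dom C a = Dom C b \<Longrightarrow> Cod C a = fst A \<Longrightarrow> Cod C b = fst A \<Longrightarrow>
      (\<And>v. v \<in> V \<Longrightarrow> p v \<cdot> a = p v \<cdot> b) \<Longrightarrow> a = b"
    and hom: "\<And>v. v \<in> V \<Longrightarrow> is_algebra_hom C Th K (p v \<cdot> k) (D v)"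
  shows "is_algebra_hom C Th K k A"
proof -
  have k': "k \<in> Arr C" "Dom C k = fst K" "Cod C k = fst A" using k by simp_all
  note A' = algD[OF A] and K' = algD[OF K]
  have "k \<cdot> snd K f = snd A f \<cdot> pow_map C (arity Th f) k" if f: "f \<in> Ops Th" for f
  proof (rule mono)
    fix v assume v: "v \<in> V"
    note D' = algD[OF D[OF v]] and p' = homD[OF p[OF v]]
    have "p v \<cdot> snd A f \<cdot> pow_map C (arity Th f) k = snd (D v) f \<cdot> pow_map C (arity Th f) (p v) \<cdot> pow_map C (arity Th f) k"
      by (rule square_comp[OF p'(4)[OF f]]) (use k' A' D' p'(1-3) f in simp_all)
    also have "\<dots> = snd (D v) f \<cdot> pow_map C (arity Th f) (p v \<cdot> k)"
      using pow_map_comp[of "p v" k] k' p'(1-3) by simp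
    also have "\<dots> = (p v \<cdot> k) \<cdot> snd K f" using homD(4)[OF hom[OF v] f] by simp
    also have "\<dots> = p v \<cdot> k \<cdot> snd K f" by (rule comp_assoc) (use k' K' p'(1-3) f in simp_all)
    finally show "p v \<cdot> k \<cdot> snd K f = p v \<cdot> snd A f \<cdot> pow_map C (arity Th f) k" by simp
  qed (use k' A' K' f in simp_all)
  then show ?thesis unfolding is_algebra_hom_def using k by simp
qed

section \<open>The category of algebras\<close>

abbreviation AC where "AC \<equiv> Alg Th C"

lemma Alg_simps [simp]:
  "A \<in> Obj AC \<longleftrightarrow> is_algebra C Th A"
  "h \<in> Arr AC \<longleftrightarrow> is_algebra C Th (fst h) \<and> is_algebra C Th (snd (snd h)) \<and>
    is_algebra_hom C Th (fst h) (U_arr h) (snd (snd h))"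
  "Dom AC h = fst h" "Cod AC h = snd (snd h)"
  "Id AC A = (A, Id C (fst A), A)"
  "Comp AC g h = (fst h, U_arr g \<cdot> U_arr h, snd (snd g))"
  unfolding Alg_def U_arr_def by (auto simp: case_prod_beta)

lemma U_arr_simp [simp]: "U_arr (A, h, B) = h"
  by (simp add: U_arr_def)

lemma alg_arr_eq: "g = h \<longleftrightarrow> fst g = fst h \<and> U_arr g = U_arr h \<and> snd (snd g) = snd (snd h)"
  unfolding U_arr_def by (cases g, cases h) auto

lemma alg_category: "category AC"
proof unfold_locales
  fix h assume h: "h \<in> Arr AC"
  then show "Dom AC h \<in> Obj AC" "Cod AC h \<in> Obj AC" by simp_all
next
  fix A assume "A \<in> Obj AC"
  then show "Id AC A \<in> Hom AC A A" unfolding Hom_def by (simp add: hom_id)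
next
  fix f A B g D assume "f \<in> Hom AC A B" "g \<in> Hom AC B D"
  then show "Comp AC g f \<in> Hom AC A D" unfolding Hom_def
    using hom_comp[of "fst f" "snd (snd f)" "snd (snd g)" "U_arr f" "U_arr g"] by auto
next
  fix f A B assume "f \<in> Hom AC A B"
  then show "Comp AC (Id AC B) f = f" "Comp AC f (Id AC A) = f"
    unfolding Hom_def alg_arr_eq using homD(1-3)[of "fst f" "U_arr f" "snd (snd f)"] by auto
next
  fix f A B g D h E assume "f \<in> Hom AC A B" "g \<in> Hom AC B D" "h \<in> Hom AC D E"
  then show "Comp AC h (Comp AC g f) = Comp AC (Comp AC h g) f"
    unfolding Hom_def using homD(1-3)[of "fst f" "U_arr f" "snd (snd f)"]
      homD(1-3)[of "fst g" "U_arr g" "snd (snd g)"] homD(1-3)[of "fst h" "U_arr h" "snd (snd h)"] by auto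
qed

end

sublocale algebras \<subseteq> Alg: category "Alg Th C"
  by (rule alg_category)

section \<open>Finite limits of algebras\<close>

context category begin

lemma limitD:
  assumes "is_limit C V W s t D M L p"
  shows "L \<in> Obj C" "v \<in> V \<Longrightarrow> p v \<in> Hom C L (D v)" "e \<in> W \<Longrightarrow> M e \<cdot> p (s e) = p (t e)"
    "is_cone C V W s t D M L p"
  using assms unfolding is_limit_def is_cone_def by blast+

lemma limit_lift:
  assumes "is_limit C V W s t D M L p" "is_cone C V W s t D M K q"
  obtains h where "h \<in> Hom C K L" "\<And>v. v \<in> V \<Longrightarrow> p v \<cdot> h = q v"
  using assms unfolding is_limit_def by metis

lemma cone_comp:
  assumes "is_diagram C V W s t D M" "is_cone C V W s t D M L p" "a \<in> Arr C" "Cod C a = L"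
  shows "is_cone C V W s t D M (Dom C a) (\<lambda>v. p v \<cdot> a)"
  unfolding is_cone_def
proof (intro conjI ballI)
  show "Dom C a \<in> Obj C" using assms(3) by simp
  have p: "p v \<in> Hom C L (D v)" if "v \<in> V" for v using assms(2) that unfolding is_cone_def by blast
  show "p v \<cdot> a \<in> Hom C (Dom C a) (D v)" if "v \<in> V" for v using p[OF that] assms(3,4) by simp
  fix e assume e: "e \<in> W"
  have M: "s e \<in> V" "t e \<in> V" "M e \<in> Hom C (D (s e)) (D (t e))"
    using assms(1) e unfolding is_diagram_def by blast+
  have "M e \<cdot> p (s e) = p (t e)" using assms(2) e unfolding is_cone_def by blast
  from comp_assoc_subst[OF this, of a] show "M e \<cdot> p (s e) \<cdot> a = p (t e) \<cdot> a"
    using p[OF M(1)] M(3) assms(3,4) by simp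
qed

lemma limit_unique:
  assumes "is_diagram C V W s t D M" "is_limit C V W s t D M L p" "a \<in> Arr C" "b \<in> Arr C"
    "Dom C a = Dom C b" "Cod C a = L" "Cod C b = L" "\<And>v. v \<in> V \<Longrightarrow> p v \<cdot> a = p v \<cdot> b"
  shows "a = b"
proof -
  have "is_cone C V W s t D M (Dom C a) (\<lambda>v. p v \<cdot> a)"
    by (rule cone_comp[OF assms(1) limitD(4)[OF assms(2)] assms(3,6)])
  then have "\<exists>!h. h \<in> Hom C (Dom C a) L \<and> (\<forall>v\<in>V. p v \<cdot> h = p v \<cdot> a)"
    using assms(2) unfolding is_limit_def by blast
  moreover have "a \<in> Hom C (Dom C a) L" "b \<in> Hom C (Dom C a) L" using assms(3-7) by simp_all
  moreover have "\<forall>v\<in>V. p v \<cdot> b = p v \<cdot> a" using assms(8) by simp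
  ultimately show ?thesis by blast
qed

lemma limitI:
  assumes "is_cone C V W s t D M L p"
    "\<And>K q. is_cone C V W s t D M K q \<Longrightarrow> \<exists>h \<in> Hom C K L. \<forall>v\<in>V. p v \<cdot> h = q v"
    "\<And>a b. a \<in> Arr C \<Longrightarrow> b \<in> Arr C \<Longrightarrow> Dom C a = Dom C b \<Longrightarrow> Cod C a = L \<Longrightarrow> Cod C b = L \<Longrightarrow>
      (\<And>v. v \<in> V \<Longrightarrow> p v \<cdot> a = p v \<cdot> b) \<Longrightarrow> a = b"
  shows "is_limit C V W s t D M L p"
  unfolding is_limit_def
proof (intro conjI allI impI)
  fix K q assume "is_cone C V W s t D M K q"
  then obtain h where h: "h \<in> Hom C K L" "\<forall>v\<in>V. p v \<cdot> h = q v" using assms(2) by blast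
  show "\<exists>!h. h \<in> Hom C K L \<and> (\<forall>v\<in>V. p v \<cdot> h = q v)"
  proof (rule ex1I)
    show "h \<in> Hom C K L \<and> (\<forall>v\<in>V. p v \<cdot> h = q v)" using h by blast
    fix k assume k: "k \<in> Hom C K L \<and> (\<forall>v\<in>V. p v \<cdot> k = q v)"
    show "k = h" by (rule assms(3)) (use h k in simp_all)
  qed
qed fact

end

context algebras begin

text \<open>The powers of the projections, followed by the operations of the \<open>D v\<close>,
  form a cone whose vertex is a power of \<open>L\<close>; it induces the operations on
  \<open>L\<close>. Uniqueness of induced arrows says that the projections are jointly monic, so
  \<open>initial_algebra\<close> and \<open>initial_hom\<close> apply.\<close>

lemma alg_limit_lift:
  assumes d: "is_diagram AC V W s t D M"
    and L: "is_limit C V W s t (\<lambda>v. fst (D v)) (\<lambda>e. U_arr (M e)) L p"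
  shows "\<exists>\<alpha>. is_limit AC V W s t D M (L, \<alpha>) (\<lambda>v. ((L, \<alpha>), p v, D v))"
proof -
  note Ld = limitD[OF L]
  have D: "is_algebra C Th (D v)" if "v \<in> V" for v using d that unfolding is_diagram_def by simp
  have M: "s e \<in> V" "t e \<in> V" "fst (M e) = D (s e)" "snd (snd (M e)) = D (t e)"
    "is_algebra_hom C Th (D (s e)) (U_arr (M e)) (D (t e))" if "e \<in> W" for e
    using d that unfolding is_diagram_def by auto
  have dC: "is_diagram C V W s t (\<lambda>v. fst (D v)) (\<lambda>e. U_arr (M e))"
    unfolding is_diagram_def using M homD(1-3)[OF M(5)] algD(1)[OF D] by simp
  note uniq = limit_unique[OF dC L]
  have p: "p v \<in> Arr C" "Dom C (p v) = L" "Cod C (p v) = fst (D v)" if "v \<in> V" for v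
    using Ld(2)[OF that] by simp_all
  have ops: "\<exists>w \<in> Hom C (pow_obj C L (arity Th f)) L.
      \<forall>v \<in> V. p v \<cdot> w = snd (D v) f \<cdot> pow_map C (arity Th f) (p v)" if f: "f \<in> Ops Th" for f
  proof -
    let ?n = "arity Th f"
    have "is_cone C V W s t (\<lambda>v. fst (D v)) (\<lambda>e. U_arr (M e)) (pow_obj C L ?n)
        (\<lambda>v. snd (D v) f \<cdot> pow_map C ?n (p v))"
      unfolding is_cone_def
    proof (intro conjI ballI)
      show "pow_obj C L ?n \<in> Obj C" using Ld(1) by simp
      show "snd (D v) f \<cdot> pow_map C ?n (p v) \<in> Hom C (pow_obj C L ?n) (fst (D v))" if "v \<in> V" for v
        using p[OF that] algD[OF D[OF that]] f by simp
      fix e assume e: "e \<in> W"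
      note M' = M[OF e] and m = homD[OF M(5)[OF e]]
      note ps = p[OF M'(1)] and pt = p[OF M'(2)] and Ds = algD[OF D[OF M'(1)]] and Dt = algD[OF D[OF M'(2)]]
      have "U_arr (M e) \<cdot> snd (D (s e)) f \<cdot> pow_map C ?n (p (s e)) =
          snd (D (t e)) f \<cdot> pow_map C ?n (U_arr (M e)) \<cdot> pow_map C ?n (p (s e))"
        by (rule square_comp[OF m(4)[OF f]]) (use m(1-3) ps Ds Dt f in simp_all)
      also have "\<dots> = snd (D (t e)) f \<cdot> pow_map C ?n (U_arr (M e) \<cdot> p (s e))"
        using pow_map_comp[of "U_arr (M e)" "p (s e)"] m(1-3) ps by simp
      finally show "U_arr (M e) \<cdot> snd (D (s e)) f \<cdot> pow_map C ?n (p (s e)) =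
          snd (D (t e)) f \<cdot> pow_map C ?n (p (t e))"
        using Ld(3)[OF e] by simp
    qed
    from limit_lift[OF L this] show ?thesis by metis
  qed
  obtain \<alpha> where \<alpha>: "is_algebra C Th (L, \<alpha>)" and hom: "\<And>v. v \<in> V \<Longrightarrow> is_algebra_hom C Th (L, \<alpha>) (p v) (D v)"
    using initial_algebra[OF Ld(1) D Ld(2) uniq ops] by blast
  have "is_limit AC V W s t D M (L, \<alpha>) (\<lambda>v. ((L, \<alpha>), p v, D v))"
  proof (rule Alg.limitI)
    show "is_cone AC V W s t D M (L, \<alpha>) (\<lambda>v. ((L, \<alpha>), p v, D v))"
      unfolding is_cone_def using \<alpha> hom D M Ld(3) by (simp add: alg_arr_eq)
  next
    fix K q assume q: "is_cone AC V W s t D M K q"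
    have K: "is_algebra C Th K" using q unfolding is_cone_def by simp
    have qv: "fst (q v) = K" "snd (snd (q v)) = D v" "is_algebra_hom C Th K (U_arr (q v)) (D v)" if "v \<in> V" for v
      using q that unfolding is_cone_def by auto
    have "is_cone C V W s t (\<lambda>v. fst (D v)) (\<lambda>e. U_arr (M e)) (fst K) (\<lambda>v. U_arr (q v))"
      unfolding is_cone_def
    proof (intro conjI ballI)
      show "fst K \<in> Obj C" using algD(1)[OF K] .
      show "U_arr (q v) \<in> Hom C (fst K) (fst (D v))" if "v \<in> V" for v using homD(1-3)[OF qv(3)[OF that]] by simp
      show "U_arr (M e) \<cdot> U_arr (q (s e)) = U_arr (q (t e))" if "e \<in> W" for e
      proof -
        have "M e \<cdot>\<^bsub>AC\<^esub> q (s e) = q (t e)" using q that unfolding is_cone_def by blast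
        then show ?thesis by (metis Alg_simps(6) U_arr_simp)
      qed
    qed
    from limit_lift[OF L this] obtain h where h: "h \<in> Hom C (fst K) L"
      "\<And>v. v \<in> V \<Longrightarrow> p v \<cdot> h = U_arr (q v)" by metis
    have hh: "is_algebra_hom C Th K h (L, \<alpha>)"
      by (rule initial_hom[where V = V and D = D and p = p, OF \<alpha> K _ D hom])
        (use h qv(3) uniq in simp_all)
    then have "(K, h, (L, \<alpha>)) \<in> Hom AC K (L, \<alpha>)" using K \<alpha> by (simp add: Hom_def)
    moreover have "\<forall>v\<in>V. ((L, \<alpha>), p v, D v) \<cdot>\<^bsub>AC\<^esub> (K, h, (L, \<alpha>)) = q v"
      using qv h(2) by (simp add: alg_arr_eq)
    ultimately show "\<exists>h\<in>Hom AC K (L, \<alpha>). \<forall>v\<in>V. ((L, \<alpha>), p v, D v) \<cdot>\<^bsub>AC\<^esub> h = q v" by blast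
  next
    fix a b assume ab: "a \<in> Arr AC" "b \<in> Arr AC" "Dom AC a = Dom AC b" "Cod AC a = (L, \<alpha>)" "Cod AC b = (L, \<alpha>)"
      and eq: "\<And>v. v \<in> V \<Longrightarrow> ((L, \<alpha>), p v, D v) \<cdot>\<^bsub>AC\<^esub> a = ((L, \<alpha>), p v, D v) \<cdot>\<^bsub>AC\<^esub> b"
    have ha: "is_algebra_hom C Th (fst a) (U_arr a) (snd (snd a))"
      and hb: "is_algebra_hom C Th (fst b) (U_arr b) (snd (snd b))" using ab by simp_all
    have "U_arr a = U_arr b"
      by (rule uniq) (use ab(3-5) homD(1-3)[OF ha] homD(1-3)[OF hb] eq in \<open>auto simp: alg_arr_eq\<close>)
    then show "a = b" using ab unfolding alg_arr_eq by simp
  qed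
  then show ?thesis by blast
qed

lemma diagram_base:
  assumes d: "is_diagram AC V W s t D M"
  shows "is_diagram C V W s t (\<lambda>v. fst (D v)) (\<lambda>e. U_arr (M e))"
  unfolding is_diagram_def
proof (intro conjI ballI)
  show "fst (D v) \<in> Obj C" if "v \<in> V" for v using d that algD(1) unfolding is_diagram_def by simp
  fix e assume "e \<in> W"
  then have M: "s e \<in> V" "t e \<in> V" "M e \<in> Hom AC (D (s e)) (D (t e))"
    using d unfolding is_diagram_def by blast+
  then have "is_algebra_hom C Th (D (s e)) (U_arr (M e)) (D (t e))" by auto
  from homD(1-3)[OF this] show "s e \<in> V" "t e \<in> V" "U_arr (M e) \<in> Hom C (fst (D (s e))) (fst (D (t e)))"
    using M by simp_all
qed

lemma alg_finitely_complete: "finitely_complete AC"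
  unfolding finitely_complete_def
proof (intro allI impI)
  fix V W s t and D :: "nat \<Rightarrow> 'a \<times> ('f \<Rightarrow> 'b)" and M
  assume *: "finite V \<and> finite W \<and> is_diagram AC V W s t D M"
  then obtain L p where "is_limit C V W s t (\<lambda>v. fst (D v)) (\<lambda>e. U_arr (M e)) L p"
    using ex_limit[OF _ _ diagram_base] by metis
  then show "\<exists>L p. is_limit AC V W s t D M L p" using * alg_limit_lift by blast
qed

end

sublocale algebras \<subseteq> Alg: complete_category "Alg Th C"
  using complete_category.intro[OF alg_category complete_category_axioms.intro[OF alg_finitely_complete]] .

context algebras begin

text \<open>A limit of algebras is known only up to isomorphism, so it is compared with the one
  lifted from the base. Chosen pullbacks of algebras become accessible only in this way.\<close>

lemma alg_limit_base:
  assumes fin: "finite V" "finite W" and d: "is_diagram AC V W s t D M"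
    and L': "is_limit AC V W s t D M L' p'"
  shows "is_limit C V W s t (\<lambda>v. fst (D v)) (\<lambda>e. U_arr (M e)) (fst L') (\<lambda>v. U_arr (p' v))"
proof -
  note dC = diagram_base[OF d]
  obtain L p where L: "is_limit C V W s t (\<lambda>v. fst (D v)) (\<lambda>e. U_arr (M e)) L p"
    using ex_limit[OF fin dC] by metis
  obtain \<alpha> where A: "is_limit AC V W s t D M (L, \<alpha>) (\<lambda>v. ((L, \<alpha>), p v, D v))"
    using alg_limit_lift[OF d L] by blast
  note Ld = limitD[OF L] and L'd = Alg.limitD[OF L'] and Ad = Alg.limitD[OF A]
  obtain i where i: "i \<in> Hom AC L' (L, \<alpha>)" "\<And>v. v \<in> V \<Longrightarrow> ((L, \<alpha>), p v, D v) \<cdot>\<^bsub>AC\<^esub> i = p' v"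
    using Alg.limit_lift[OF A L'd(4)] by metis
  obtain j where j: "j \<in> Hom AC (L, \<alpha>) L'" "\<And>v. v \<in> V \<Longrightarrow> p' v \<cdot>\<^bsub>AC\<^esub> j = ((L, \<alpha>), p v, D v)"
    using Alg.limit_lift[OF L' Ad(4)] by metis
  have iC: "U_arr i \<in> Arr C" "Dom C (U_arr i) = fst L'" "Cod C (U_arr i) = L"
    using i(1) homD(1-3)[of "fst i" "U_arr i" "snd (snd i)"] by auto
  have jC: "U_arr j \<in> Arr C" "Dom C (U_arr j) = L" "Cod C (U_arr j) = fst L'"
    using j(1) homD(1-3)[of "fst j" "U_arr j" "snd (snd j)"] by auto
  have p'C: "U_arr (p' v) \<in> Arr C" "Dom C (U_arr (p' v)) = fst L'" "Cod C (U_arr (p' v)) = fst (D v)" if "v \<in> V" for v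
    using L'd(2)[OF that] homD(1-3)[of "fst (p' v)" "U_arr (p' v)" "snd (snd (p' v))"] by auto
  have pC: "p v \<in> Arr C" "Dom C (p v) = L" "Cod C (p v) = fst (D v)" if "v \<in> V" for v
    using Ld(2)[OF that] by simp_all
  have pi: "p v \<cdot> U_arr i = U_arr (p' v)" if "v \<in> V" for v using i(2)[OF that] by (metis Alg_simps(6) U_arr_simp)
  have pj: "U_arr (p' v) \<cdot> U_arr j = p v" if "v \<in> V" for v using j(2)[OF that] by (metis Alg_simps(6) U_arr_simp)
  \<comment> \<open>This composite is all that the transport uses: \<open>j\<close> carries lifts
    from \<open>L\<close> to \<open>L'\<close>, and arrows into \<open>L'\<close> that agree after
    \<open>i\<close> agree after applying \<open>j\<close> as well.\<close>
  have "j \<cdot>\<^bsub>AC\<^esub> i = Id AC L'"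
  proof (rule Alg.limit_unique[OF d L'])
    have ij: "i \<in> Arr AC" "j \<in> Arr AC" "Cod AC i = Dom AC j" "Dom AC i = L'" "Cod AC j = L'" "L' \<in> Obj AC"
      using i(1) j(1) L'd(1) unfolding Hom_def by auto
    show "j \<cdot>\<^bsub>AC\<^esub> i \<in> Arr AC" "Id AC L' \<in> Arr AC" "Dom AC (j \<cdot>\<^bsub>AC\<^esub> i) = Dom AC (Id AC L')"
      "Cod AC (j \<cdot>\<^bsub>AC\<^esub> i) = L'" "Cod AC (Id AC L') = L'"
      using Alg.comp_arr[OF ij(1-3)] Alg.id_arr[OF ij(6)] ij(4,5) by metis+
    fix v assume v: "v \<in> V"
    have p': "p' v \<in> Arr AC" "Dom AC (p' v) = L'" using L'd(2)[OF v] unfolding Hom_def by auto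
    have "p' v \<cdot>\<^bsub>AC\<^esub> j \<cdot>\<^bsub>AC\<^esub> i = ((L, \<alpha>), p v, D v) \<cdot>\<^bsub>AC\<^esub> i"
      by (rule Alg.comp_assoc_subst[OF j(2)[OF v] ij(1,2) p'(1) ij(3)]) (use p'(2) ij(5) in metis)
    also have "\<dots> = p' v" by (rule i(2)[OF v])
    also have "\<dots> = p' v \<cdot>\<^bsub>AC\<^esub> Id AC L'" using Alg.comp_id(2)[OF p'] by (rule sym)
    finally show "p' v \<cdot>\<^bsub>AC\<^esub> j \<cdot>\<^bsub>AC\<^esub> i = p' v \<cdot>\<^bsub>AC\<^esub> Id AC L'" .
  qed
  then have ji: "U_arr j \<cdot> U_arr i = Id C (fst L')" by (metis Alg_simps(5,6) U_arr_simp)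
  show ?thesis
  proof (rule limitI)
    have "fst L' \<in> Obj C" using L'd(1) algD(1) by simp
    moreover have "U_arr (M e) \<cdot> U_arr (p' (s e)) = U_arr (p' (t e))" if "e \<in> W" for e
      using L'd(3)[OF that] by (metis Alg_simps(6) U_arr_simp)
    ultimately show "is_cone C V W s t (\<lambda>v. fst (D v)) (\<lambda>e. U_arr (M e)) (fst L') (\<lambda>v. U_arr (p' v))"
      unfolding is_cone_def using p'C by simp
  next
    fix K q assume "is_cone C V W s t (\<lambda>v. fst (D v)) (\<lambda>e. U_arr (M e)) K q"
    then obtain h where h: "h \<in> Hom C K L" "\<And>v. v \<in> V \<Longrightarrow> p v \<cdot> h = q v" using limit_lift[OF L] by metis
    have "U_arr (p' v) \<cdot> U_arr j \<cdot> h = q v" if "v \<in> V" for v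
      using comp_assoc_subst[OF pj[OF that], of h] h p'C[OF that] jC that by simp
    moreover have "U_arr j \<cdot> h \<in> Hom C K (fst L')" using h(1) jC by simp
    ultimately show "\<exists>h\<in>Hom C K (fst L'). \<forall>v\<in>V. U_arr (p' v) \<cdot> h = q v" by blast
  next
    fix a b assume ab: "a \<in> Arr C" "b \<in> Arr C" "Dom C a = Dom C b" "Cod C a = fst L'" "Cod C b = fst L'"
      and eq: "\<And>v. v \<in> V \<Longrightarrow> U_arr (p' v) \<cdot> a = U_arr (p' v) \<cdot> b"
    have "U_arr i \<cdot> a = U_arr i \<cdot> b"
    proof (rule limit_unique[OF dC L])
      fix v assume v: "v \<in> V"
      show "p v \<cdot> U_arr i \<cdot> a = p v \<cdot> U_arr i \<cdot> b"
        using comp_assoc_subst[OF pi[OF v], of a] comp_assoc_subst[OF pi[OF v], of b] eq[OF v] ab iC pC[OF v] by simp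
    qed (use ab iC in simp_all)
    then have "U_arr j \<cdot> U_arr i \<cdot> a = U_arr j \<cdot> U_arr i \<cdot> b" by simp
    then show "a = b"
      using comp_assoc_subst[OF ji, of a] comp_assoc_subst[OF ji, of b] ab iC jC by simp
  qed
qed

lemma alg_pullback_base:
  assumes "is_pullback AC f g P p q"
  shows "is_pullback C (U_arr f) (U_arr g) (fst P) (U_arr p) (U_arr q)"
proof -
  note P = Alg.pullbackD[OF assms]
  let ?D = "\<lambda>i::nat. if i = 0 then Dom AC f else if i = 1 then Dom AC g else Cod AC f"
  let ?M = "\<lambda>i::nat. if i = 0 then f else g"
  let ?r = "\<lambda>i::nat. if i = 0 then p else if i = 1 then q else f \<cdot>\<^bsub>AC\<^esub> p"
  have d: "is_diagram AC {0,1,2} {0,1} (\<lambda>i. i) (\<lambda>_. 2) ?D ?M"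
    unfolding is_diagram_def Hom_def using P(1-3) Alg.arr_obj by (simp del: Alg_simps)
  have "is_limit AC {0,1,2} {0,1} (\<lambda>i. i) (\<lambda>_. 2) ?D ?M P ?r"
    using Alg.pullback_iff_limit[OF P(1-3), of P ?r] assms by (simp del: Alg_simps)
  from alg_limit_base[OF _ _ d this]
  have L: "is_limit C {0,1,2} {0,1} (\<lambda>i. i) (\<lambda>_. 2) (\<lambda>v. fst (?D v)) (\<lambda>e. U_arr (?M e)) (fst P) (\<lambda>v. U_arr (?r v))"
    by simp
  have fC: "U_arr f \<in> Arr C" "Dom C (U_arr f) = fst (Dom AC f)" "Cod C (U_arr f) = fst (Cod AC f)"
    using P(1) homD(1-3)[of "fst f" "U_arr f" "snd (snd f)"] by auto
  have gC: "U_arr g \<in> Arr C" "Dom C (U_arr g) = fst (Dom AC g)" "Cod C (U_arr g) = fst (Cod AC g)"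
    using P(2) homD(1-3)[of "fst g" "U_arr g" "snd (snd g)"] by auto
  have eqs: "(\<lambda>v. fst (?D v)) = (\<lambda>i. if i = 0 then Dom C (U_arr f) else if i = 1 then Dom C (U_arr g) else Cod C (U_arr f))"
    "(\<lambda>e. U_arr (?M e)) = (\<lambda>i. if i = 0 then U_arr f else U_arr g)"
    using fC gC by (auto simp: fun_eq_iff)
  have "Cod C (U_arr f) = Cod C (U_arr g)" using fC gC P(3) by simp
  from pullback_iff_limit[OF fC(1) gC(1) this, of "fst P" "\<lambda>v. U_arr (?r v)"] L show ?thesis
    unfolding eqs by simp
qed

section \<open>Monomorphisms and inclusions of algebras\<close>

lemma alg_arr_base:
  assumes "h \<in> Arr AC"
  shows "U_arr h \<in> Arr C" "Dom C (U_arr h) = fst (Dom AC h)" "Cod C (U_arr h) = fst (Cod AC h)"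
    "is_algebra C Th (Dom AC h)" "is_algebra C Th (Cod AC h)" "is_algebra_hom C Th (Dom AC h) (U_arr h) (Cod AC h)"
  using assms homD(1-3)[of "fst h" "U_arr h" "snd (snd h)"] by auto

text \<open>Downwards, monicity is a pullback condition, and pullbacks of algebras have underlying
  pullbacks. Upwards, an arrow of algebras is determined by its ends and its underlying
  arrow.\<close>

lemma alg_mono_iff: "is_mono AC m \<longleftrightarrow> m \<in> Arr AC \<and> is_mono C (U_arr m)"
proof
  assume m: "is_mono AC m"
  then have mA: "m \<in> Arr AC" unfolding is_mono_def by blast
  have "is_pullback AC m m (Dom AC m) (Id AC (Dom AC m)) (Id AC (Dom AC m))"
    using m Alg.mono_iff_pullback[OF mA] by blast
  from alg_pullback_base[OF this]
  have "is_pullback C (U_arr m) (U_arr m) (Dom C (U_arr m)) (Id C (Dom C (U_arr m))) (Id C (Dom C (U_arr m)))"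
    using alg_arr_base(2)[OF mA] by simp
  then show "m \<in> Arr AC \<and> is_mono C (U_arr m)"
    using mono_iff_pullback[OF alg_arr_base(1)[OF mA]] mA by blast
next
  assume *: "m \<in> Arr AC \<and> is_mono C (U_arr m)"
  show "is_mono AC m"
    unfolding is_mono_def
  proof (intro conjI allI ballI impI)
    show "m \<in> Arr AC" using * by blast
    fix Z u v assume u: "u \<in> Hom AC Z (Dom AC m)" and v: "v \<in> Hom AC Z (Dom AC m)"
      and eq: "m \<cdot>\<^bsub>AC\<^esub> u = m \<cdot>\<^bsub>AC\<^esub> v"
    have uA: "u \<in> Arr AC" "Dom AC u = Z" "Cod AC u = Dom AC m" and vA: "v \<in> Arr AC" "Dom AC v = Z" "Cod AC v = Dom AC m"
      using u v unfolding Hom_def by blast+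
    have "U_arr m \<cdot> U_arr u = U_arr m \<cdot> U_arr v" using eq by (metis Alg_simps(6) U_arr_simp)
    then have "U_arr u = U_arr v"
      by (rule mono_cancel[OF conjunct2[OF *]])
        (use alg_arr_base(1-3)[OF uA(1)] alg_arr_base(1-3)[OF vA(1)] alg_arr_base(1-3)[OF conjunct1[OF *]] uA(2,3) vA(2,3) in simp_all)
    then show "u = v" unfolding alg_arr_eq using uA(2,3) vA(2,3) by simp
  qed
qed


text \<open>A factorization of a homomorphism through a monic homomorphism respects the operations
  automatically, by \<open>initial_hom\<close> for a family with one member.\<close>

lemma alg_sub_le_iff:
  assumes m: "m \<in> Arr AC" and n: "is_mono AC n" and cod: "Cod AC m = Cod AC n"
  shows "sub_le AC m n \<longleftrightarrow> sub_le C (U_arr m) (U_arr n)"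
proof
  have nA: "n \<in> Arr AC" and nm: "is_mono C (U_arr n)" using n alg_mono_iff by blast+
  note mC = alg_arr_base[OF m] and nC = alg_arr_base[OF nA]
  { assume "sub_le AC m n"
    then obtain k where k: "k \<in> Hom AC (Dom AC m) (Dom AC n)" "n \<cdot>\<^bsub>AC\<^esub> k = m"
      unfolding sub_le_def by blast
    have kA: "k \<in> Arr AC" "Dom AC k = Dom AC m" "Cod AC k = Dom AC n" using k(1) unfolding Hom_def by blast+
    have "U_arr n \<cdot> U_arr k = U_arr m" using k(2) by (metis Alg_simps(6) U_arr_simp)
    moreover have "U_arr k \<in> Hom C (Dom C (U_arr m)) (Dom C (U_arr n))"
      using alg_arr_base(1-3)[OF kA(1)] kA(2,3) mC(2) nC(2) by simp
    ultimately show "sub_le C (U_arr m) (U_arr n)" unfolding sub_le_def by blast }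
  { assume "sub_le C (U_arr m) (U_arr n)"
    then obtain k where k: "k \<in> Hom C (Dom C (U_arr m)) (Dom C (U_arr n))" "U_arr n \<cdot> k = U_arr m"
      unfolding sub_le_def by blast
    have k': "k \<in> Hom C (fst (Dom AC m)) (fst (Dom AC n))" using k(1) mC(2) nC(2) by simp
    have "is_algebra_hom C Th (Dom AC m) k (Dom AC n)"
    proof (rule initial_hom[where V = "{()}" and D = "\<lambda>_. Cod AC n" and p = "\<lambda>_. U_arr n", OF nC(4) mC(4) k'])
      show "is_algebra_hom C Th (Dom AC m) (U_arr n \<cdot> k) (Cod AC n)" using k(2) mC(6) cod by metis
      fix a b assume "a \<in> Arr C" "b \<in> Arr C" "Dom C a = Dom C b" "Cod C a = fst (Dom AC n)"
        "Cod C b = fst (Dom AC n)" "\<And>v. v \<in> {()} \<Longrightarrow> U_arr n \<cdot> a = U_arr n \<cdot> b"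
      then show "a = b" using mono_cancel[OF nm, of a b] nC(2) by simp
    qed (rule nC)+
    then have "(Dom AC m, k, Dom AC n) \<in> Hom AC (Dom AC m) (Dom AC n)"
      using mC(4) nC(4) by (simp add: Hom_def)
    moreover have "n \<cdot>\<^bsub>AC\<^esub> (Dom AC m, k, Dom AC n) = m"
      using k(2) cod unfolding alg_arr_eq by simp
    ultimately show "sub_le AC m n" unfolding sub_le_def by blast }
qed

section \<open>Suprema of chains of subalgebras\<close>

lemma alg_chain_base:
  assumes "is_chain AC X A"
  shows "is_chain C (fst X) (\<lambda>i. U_arr (A i))"
  unfolding is_chain_def
proof (intro allI conjI)
  fix i
  note Ai = Alg.chainD[OF assms, of i] and Aj = Alg.chainD[OF assms, of "Suc i"]
  show "U_arr (A i) \<in> Subobjects C (fst X)"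
    using Ai alg_mono_iff alg_arr_base(3)[OF Ai(2)] by simp
  have "sub_le AC (A i) (A (Suc i))" using assms unfolding is_chain_def by blast
  then show "sub_le C (U_arr (A i)) (U_arr (A (Suc i)))"
    using alg_sub_le_iff[OF Ai(2) Aj(1)] Ai(3) Aj(3) by simp
qed

text \<open>An upper bound among subalgebras is an upper bound among subobjects, and the two orders
  agree, so leastness is reflected.\<close>

lemma alg_reflects_chain_sup:
  assumes A: "is_chain AC X A" and s: "s \<in> Subobjects AC X"
    and sup: "is_chain_sup C (fst X) (\<lambda>i. U_arr (A i)) (U_arr s)"
  shows "is_chain_sup AC X A s"
proof -
  have s': "is_mono AC s" "Cod AC s = X" using s unfolding Subobjects_def by blast+
  have sA: "s \<in> Arr AC" using s'(1) unfolding is_mono_def by blast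
  note Ad = Alg.chainD[OF A]
  have "sub_le AC (A i) s" for i
    using alg_sub_le_iff[OF Ad(2)[of i] s'(1)] chain_supD(4)[OF sup, of i] Ad(3) s'(2) by simp
  moreover have "sub_le AC s u" if u: "u \<in> Subobjects AC X" "\<And>i. sub_le AC (A i) u" for u
  proof -
    have u': "is_mono AC u" "Cod AC u = X" using u(1) unfolding Subobjects_def by blast+
    have uA: "u \<in> Arr AC" using u'(1) unfolding is_mono_def by blast
    have "sub_le C (U_arr (A i)) (U_arr u)" for i
      using alg_sub_le_iff[OF Ad(2)[of i] u'(1)] u(2) Ad(3) u'(2) by simp
    then have "sub_le C (U_arr s) (U_arr u)"
      using chain_sup_least[OF sup] u'(1) alg_mono_iff alg_arr_base(3)[OF uA] u'(2) by simp
    then show ?thesis using alg_sub_le_iff[OF sA u'(1)] s'(2) u'(2) by simp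
  qed
  ultimately show ?thesis
    unfolding is_chain_sup_def is_supremum_def using s by blast
qed

text \<open>The diagonal X -> X^n is a section of every projection, which is how a hypothesis on
  split epimorphisms reaches powers.\<close>

lemma split_epi_proj:
  assumes "X \<in> Obj C" "i < n"
  shows "is_split_epi C (pow_proj C X n i)"
proof (rule split_epiI)
  have t: "tupling C X X n (\<lambda>_. Id C X) \<in> Hom C X (pow_obj C X n) \<and>
      (\<forall>i<n. pow_proj C X n i \<cdot> tupling C X X n (\<lambda>_. Id C X) = Id C X)"
    by (rule tupling_spec) (use assms(1) in simp_all)
  then show "tupling C X X n (\<lambda>_. Id C X) \<in> Hom C (Cod C (pow_proj C X n i)) (Dom C (pow_proj C X n i))"
    "pow_proj C X n i \<cdot> tupling C X X n (\<lambda>_. Id C X) = Id C (Cod C (pow_proj C X n i))"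
    using assms by simp_all
qed (use assms in simp)

text \<open>Tuple the lifts of the coordinates. This turns coordinatewise membership, the form
  delivered by \<open>chain_sup_finite\<close>, into an element to which an operation of the
  subalgebra can be applied.\<close>

lemma pow_map_factor:
  assumes m: "m \<in> Arr C" and x: "x \<in> Arr C" "Cod C x = pow_obj C (Cod C m) n"
    and le: "\<And>i. i < n \<Longrightarrow> pow_proj C (Cod C m) n i \<cdot> x \<sqsubseteq> m"
  obtains y where "y \<in> Hom C (Dom C x) (pow_obj C (Dom C m) n)" "pow_map C n m \<cdot> y = x"
proof -
  have X: "Cod C m \<in> Obj C" "Dom C m \<in> Obj C" using m by simp_all
  have "\<exists>k. k \<in> Hom C (Dom C x) (Dom C m) \<and> m \<cdot> k = pow_proj C (Cod C m) n i \<cdot> x" if "i < n" for i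
    using le[OF that] X(1) x that unfolding sub_le_def by auto
  then obtain k where k: "\<And>i. i < n \<Longrightarrow> k i \<in> Hom C (Dom C x) (Dom C m)"
    "\<And>i. i < n \<Longrightarrow> m \<cdot> k i = pow_proj C (Cod C m) n i \<cdot> x" by metis
  let ?y = "tupling C (Dom C x) (Dom C m) n k"
  have y: "?y \<in> Hom C (Dom C x) (pow_obj C (Dom C m) n)" "\<And>i. i < n \<Longrightarrow> pow_proj C (Dom C m) n i \<cdot> ?y = k i"
    using tupling_spec[where u = k, OF arr_obj(1)[OF x(1)] X(2) k(1)] by blast+
  have "pow_map C n m \<cdot> ?y = x"
  proof (rule pow_ext[of _ _ "Cod C m" n])
    fix i assume i: "i < n"
    show "pow_proj C (Cod C m) n i \<cdot> pow_map C n m \<cdot> ?y = pow_proj C (Cod C m) n i \<cdot> x"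
      using proj_pow_map_comp[of m i n "Cod C m" ?y] y(1) y(2)[OF i] k(2)[OF i] m i by simp
  qed (use y(1) m x X in simp_all)
  with y(1) show ?thesis by (rule that)
qed

text \<open>What must be shown is that an operation maps tuples from \<open>s\<close> into
  \<open>s\<close>. By \<open>chain_sup_finite\<close> it suffices to treat tuples whose coordinates
  lie in one stage, and a stage is a subalgebra. That the resulting subalgebra is the supremum
  follows from reflection.\<close>

lemma alg_chain_sup_lift:
  assumes st: "chain_sups_stable_split_epi C" "chain_sups_stable_meet C"
    and A: "is_chain AC X A" and sup: "is_chain_sup C (fst X) (\<lambda>i. U_arr (A i)) s"
  shows "\<exists>\<alpha>. (((Dom C s, \<alpha>), s, X) \<in> Subobjects AC X \<and> is_chain_sup AC X A ((Dom C s, \<alpha>), s, X))"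
proof -
  note s = chain_supD[OF sup]
  note Ad = Alg.chainD[OF A]
  have X: "is_algebra C Th X" using Ad(3)[of 0] alg_arr_base(5)[OF Ad(2)[of 0]] by simp
  note X' = algD[OF X]
  have Dom_s: "Dom C s \<in> Obj C" using s(2) by simp
  have ops: "\<exists>w \<in> Hom C (pow_obj C (Dom C s) (arity Th f)) (Dom C s).
      \<forall>v \<in> {()}. s \<cdot> w = snd X f \<cdot> pow_map C (arity Th f) s" if f: "f \<in> Ops Th" for f
  proof -
    let ?n = "arity Th f"
    let ?P = "pow_obj C (fst X) ?n"
    have xf: "snd X f \<in> Arr C" "Dom C (snd X f) = ?P" "Cod C (snd X f) = fst X" using X' f by simp_all
    \<comment> \<open>The tuples on which the operation takes values in \<open>s\<close>. An
      operation need not be a split epimorphism, so only the supremum is pulled back along it, not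
      the chain.\<close>
    define v where "v = inverse_image C (snd X f) s"
    have v: "u \<sqsubseteq> v \<longleftrightarrow> u \<in> Arr C \<and> Cod C u = ?P \<and> snd X f \<cdot> u \<sqsubseteq> s" for u
      unfolding v_def using inverse_image_le[of "snd X f" s] xf s by simp
    have vm: "v \<in> Subobjects C ?P" unfolding v_def using inverse_image_mono[of "snd X f" s] xf s by simp
    have sn: "pow_map C ?n s \<in> Arr C" "Cod C (pow_map C ?n s) = ?P" "Dom C (pow_map C ?n s) = pow_obj C (Dom C s) ?n"
      using s by simp_all
    \<comment> \<open>For a constant there are no projections and the claim is the base case: every
      stage contains the constant.\<close>
    have "pow_map C ?n s \<sqsubseteq> v"
    proof (rule chain_sup_finite[OF st alg_chain_base[OF A] sup _ _ vm, where g = "pow_proj C (fst X) ?n" and n = ?n])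
      show "?P \<in> Obj C" using X'(1) by simp
      show "is_split_epi C (pow_proj C (fst X) ?n i) \<and> Dom C (pow_proj C (fst X) ?n i) = ?P \<and>
          Cod C (pow_proj C (fst X) ?n i) = fst X" if "i < ?n" for i
        using split_epi_proj[OF X'(1) that] X'(1) that by simp
      show "pow_map C ?n s \<in> Arr C" "Cod C (pow_map C ?n s) = ?P" by fact+
      show "\<forall>i<?n. pow_proj C (fst X) ?n i \<cdot> pow_map C ?n s \<sqsubseteq> s"
        using s Dom_s by (simp add: sub_leI)
      fix j x assume x: "x \<in> Arr C" "Cod C x = ?P" and le: "\<forall>i<?n. pow_proj C (fst X) ?n i \<cdot> x \<sqsubseteq> U_arr (A j)"
      note Aj = alg_arr_base[OF Ad(2)[of j]]
      have cAj: "Cod C (U_arr (A j)) = fst X" using Aj(3) Ad(3) by metis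
      obtain y where y: "y \<in> Hom C (Dom C x) (pow_obj C (Dom C (U_arr (A j))) ?n)" "pow_map C ?n (U_arr (A j)) \<cdot> y = x"
        using pow_map_factor[OF Aj(1) x(1), of ?n] x(2) le cAj by metis
      have a: "snd (Dom AC (A j)) f \<in> Hom C (pow_obj C (Dom C (U_arr (A j))) ?n) (Dom C (U_arr (A j)))"
        using algD[OF Aj(4)] f Aj(2) by simp
      have hom: "U_arr (A j) \<cdot> snd (Dom AC (A j)) f = snd X f \<cdot> pow_map C ?n (U_arr (A j))"
        using homD(4)[OF Aj(6) f] Ad(3) by metis
      have "U_arr (A j) \<cdot> snd (Dom AC (A j)) f \<cdot> y = snd X f \<cdot> pow_map C ?n (U_arr (A j)) \<cdot> y"
        by (rule square_comp[OF hom]) (use y(1) a Aj(1) cAj xf in simp_all)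
      then have "snd X f \<cdot> x = U_arr (A j) \<cdot> snd (Dom AC (A j)) f \<cdot> y" using y(2) by simp
      then have "snd X f \<cdot> x \<sqsubseteq> U_arr (A j)"
        using sub_leI[of "snd (Dom AC (A j)) f \<cdot> y" "U_arr (A j)"] y(1) a Aj(1) by simp
      then have "snd X f \<cdot> x \<sqsubseteq> s" by (rule sub_le_trans[OF _ s(4) s(2)])
      then show "x \<sqsubseteq> v" unfolding v using x by blast
    qed
    then have "snd X f \<cdot> pow_map C ?n s \<sqsubseteq> s" unfolding v by blast
    then obtain w where "w \<in> Arr C" "Dom C w = Dom C (snd X f \<cdot> pow_map C ?n s)" "Cod C w = Dom C s"
      "s \<cdot> w = snd X f \<cdot> pow_map C ?n s" using sub_leE[OF _ s(2)] by metis
    moreover have "Dom C (snd X f \<cdot> pow_map C ?n s) = pow_obj C (Dom C s) ?n" using sn xf by simp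
    ultimately show ?thesis by auto
  qed
  have "\<exists>\<alpha>. is_algebra C Th (Dom C s, \<alpha>) \<and> (\<forall>v\<in>{()}. is_algebra_hom C Th (Dom C s, \<alpha>) s X)"
  proof (rule initial_algebra[OF Dom_s _ _ _ ops])
    show "s \<in> Hom C (Dom C s) (fst X)" using s by simp
    fix a b assume "a \<in> Arr C" "b \<in> Arr C" "Dom C a = Dom C b" "Cod C a = Dom C s"
      "Cod C b = Dom C s" "\<And>v. v \<in> {()} \<Longrightarrow> s \<cdot> a = s \<cdot> b"
    then show "a = b" using mono_cancel[OF s(1), of a b] by simp
  qed (use X in simp)
  then obtain \<alpha> where \<alpha>: "is_algebra C Th (Dom C s, \<alpha>)" "is_algebra_hom C Th (Dom C s, \<alpha>) s X" by blast
  let ?t = "((Dom C s, \<alpha>), s, X)"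
  have "?t \<in> Subobjects AC X"
    unfolding Subobjects_def using alg_mono_iff[of ?t] \<alpha> X s(1) by simp
  moreover have "is_chain_sup AC X A ?t"
    by (rule alg_reflects_chain_sup[OF A calculation]) (use sup in simp)
  ultimately show ?thesis by blast
qed

lemma alg_has_chain_sups:
  assumes "has_chain_sups C" "chain_sups_stable_split_epi C" "chain_sups_stable_meet C"
  shows "has_chain_sups AC"
  unfolding has_chain_sups_def
proof (intro ballI allI impI)
  fix X A assume X: "X \<in> Obj AC" and A: "is_chain AC X A"
  have "fst X \<in> Obj C" using X algD(1) by simp
  then obtain s where "is_chain_sup C (fst X) (\<lambda>i. U_arr (A i)) s"
    using assms(1) alg_chain_base[OF A] unfolding has_chain_sups_def by blast
  from alg_chain_sup_lift[OF assms(2,3) A this] show "\<exists>s. is_chain_sup AC X A s" by blast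
qed

text \<open>The given supremum of subalgebras is compared with the one lifted from a supremum of the
  underlying chain; as suprema of the same chain of algebras they include each other.\<close>

lemma alg_preserves_chain_sup:
  assumes "has_chain_sups C" "chain_sups_stable_split_epi C" "chain_sups_stable_meet C"
    and A: "is_chain AC X A" and sup: "is_chain_sup AC X A s"
  shows "is_chain_sup C (fst X) (\<lambda>i. U_arr (A i)) (U_arr s)"
proof -
  note Ad = Alg.chainD[OF A] and s = Alg.chain_supD[OF sup]
  note AC' = alg_chain_base[OF A]
  have "fst X \<in> Obj C" using chainD(2,3)[OF AC', of 0] arr_obj(2) by metis
  then obtain r where r: "is_chain_sup C (fst X) (\<lambda>i. U_arr (A i)) r"
    using assms(1) AC' unfolding has_chain_sups_def by blast
  from alg_chain_sup_lift[OF assms(2,3) A this] obtain t where t: "U_arr t = r" "is_chain_sup AC X A t"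
    by (metis U_arr_simp)
  note t' = Alg.chain_supD[OF t(2)]
  have "sub_le AC t s" "sub_le AC s t"
    using Alg.chain_sup_least[OF t(2) s(1,3)] Alg.chain_sup_least[OF sup t'(1,3)] s(4) t'(4) by blast+
  then have le: "sub_le C r (U_arr s)" "sub_le C (U_arr s) r"
    using alg_sub_le_iff[OF t'(2) s(1)] alg_sub_le_iff[OF s(2) t'(1)] s(3) t'(3) t(1) by simp_all
  note UsA = sub_leD(1)[OF le(2) chain_supD(2)[OF r]]
  have "sub_le C x (U_arr s) \<longleftrightarrow> sub_le C x r" for x
    using sub_le_trans[OF _ le(1) UsA] sub_le_trans[OF _ le(2) chain_supD(2)[OF r]] by blast
  then show ?thesis
    by (intro chain_sup_cong[OF r AC']) (use chainD[OF AC'] s(1) alg_mono_iff in simp_all)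
qed

text \<open>Reduces a stability statement about algebras to the base, where the chosen inverse
  images and intersections have the same elements as the underlying arrows of those chosen for
  algebras.\<close>

lemma alg_chain_sup_transfer:
  assumes "is_chain AC X B" "t \<in> Subobjects AC X" "is_chain_sup C (fst X) A s" "is_chain C (fst X) A"
    "\<And>i x. sub_le C x (U_arr (B i)) \<longleftrightarrow> sub_le C x (A i)" "\<And>x. sub_le C x (U_arr t) \<longleftrightarrow> sub_le C x s"
  shows "is_chain_sup AC X B t"
proof (rule alg_reflects_chain_sup[OF assms(1,2)])
  have "is_mono AC t" using assms(2) unfolding Subobjects_def by blast
  then show "is_chain_sup C (fst X) (\<lambda>i. U_arr (B i)) (U_arr t)"
    by (intro chain_sup_cong[OF assms(3,4,5,6)] chainD(2)[OF alg_chain_base[OF assms(1)]])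
      (simp add: alg_mono_iff)
qed

lemma alg_inverse_image_le:
  assumes g: "g \<in> Arr AC" and m: "is_mono AC m" and eq: "Cod AC g = Cod AC m"
  shows "sub_le C x (U_arr (inverse_image AC g m)) \<longleftrightarrow> sub_le C x (inverse_image C (U_arr g) (U_arr m))"
proof -
  have mA: "m \<in> Arr AC" using m unfolding is_mono_def by blast
  have "is_pullback AC g m (Dom AC (pb1 AC g m)) (pb1 AC g m) (pb2 AC g m)"
    by (rule Alg.pb_pullback[OF g mA eq])
  from pullback_sub_le[OF alg_pullback_base[OF this], of x] show ?thesis
    unfolding inverse_image_def[of AC]
    using inverse_image_le[of "U_arr g" "U_arr m" x] alg_arr_base(1-3)[OF g] alg_arr_base(1-3)[OF mA] eq by simp
qed

lemma alg_sub_meet_le: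
  assumes m: "is_mono AC m" and n: "is_mono AC n" and eq: "Cod AC m = Cod AC n"
  shows "sub_le C x (U_arr (sub_meet AC m n)) \<longleftrightarrow> sub_le C x (sub_meet C (U_arr m) (U_arr n))"
proof -
  have mn: "m \<in> Arr AC" "n \<in> Arr AC" using m n unfolding is_mono_def by blast+
  have "is_pullback AC m n (Dom AC (pb1 AC m n)) (pb1 AC m n) (pb2 AC m n)"
    by (rule Alg.pb_pullback[OF mn eq])
  from pullback_meet_le[OF alg_pullback_base[OF this], of x] show ?thesis
    unfolding sub_meet_def[of AC]
    using sub_meet_le[of "U_arr m" "U_arr n" x] alg_arr_base(1-3)[OF mn(1)] alg_arr_base(1-3)[OF mn(2)] eq by simp
qed

text \<open>Stability along split epimorphisms is established beside stability under intersection
  because the join formula is later applied inside the category of algebras. A section in that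
  category has an underlying section, so the hypothesis on the base applies.\<close>

lemma alg_stable:
  assumes st: "has_chain_sups C" "chain_sups_stable_split_epi C" "chain_sups_stable_meet C"
  shows "chain_sups_stable_split_epi AC" "chain_sups_stable_meet AC"
proof -
  show "chain_sups_stable_split_epi AC"
    unfolding chain_sups_stable_split_epi_def
  proof (intro ballI allI impI)
    fix X A s g assume X: "X \<in> Obj AC"
      and *: "is_chain AC X A \<and> is_chain_sup AC X A s \<and> is_split_epi AC g \<and> Cod AC g = X"
    then have A: "is_chain AC X A" and sup: "is_chain_sup AC X A s" and g: "is_split_epi AC g" "Cod AC g = X" by blast+
    note Ad = Alg.chainD[OF A] and s = Alg.chain_supD[OF sup]
    have gA: "g \<in> Arr AC" using g(1) unfolding is_split_epi_def by blast
    note gC = alg_arr_base[OF gA]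
    obtain r where r: "r \<in> Hom AC (Cod AC g) (Dom AC g)" "g \<cdot>\<^bsub>AC\<^esub> r = Id AC (Cod AC g)"
      using g(1) unfolding is_split_epi_def by blast
    have rA: "r \<in> Arr AC" "Dom AC r = Cod AC g" "Cod AC r = Dom AC g" using r(1) unfolding Hom_def by blast+
    have "U_arr g \<cdot> U_arr r = Id C (fst (Cod AC g))" using r(2) by (metis Alg_simps(5,6) U_arr_simp)
    then have spl: "is_split_epi C (U_arr g)"
      using split_epiI[of "U_arr g" "U_arr r"] alg_arr_base(1-3)[OF rA(1)] rA(2,3) gC(1-3) by simp
    have gX: "Cod C (U_arr g) = fst X" using gC(3) g(2) by simp
    have X': "fst X \<in> Obj C" using X algD(1) by simp
    have "is_chain_sup C (Dom C (U_arr g)) (\<lambda>i. inverse_image C (U_arr g) (U_arr (A i))) (inverse_image C (U_arr g) (U_arr s))"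
      using st(2) X' alg_chain_base[OF A] alg_preserves_chain_sup[OF st A sup] spl gX
      unfolding chain_sups_stable_split_epi_def by simp
    then show "is_chain_sup AC (Dom AC g) (\<lambda>i. inverse_image AC g (A i)) (inverse_image AC g s)"
    proof (intro alg_chain_sup_transfer[where s = "inverse_image C (U_arr g) (U_arr s)"
          and A = "\<lambda>i. inverse_image C (U_arr g) (U_arr (A i))"])
      show "is_chain AC (Dom AC g) (\<lambda>i. inverse_image AC g (A i))" by (rule Alg.inverse_image_chain[OF A gA g(2)])
      show "inverse_image AC g s \<in> Subobjects AC (Dom AC g)"
        using Alg.inverse_image_mono[OF gA s(1)] g(2) s(3) unfolding Subobjects_def by simp
      show "is_chain C (fst (Dom AC g)) (\<lambda>i. inverse_image C (U_arr g) (U_arr (A i)))"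
        using inverse_image_chain[OF alg_chain_base[OF A] gC(1) gX] gC(2) by simp
    qed (use alg_inverse_image_le[OF gA] Ad(1,3) s(1,3) g(2) gC(2) in simp_all)
  qed
  show "chain_sups_stable_meet AC"
    unfolding chain_sups_stable_meet_def
  proof (intro ballI allI impI)
    fix X A s V assume X: "X \<in> Obj AC" and V: "V \<in> Subobjects AC X"
      and *: "is_chain AC X A \<and> is_chain_sup AC X A s"
    then have A: "is_chain AC X A" and sup: "is_chain_sup AC X A s" by blast+
    note Ad = Alg.chainD[OF A] and s = Alg.chain_supD[OF sup]
    have V': "is_mono AC V" "Cod AC V = X" using V unfolding Subobjects_def by blast+
    have UV: "is_mono C (U_arr V)" "Cod C (U_arr V) = fst X"
      using V' alg_mono_iff alg_arr_base(3)[of V] by simp_all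
    have X': "fst X \<in> Obj C" using X algD(1) by simp
    have "is_chain_sup C (fst X) (\<lambda>i. sub_meet C (U_arr (A i)) (U_arr V)) (sub_meet C (U_arr s) (U_arr V))"
      using st(3) X' alg_chain_base[OF A] alg_preserves_chain_sup[OF st A sup] UV
      unfolding chain_sups_stable_meet_def by simp
    then show "is_chain_sup AC X (\<lambda>i. sub_meet AC (A i) V) (sub_meet AC s V)"
    proof (intro alg_chain_sup_transfer[where s = "sub_meet C (U_arr s) (U_arr V)"
          and A = "\<lambda>i. sub_meet C (U_arr (A i)) (U_arr V)"])
      show "is_chain AC X (\<lambda>i. sub_meet AC (A i) V)" by (rule Alg.sub_meet_chain[OF A V'])
      show "sub_meet AC s V \<in> Subobjects AC X"
        using Alg.sub_meet_mono[OF s(1) V'(1)] V'(2) s(3) unfolding Subobjects_def by simp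
      show "is_chain C (fst X) (\<lambda>i. sub_meet C (U_arr (A i)) (U_arr V))"
        by (rule sub_meet_chain[OF alg_chain_base[OF A] UV])
    qed (use alg_sub_meet_le[OF _ V'(1)] Ad(1,3) s(1,3) V'(2) in simp_all)
  qed
qed

end

context category begin

lemma coequalizerI:
  assumes "f \<in> Arr C" "g \<in> Hom C (Dom C f) (Cod C f)" "e \<in> Arr C" "Dom C e = Cod C f" "e \<cdot> f = e \<cdot> g"
    "\<And>h. h \<in> Arr C \<Longrightarrow> Dom C h = Dom C e \<Longrightarrow> h \<cdot> f = h \<cdot> g \<Longrightarrow>
      \<exists>k \<in> Hom C (Cod C e) (Cod C h). k \<cdot> e = h"
    "\<And>u v. u \<in> Arr C \<Longrightarrow> v \<in> Arr C \<Longrightarrow> Dom C u = Cod C e \<Longrightarrow> Dom C v = Cod C e \<Longrightarrow>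
      u \<cdot> e = v \<cdot> e \<Longrightarrow> u = v"
  shows "is_coequalizer C f g e"
  unfolding is_coequalizer_def
proof (intro conjI allI ballI impI)
  fix Z h assume h: "h \<in> Hom C (Cod C f) Z" "h \<cdot> f = h \<cdot> g"
  then have h': "h \<in> Arr C" "Dom C h = Dom C e" "Cod C h = Z" using assms(4) by simp_all
  obtain k where k: "k \<in> Hom C (Cod C e) Z" "k \<cdot> e = h"
    using assms(6)[OF h'(1,2) h(2)] unfolding h'(3) by blast
  show "\<exists>!k. k \<in> Hom C (Cod C e) Z \<and> k \<cdot> e = h"
  proof (rule ex1I)
    show "k \<in> Hom C (Cod C e) Z \<and> k \<cdot> e = h" using k by blast
    fix l assume "l \<in> Hom C (Cod C e) Z \<and> l \<cdot> e = h"
    then show "l = k" using assms(7)[of l k] k by simp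
  qed
qed fact+

text \<open>Serves in \<open>alg_regular_epi_base\<close>, where an arrow is recognized as a regular
  epimorphism only up to an isomorphism of its codomain.\<close>

lemma regular_epi_iso_comp:
  assumes "is_regular_epi C e" "m \<in> Arr C" "Dom C m = Cod C e" "k \<in> Hom C (Cod C m) (Dom C m)"
    "m \<cdot> k = Id C (Cod C m)" "k \<cdot> m = Id C (Dom C m)"
  shows "is_regular_epi C (m \<cdot> e)"
proof -
  obtain f g where fg: "is_coequalizer C f g e" using assms(1) unfolding is_regular_epi_def by blast
  note c = coequalizerD[OF fg]
  have k: "k \<in> Arr C" "Dom C k = Cod C m" "Cod C k = Dom C m" using assms(4) by simp_all
  have "is_coequalizer C f g (m \<cdot> e)"
  proof (rule coequalizerI)
    show "f \<in> Arr C" "g \<in> Hom C (Dom C f) (Cod C f)" "m \<cdot> e \<in> Arr C" "Dom C (m \<cdot> e) = Cod C f"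
      using c assms(2,3) by simp_all
    show "(m \<cdot> e) \<cdot> f = (m \<cdot> e) \<cdot> g" using c assms(2,3) by simp
    fix h assume h: "h \<in> Arr C" "Dom C h = Dom C (m \<cdot> e)" "h \<cdot> f = h \<cdot> g"
    have "Dom C h = Dom C e" using h(2) c(3) assms(2,3) by simp
    from coequalizer_lift[OF fg h(1) this h(3)] obtain t where
      t: "t \<in> Arr C" "Dom C t = Cod C e" "Cod C t = Cod C h" "t \<cdot> e = h" by metis
    have "(t \<cdot> k) \<cdot> m \<cdot> e = t \<cdot> k \<cdot> m \<cdot> e"
      by (rule comp_assoc) (use t k c(3) assms(2,3) in simp_all)
    also have "k \<cdot> m \<cdot> e = e"
      using comp_assoc_subst[OF assms(6), of e] k c(3) assms(2,3) by simp
    finally have "(t \<cdot> k) \<cdot> m \<cdot> e = h" using t by simp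
    moreover have "t \<cdot> k \<in> Hom C (Cod C (m \<cdot> e)) (Cod C h)" using t k c(3) assms(2,3) by simp
    ultimately show "\<exists>k\<in>Hom C (Cod C (m \<cdot> e)) (Cod C h). k \<cdot> m \<cdot> e = h" by blast
  next
    fix u v assume uv: "u \<in> Arr C" "v \<in> Arr C" "Dom C u = Cod C (m \<cdot> e)" "Dom C v = Cod C (m \<cdot> e)"
      "u \<cdot> m \<cdot> e = v \<cdot> m \<cdot> e"
    have d: "Dom C u = Cod C m" "Dom C v = Cod C m" using uv(3,4) c(3) assms(2,3) by simp_all
    have "(u \<cdot> m) \<cdot> e = (v \<cdot> m) \<cdot> e" using uv(1,2,5) d c(3) assms(2,3) by simp
    then have um: "u \<cdot> m = v \<cdot> m"
      by (rule regular_epi_cancel[OF assms(1), rotated -1]) (use uv(1,2) d c(3) assms(2,3) in simp_all)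
    have "u \<cdot> m \<cdot> k = v \<cdot> m \<cdot> k"
      by (rule square_comp[OF um]) (use uv(1,2) d k assms(2) in simp_all)
    then show "u = v" using uv(1,2) d assms(5) by simp
  qed
  then show ?thesis unfolding is_regular_epi_def by blast
qed

end

section \<open>Regularity of the category of algebras\<close>

context regular_complete begin

text \<open>Lift one element at a time and restrict the earlier lifts to the new cover. The cover is
  claimed to be strong only, because strong epimorphisms compose.\<close>

lemma cover_lift_finite:
  fixes n :: nat
  assumes "is_regular_epi C e" "Z \<in> Obj C" "\<And>i. i < n \<Longrightarrow> u i \<in> Hom C Z (Cod C e)"
  shows "\<exists>w a. strong w \<and> Cod C w = Z \<and> (\<forall>i<n. a i \<in> Hom C (Dom C w) (Dom C e) \<and> e \<cdot> a i = u i \<cdot> w)"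
  using assms(3)
proof (induction n)
  case 0
  show ?case using assms(2) by (intro exI[of _ "Id C Z"]) simp
next
  case (Suc n)
  have "\<And>i. i < n \<Longrightarrow> u i \<in> Hom C Z (Cod C e)" and un: "u n \<in> Hom C Z (Cod C e)"
    using Suc.prems less_SucI lessI by blast+
  with Suc.IH obtain w a where w: "strong w" "Cod C w = Z"
    and a: "\<And>i. i < n \<Longrightarrow> a i \<in> Hom C (Dom C w) (Dom C e)" "\<And>i. i < n \<Longrightarrow> e \<cdot> a i = u i \<cdot> w" by blast
  have eA: "e \<in> Arr C" using assms(1) regular_epi_arr by blast
  have wA: "w \<in> Arr C" using w by simp
  have "u n \<cdot> w \<in> Arr C" "Cod C (u n \<cdot> w) = Cod C e" "Dom C (u n \<cdot> w) = Dom C w" using un w wA by simp_all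
  with cover_lift[OF assms(1)] obtain w' b where w': "strong w'" "Cod C w' = Dom C w"
    and b: "b \<in> Arr C" "Dom C b = Dom C w'" "Cod C b = Dom C e" "(u n \<cdot> w) \<cdot> w' = e \<cdot> b" by metis
  have w'A: "w' \<in> Arr C" using w' by simp
  let ?a = "\<lambda>i. if i = n then b else a i \<cdot> w'"
  have "?a i \<in> Hom C (Dom C (w \<cdot> w')) (Dom C e) \<and> e \<cdot> ?a i = u i \<cdot> w \<cdot> w'" if i: "i < Suc n" for i
  proof (cases "i = n")
    case True
    then show ?thesis using b un w w' wA w'A by simp
  next
    case False
    then have i': "i < n" using i by simp
    have ui: "u i \<in> Hom C Z (Cod C e)" using Suc.prems[OF i] .
    have "e \<cdot> a i \<cdot> w' = u i \<cdot> w \<cdot> w'"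
      by (rule square_comp[OF a(2)[OF i']]) (use a(1)[OF i'] ui eA w w' wA w'A in simp_all)
    then show ?thesis using False a(1)[OF i'] w' wA w'A w(2) by simp
  qed
  moreover have "strong (w \<cdot> w')" using strong_comp[OF w(1) w'(1,2)] .
  moreover have "Cod C (w \<cdot> w') = Z" using wA w'A w w' by simp
  ultimately show ?case by (intro exI[of _ "w \<cdot> w'"] exI[of _ ?a]) blast
qed

text \<open>Lift the generic tuple, that is the family of projections. The power of \<open>e\<close>
  is thus surjective over a cover, which replaces a proof that it is itself a regular
  epimorphism.\<close>

lemma cover_lift_power:
  assumes "is_regular_epi C e"
  obtains w t where "strong w" "Cod C w = pow_obj C (Cod C e) n" "t \<in> Hom C (Dom C w) (pow_obj C (Dom C e) n)"
    "pow_map C n e \<cdot> t = w"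
proof -
  have eA: "e \<in> Arr C" using assms regular_epi_arr by blast
  let ?P = "pow_obj C (Cod C e) n" and ?\<pi> = "pow_proj C (Cod C e) n"
  have P: "?P \<in> Obj C" "\<And>i. i < n \<Longrightarrow> ?\<pi> i \<in> Hom C ?P (Cod C e)" using eA by simp_all
  from cover_lift_finite[where u = ?\<pi>, OF assms P] obtain w a where w: "strong w" "Cod C w = ?P"
    and a: "\<And>i. i < n \<Longrightarrow> a i \<in> Hom C (Dom C w) (Dom C e)" "\<And>i. i < n \<Longrightarrow> e \<cdot> a i = ?\<pi> i \<cdot> w" by blast
  have wA: "w \<in> Arr C" using w by simp
  have obj: "Dom C w \<in> Obj C" "Dom C e \<in> Obj C" "Cod C e \<in> Obj C" using wA eA by simp_all
  let ?t = "tupling C (Dom C w) (Dom C e) n a"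
  have t: "?t \<in> Hom C (Dom C w) (pow_obj C (Dom C e) n)" "\<And>i. i < n \<Longrightarrow> pow_proj C (Dom C e) n i \<cdot> ?t = a i"
    using tupling_spec[where u = a, OF obj(1,2) a(1)] by blast+
  have "pow_map C n e \<cdot> ?t = w"
  proof (rule pow_ext[of _ _ "Cod C e" n])
    fix i assume i: "i < n"
    show "?\<pi> i \<cdot> pow_map C n e \<cdot> ?t = ?\<pi> i \<cdot> w"
      using proj_pow_map_comp[of e i n "Cod C e" ?t] t(1) t(2)[OF i] a(2)[OF i] eA i by simp
  qed (use t(1) eA w wA obj in simp_all)
  with w t(1) show ?thesis by (rule that)
qed

end

section \<open>Images and regular epimorphisms of algebras\<close>

locale regular_algebras = regular_complete + algebras
begin

text \<open>A tuple in the image lifts over a cover to a tuple in \<open>A\<close>, where the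
  operation can be applied; its value lands in the image, and strength of the cover lets this
  membership descend.\<close>

lemma image_algebra:
  assumes A: "is_algebra C Th A" and B: "is_algebra C Th B" and h: "is_algebra_hom C Th A h B"
    and m: "is_mono C m" and e: "is_regular_epi C e" and me: "Cod C e = Dom C m" "m \<cdot> e = h"
  shows "\<exists>\<iota>. is_algebra C Th (Dom C m, \<iota>) \<and> is_algebra_hom C Th (Dom C m, \<iota>) m B \<and>
    is_algebra_hom C Th A e (Dom C m, \<iota>)"
proof -
  note A' = algD[OF A] and B' = algD[OF B] and h' = homD[OF h]
  have mA: "m \<in> Arr C" and eA: "e \<in> Arr C" using m e regular_epi_arr by simp_all
  have dc: "Dom C e = fst A" "Cod C m = fst B" using comp_arr(2,3)[OF eA mA me(1)] me(2) h'(2,3) by simp_all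
  have I: "Dom C m \<in> Obj C" using mA by simp
  have ops: "\<exists>w \<in> Hom C (pow_obj C (Dom C m) (arity Th f)) (Dom C m).
      \<forall>v \<in> {()}. m \<cdot> w = snd B f \<cdot> pow_map C (arity Th f) m" if f: "f \<in> Ops Th" for f
  proof -
    let ?n = "arity Th f"
    let ?u = "snd B f \<cdot> pow_map C ?n m"
    obtain w t where w: "strong w" "Cod C w = pow_obj C (Dom C m) ?n"
      and t: "t \<in> Hom C (Dom C w) (pow_obj C (fst A) ?n)" "pow_map C ?n e \<cdot> t = w"
      using cover_lift_power[OF e, of ?n] me(1) dc(1) by metis
    have bf: "snd B f \<in> Hom C (pow_obj C (fst B) ?n) (fst B)" and af: "snd A f \<in> Hom C (pow_obj C (fst A) ?n) (fst A)"
      using A' B' f by simp_all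
    have u: "?u \<in> Arr C" "Dom C ?u = pow_obj C (Dom C m) ?n" "Cod C ?u = fst B" using bf mA dc by simp_all
    have wA: "w \<in> Arr C" using w by simp
    have mn: "pow_map C ?n m \<cdot> pow_map C ?n e = pow_map C ?n h"
      using pow_map_comp[OF mA eA me(1)] me(2) by simp
    have "?u \<cdot> w = snd B f \<cdot> pow_map C ?n m \<cdot> w"
      by (rule comp_assoc) (use bf mA dc wA w(2) in simp_all)
    also have "pow_map C ?n m \<cdot> w = pow_map C ?n h \<cdot> t"
      using comp_assoc_subst[OF mn, of t] t eA mA dc me(1) by simp
    also have "snd B f \<cdot> pow_map C ?n h \<cdot> t = h \<cdot> snd A f \<cdot> t"
      by (rule square_comp[OF h'(4)[OF f, symmetric]]) (use bf af t(1) h'(1-3) in simp_all)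
    also have "\<dots> = m \<cdot> e \<cdot> snd A f \<cdot> t"
      by (rule comp_assoc_subst[OF me(2), symmetric]) (use af t(1) eA mA dc me(1) in simp_all)
    finally have "?u \<cdot> w \<sqsubseteq> m" using sub_leI[of "e \<cdot> snd A f \<cdot> t" m] af t(1) eA mA dc me(1) by simp
    then have "?u \<sqsubseteq> m" by (rule strongD[OF w(1) m u(1), rotated -1]) (use u(2) w(2) in simp)
    then obtain k where "k \<in> Arr C" "Dom C k = Dom C ?u" "Cod C k = Dom C m" "m \<cdot> k = ?u"
      using sub_leE[OF _ mA] by metis
    then show ?thesis using u(2) by auto
  qed
  have "\<exists>\<iota>. is_algebra C Th (Dom C m, \<iota>) \<and> (\<forall>v\<in>{()}. is_algebra_hom C Th (Dom C m, \<iota>) m B)"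
  proof (rule initial_algebra[OF I _ _ _ ops])
    show "m \<in> Hom C (Dom C m) (fst B)" using mA dc by simp
    fix a b assume "a \<in> Arr C" "b \<in> Arr C" "Dom C a = Dom C b" "Cod C a = Dom C m"
      "Cod C b = Dom C m" "\<And>v. v \<in> {()} \<Longrightarrow> m \<cdot> a = m \<cdot> b"
    then show "a = b" using mono_cancel[OF m, of a b] by simp
  qed (use B in simp)
  then obtain \<iota> where i: "is_algebra C Th (Dom C m, \<iota>)" "is_algebra_hom C Th (Dom C m, \<iota>) m B" by blast
  have "is_algebra_hom C Th A e (Dom C m, \<iota>)"
  proof (rule initial_hom[where V = "{()}" and D = "\<lambda>_. B" and p = "\<lambda>_. m", OF i(1) A])
    show "e \<in> Hom C (fst A) (fst (Dom C m, \<iota>))" using eA dc me(1) by simp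
    show "is_algebra_hom C Th A (m \<cdot> e) B" using me(2) h by simp
    fix a b assume "a \<in> Arr C" "b \<in> Arr C" "Dom C a = Dom C b" "Cod C a = fst (Dom C m, \<iota>)"
      "Cod C b = fst (Dom C m, \<iota>)" "\<And>v. v \<in> {()} \<Longrightarrow> m \<cdot> a = m \<cdot> b"
    then show "a = b" using mono_cancel[OF m, of a b] by simp
  qed (use B i in simp_all)
  with i show ?thesis by blast
qed

text \<open>Among algebras \<open>e\<close> is exhibited as the coequalizer of its kernel pair,
  since the pair witnessing regularity in the base need not consist of homomorphisms. The arrow
  induced in the base is a homomorphism because its compatibility with an operation may be tested
  over a cover on which tuples lift along \<open>e\<close>.\<close>

lemma alg_regular_epi_lift:
  assumes eA: "e \<in> Arr AC" and reg: "is_regular_epi C (U_arr e)"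
  shows "is_regular_epi AC e"
proof -
  obtain P p q where P: "is_pullback AC e e P p q" by (rule Alg.ex_pullback[OF eA eA refl])
  note Pd = Alg.pullbackD[OF P]
  note PC = alg_pullback_base[OF P]
  note e = alg_arr_base[OF eA]
  have "is_coequalizer AC p q e"
  proof (rule Alg.coequalizerI)
    show "p \<in> Arr AC" "q \<in> Hom AC (Dom AC p) (Cod AC p)" "e \<in> Arr AC" "Dom AC e = Cod AC p"
      "e \<cdot>\<^bsub>AC\<^esub> p = e \<cdot>\<^bsub>AC\<^esub> q"
      using Pd by (simp_all add: Hom_def del: Alg_simps)
  next
    fix u v assume uv: "u \<in> Arr AC" "v \<in> Arr AC" "Dom AC u = Cod AC e" "Dom AC v = Cod AC e"
      and eq: "u \<cdot>\<^bsub>AC\<^esub> e = v \<cdot>\<^bsub>AC\<^esub> e"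
    have "U_arr u \<cdot> U_arr e = U_arr v \<cdot> U_arr e" using eq by (metis Alg_simps(6) U_arr_simp)
    then have "U_arr u = U_arr v"
      by (rule regular_epi_cancel[OF reg, rotated -1])
        (use alg_arr_base(1-3)[OF uv(1)] alg_arr_base(1-3)[OF uv(2)] uv(3,4) e in simp_all)
    moreover have "snd (snd u) = snd (snd v)" using eq unfolding alg_arr_eq by simp
    ultimately show "u = v" unfolding alg_arr_eq using uv(3,4) by simp
  next
    fix h assume hA: "h \<in> Arr AC" and dh: "Dom AC h = Dom AC e" and eq: "h \<cdot>\<^bsub>AC\<^esub> p = h \<cdot>\<^bsub>AC\<^esub> q"
    note h = alg_arr_base[OF hA]
    have eqC: "U_arr h \<cdot> U_arr p = U_arr h \<cdot> U_arr q" using eq by (metis Alg_simps(6) U_arr_simp)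
    \<comment> \<open>The witnessing pair factors through the kernel pair, so an arrow coequalizing
      the kernel pair coequalizes it too.\<close>
    obtain f g where fg: "is_coequalizer C f g (U_arr e)" using reg unfolding is_regular_epi_def by blast
    note c = coequalizerD[OF fg]
    obtain k where k: "k \<in> Arr C" "Dom C k = Dom C f" "Cod C k = fst P" "U_arr p \<cdot> k = f" "U_arr q \<cdot> k = g"
      by (rule pullback_lift[OF PC c(1,2) _ _ _ c(7)]) (use c in simp_all)
    note PCd = pullbackD[OF PC]
    have "U_arr h \<cdot> U_arr p \<cdot> k = U_arr h \<cdot> U_arr q \<cdot> k"
      by (rule square_comp[OF eqC]) (use k(1-3) PCd(4-9) h(1-3) e(2) dh in simp_all)
    then have hfg: "U_arr h \<cdot> f = U_arr h \<cdot> g" using k by simp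
    have "Dom C (U_arr h) = Dom C (U_arr e)" using h(2) e(2) dh by simp
    from coequalizer_lift[OF fg h(1) this hfg] obtain t where
      t: "t \<in> Arr C" "Dom C t = Cod C (U_arr e)" "Cod C t = Cod C (U_arr h)" "t \<cdot> U_arr e = U_arr h" by metis
    have "is_algebra_hom C Th (Cod AC e) t (Cod AC h)"
      unfolding is_algebra_hom_def
    proof (intro conjI ballI)
      show "t \<in> Hom C (fst (Cod AC e)) (fst (Cod AC h))" using t h(3) e(3) by simp
      fix f assume f: "f \<in> Ops Th"
      let ?n = "arity Th f"
      let ?a = "snd (Dom AC e) f" and ?b = "snd (Cod AC e) f" and ?c = "snd (Cod AC h) f"
      note a = algD(2-4)[OF e(4) f] and b = algD(2-4)[OF e(5) f] and c' = algD(2-4)[OF h(5) f]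
      have he: "U_arr e \<cdot> ?a = ?b \<cdot> pow_map C ?n (U_arr e)" by (rule homD(4)[OF e(6) f])
      have hh: "U_arr h \<cdot> ?a = ?c \<cdot> pow_map C ?n (U_arr h)" using homD(4)[OF h(6) f] dh by metis
      obtain w s where w: "strong w" "Cod C w = pow_obj C (Cod C (U_arr e)) ?n"
        and s: "s \<in> Hom C (Dom C w) (pow_obj C (Dom C (U_arr e)) ?n)" "pow_map C ?n (U_arr e) \<cdot> s = w"
        by (rule cover_lift_power[OF reg])
      have wA: "w \<in> Arr C" using w by simp
      have s': "s \<in> Arr C" "Dom C s = Dom C w" "Cod C s = pow_obj C (fst (Dom AC e)) ?n" using s e(2) by simp_all
      have tn: "pow_map C ?n t \<cdot> pow_map C ?n (U_arr e) = pow_map C ?n (U_arr h)"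
        using pow_map_comp[OF t(1) e(1), of ?n] t(2,4) by simp
      have dhe: "Dom C (U_arr h) = fst (Dom AC e)" using h(2) dh by simp
      have "(t \<cdot> ?b) \<cdot> w = t \<cdot> ?b \<cdot> w"
        by (rule comp_assoc) (use t b w wA e in simp_all)
      also have "?b \<cdot> w = U_arr e \<cdot> ?a \<cdot> s"
        using square_comp[OF he, of s] s'(1) s'(3) s(2) e(1-3) a b by simp
      also have "t \<cdot> U_arr e \<cdot> ?a \<cdot> s = U_arr h \<cdot> ?a \<cdot> s"
        by (rule comp_assoc_subst[OF t(4)]) (use t(1-3) s' a e(1-3) in simp_all)
      also have "\<dots> = ?c \<cdot> pow_map C ?n (U_arr h) \<cdot> s"
        by (rule square_comp[OF hh]) (use s' a c' h(1,3) dhe in simp_all)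
      also have "pow_map C ?n (U_arr h) \<cdot> s = pow_map C ?n t \<cdot> w"
        using comp_assoc_subst[OF tn, of s] s' s(2) t(1-3) e(1-3) by simp
      also have "?c \<cdot> pow_map C ?n t \<cdot> w = (?c \<cdot> pow_map C ?n t) \<cdot> w"
        by (rule comp_assoc[symmetric]) (use t(1-3) w wA c' h(3) in simp_all)
      finally show "t \<cdot> ?b = ?c \<cdot> pow_map C ?n t"
        by (rule strong_cancel[OF w(1), rotated -1]) (use t(1-3) b c' h(3) e(3) w(2) in simp_all)
    qed
    then have "(Cod AC e, t, Cod AC h) \<in> Hom AC (Cod AC e) (Cod AC h)"
      using e(5) h(5) by (simp add: Hom_def)
    moreover have "(Cod AC e, t, Cod AC h) \<cdot>\<^bsub>AC\<^esub> e = h" using t(4) dh unfolding alg_arr_eq by simp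
    ultimately show "\<exists>k\<in>Hom AC (Cod AC e) (Cod AC h). k \<cdot>\<^bsub>AC\<^esub> e = h" by blast
  qed
  then show ?thesis unfolding is_regular_epi_def by blast
qed

text \<open>Regularity of the second factor is stated for its underlying arrow:
  \<open>alg_regular_epi_base\<close> needs this form, and \<open>alg_regular_epi_lift\<close> turns
  it into the other.\<close>

lemma alg_factorization:
  assumes hA: "h \<in> Arr AC"
  obtains m e where "is_mono AC m" "e \<in> Arr AC" "is_regular_epi C (U_arr e)" "Cod AC e = Dom AC m"
    "m \<cdot>\<^bsub>AC\<^esub> e = h"
proof -
  note h = alg_arr_base[OF hA]
  obtain m e where m: "is_mono C m" and e: "is_regular_epi C e" and me: "Cod C e = Dom C m" "m \<cdot> e = U_arr h"
    using regular_factorization[OF h(1)] by metis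
  obtain \<iota> where i: "is_algebra C Th (Dom C m, \<iota>)" "is_algebra_hom C Th (Dom C m, \<iota>) m (Cod AC h)"
    "is_algebra_hom C Th (Dom AC h) e (Dom C m, \<iota>)"
    using image_algebra[OF h(4,5,6) m e me] by blast
  show ?thesis
  proof
    show "is_mono AC ((Dom C m, \<iota>), m, Cod AC h)" unfolding alg_mono_iff using i h(5) m by simp
    show "(Dom AC h, e, (Dom C m, \<iota>)) \<in> Arr AC" using i h(4) by simp
    show "is_regular_epi C (U_arr (Dom AC h, e, (Dom C m, \<iota>)))" using e by simp
    show "((Dom C m, \<iota>), m, Cod AC h) \<cdot>\<^bsub>AC\<^esub> (Dom AC h, e, (Dom C m, \<iota>)) = h"
      unfolding alg_arr_eq using me by simp
  qed simp
qed

text \<open>Factor \<open>e\<close> through its image. A regular epimorphism is strong, so the monic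
  part \<open>m\<close> has a section and is invertible; the underlying arrow of \<open>e\<close>
  then differs by an isomorphism from one that is regular in the base.\<close>

lemma alg_regular_epi_base:
  assumes "is_regular_epi AC e"
  shows "is_regular_epi C (U_arr e)"
proof -
  have eA: "e \<in> Arr AC" using Alg.regular_epi_arr[OF assms] .
  note e = alg_arr_base[OF eA]
  obtain m d where m: "is_mono AC m" and d: "d \<in> Arr AC" "is_regular_epi C (U_arr d)"
    and md: "Cod AC d = Dom AC m" "m \<cdot>\<^bsub>AC\<^esub> d = e"
    by (rule alg_factorization[OF eA])
  have mA: "m \<in> Arr AC" using m unfolding is_mono_def by blast
  have cm: "Cod AC m = Cod AC e" using md(2) by (metis Alg.comp_arr(3) d(1) mA md(1))
  note mC = alg_arr_base[OF mA] and dC = alg_arr_base[OF d(1)]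
  have I: "Id AC (Cod AC e) \<in> Arr AC" "Dom AC (Id AC (Cod AC e)) = Cod AC e"
    using Alg.id_arr[of "Cod AC e"] Alg.arr_obj(2)[OF eA] by blast+
  have "sub_le AC e m" using Alg.sub_leI[OF d(1) md(1) mA] md(2) by metis
  then have "sub_le AC (Id AC (Cod AC e) \<cdot>\<^bsub>AC\<^esub> e) m" using Alg.comp_id(1)[OF eA refl] by metis
  from Alg.strongD[OF Alg.regular_epi_strong[OF assms] m I this]
  obtain k where k: "k \<in> Hom AC (Cod AC e) (Dom AC m)" "m \<cdot>\<^bsub>AC\<^esub> k = Id AC (Cod AC e)"
    unfolding sub_le_def using I(2) by metis
  have kA: "k \<in> Arr AC" "Dom AC k = Cod AC e" "Cod AC k = Dom AC m" using k(1) unfolding Hom_def by blast+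
  note kC = alg_arr_base[OF kA(1)]
  let ?m = "U_arr m" and ?k = "U_arr k"
  have kC': "?k \<in> Hom C (Cod C ?m) (Dom C ?m)" using kC kA(2,3) mC cm by simp
  have mk: "?m \<cdot> ?k = Id C (Cod C ?m)"
    using k(2) cm mC(3) by (metis Alg_simps(5,6) U_arr_simp)
  have "is_mono C ?m" using m alg_mono_iff by blast
  then have km: "?k \<cdot> ?m = Id C (Dom C ?m)"
    by (rule mono_cancel) (use kC' mC(1) comp_assoc_subst[OF mk, of ?m] in simp_all)
  have "is_regular_epi C (?m \<cdot> U_arr d)"
    by (rule regular_epi_iso_comp[OF d(2) mC(1) _ kC' mk km]) (use mC(2) dC(3) md(1) in simp)
  moreover have "?m \<cdot> U_arr d = U_arr e" using md(2) by (metis Alg_simps(6) U_arr_simp)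
  ultimately show ?thesis by simp
qed

lemma alg_regular: "regular_category AC"
  unfolding regular_category_def
proof (intro conjI ballI allI impI)
  show "finitely_complete AC" by (rule alg_finitely_complete)
  fix f assume "f \<in> Arr AC"
  from alg_factorization[OF this]
  show "\<exists>m e. is_mono AC m \<and> is_regular_epi AC e \<and> Cod AC e = Dom AC m \<and> m \<cdot>\<^bsub>AC\<^esub> e = f"
    using alg_regular_epi_lift by metis
next
  fix f e P p q assume *: "is_regular_epi AC e \<and> is_pullback AC f e P p q"
  then have "is_regular_epi C (U_arr p)"
    using regular_epi_pullback[OF alg_regular_epi_base alg_pullback_base] by blast
  then show "is_regular_epi AC p"
    using alg_regular_epi_lift Alg.pullbackD(4) * by blast
qed

end

section \<open>Toposes\<close>

lemma (in category) pullbackI: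
  assumes "f \<in> Arr C" "g \<in> Arr C" "Cod C f = Cod C g" "p \<in> Hom C P (Dom C f)" "q \<in> Hom C P (Dom C g)"
    "f \<cdot> p = g \<cdot> q"
    "\<And>u v. u \<in> Arr C \<Longrightarrow> v \<in> Arr C \<Longrightarrow> Dom C v = Dom C u \<Longrightarrow> Cod C u = Dom C f \<Longrightarrow> Cod C v = Dom C g \<Longrightarrow>
      f \<cdot> u = g \<cdot> v \<Longrightarrow> \<exists>h \<in> Hom C (Dom C u) P. p \<cdot> h = u \<and> q \<cdot> h = v"
    "\<And>h k. h \<in> Arr C \<Longrightarrow> k \<in> Arr C \<Longrightarrow> Dom C h = Dom C k \<Longrightarrow> Cod C h = P \<Longrightarrow> Cod C k = P \<Longrightarrow>
      p \<cdot> h = p \<cdot> k \<Longrightarrow> q \<cdot> h = q \<cdot> k \<Longrightarrow> h = k"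
  shows "is_pullback C f g P p q"
  unfolding is_pullback_def
proof (intro conjI allI ballI impI)
  fix Z u v assume u: "u \<in> Hom C Z (Dom C f)" and v: "v \<in> Hom C Z (Dom C g)" and eq: "f \<cdot> u = g \<cdot> v"
  have uv: "u \<in> Arr C" "v \<in> Arr C" "Dom C v = Dom C u" "Cod C u = Dom C f" "Cod C v = Dom C g" "Dom C u = Z"
    using u v by simp_all
  obtain h where h: "h \<in> Hom C Z P" "p \<cdot> h = u" "q \<cdot> h = v"
    using assms(7)[OF uv(1-5) eq] unfolding uv(6) by blast
  show "\<exists>!h. h \<in> Hom C Z P \<and> p \<cdot> h = u \<and> q \<cdot> h = v"
  proof (rule ex1I)
    show "h \<in> Hom C Z P \<and> p \<cdot> h = u \<and> q \<cdot> h = v" using h by blast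
    fix k assume k: "k \<in> Hom C Z P \<and> p \<cdot> k = u \<and> q \<cdot> k = v"
    show "k = h" by (rule assms(8)) (use h k in simp_all)
  qed
qed fact+

locale topos = complete_category +
  fixes \<Omega> tr
  assumes classifier: "is_subobject_classifier C \<Omega> tr"
    and exponentials: "\<And>A B. A \<in> Obj C \<Longrightarrow> B \<in> Obj C \<Longrightarrow> \<exists>Y ev. is_exponential C A B Y ev"
begin

section \<open>Truth values, power objects and universal quantification\<close>

lemma tr_arr: "tr \<in> Arr C" "Cod C tr = \<Omega>" "\<Omega> \<in> Obj C"
  using classifier arr_obj(2) unfolding is_subobject_classifier_def by blast+

lemma to_terminal_unique:
  assumes "u \<in> Arr C" "v \<in> Arr C" "Dom C u = Dom C v" "Cod C u = Dom C tr" "Cod C v = Dom C tr"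
  shows "u = v"
proof -
  have "\<exists>!h. h \<in> Hom C (Dom C u) (Dom C tr)"
    using classifier arr_obj(1)[OF assms(1)] unfolding is_subobject_classifier_def is_terminal_def by blast
  moreover have "u \<in> Hom C (Dom C u) (Dom C tr)" "v \<in> Hom C (Dom C u) (Dom C tr)" using assms by simp_all
  ultimately show ?thesis by blast
qed

lemma tr_mono: "is_mono C tr"
  unfolding is_mono_def using tr_arr to_terminal_unique by simp

lemma classify:
  assumes "is_mono C m"
  obtains \<chi> where "\<chi> \<in> Hom C (Cod C m) \<Omega>"
    "\<And>x. x \<in> Arr C \<Longrightarrow> Cod C x = Cod C m \<Longrightarrow> \<chi> \<cdot> x \<sqsubseteq> tr \<longleftrightarrow> x \<sqsubseteq> m"
proof -
  have "\<exists>!\<chi>. \<chi> \<in> Hom C (Cod C m) \<Omega> \<and> (\<exists>b. is_pullback C \<chi> tr (Dom C m) m b)"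
    using classifier assms unfolding is_subobject_classifier_def by blast
  then obtain \<chi> b where c: "\<chi> \<in> Hom C (Cod C m) \<Omega>" "is_pullback C \<chi> tr (Dom C m) m b" by blast
  show ?thesis
  proof (rule that[OF c(1)])
    fix x assume "x \<in> Arr C" "Cod C x = Cod C m"
    then show "\<chi> \<cdot> x \<sqsubseteq> tr \<longleftrightarrow> x \<sqsubseteq> m" using pullback_sub_le[OF c(2), of x] c(1) by simp
  qed
qed

text \<open>Both arrows classify the same monomorphism, the pullback of \<open>tr\<close> along
  \<phi>, so uniqueness of characteristic arrows identifies them. That the square for \<psi> is a
  pullback uses that the domain of \<open>tr\<close> is terminal.\<close>

lemma omega_ext:
  assumes "\<phi> \<in> Hom C P \<Omega>" "\<psi> \<in> Hom C P \<Omega>"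
    "\<And>x. x \<in> Arr C \<Longrightarrow> Cod C x = P \<Longrightarrow> \<phi> \<cdot> x \<sqsubseteq> tr \<longleftrightarrow> \<psi> \<cdot> x \<sqsubseteq> tr"
  shows "\<phi> = \<psi>"
proof -
  have f: "\<phi> \<in> Arr C" "Dom C \<phi> = P" "Cod C \<phi> = \<Omega>" and g: "\<psi> \<in> Arr C" "Dom C \<psi> = P" "Cod C \<psi> = \<Omega>"
    using assms(1,2) by simp_all
  let ?m = "pb1 C \<phi> tr"
  have pb: "is_pullback C \<phi> tr (Dom C ?m) ?m (pb2 C \<phi> tr)"
    by (rule pb_pullback) (use f tr_arr in simp_all)
  have mono: "is_mono C ?m" by (rule pullback_mono[OF pb tr_mono])
  have m: "?m \<in> Arr C" "Cod C ?m = P" using pullbackD[OF pb] f by simp_all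
  have le: "x \<sqsubseteq> ?m \<longleftrightarrow> x \<in> Arr C \<and> Cod C x = P \<and> \<psi> \<cdot> x \<sqsubseteq> tr" for x
    using pullback_sub_le[OF pb, of x, unfolded f(2)] assms(3)[of x] by blast
  have "\<psi> \<cdot> ?m \<sqsubseteq> tr" using le[of ?m] m(1) by simp
  then obtain q where q: "q \<in> Arr C" "Dom C q = Dom C (\<psi> \<cdot> ?m)" "Cod C q = Dom C tr" "tr \<cdot> q = \<psi> \<cdot> ?m"
    using sub_leE[OF _ tr_arr(1)] by metis
  have dq: "Dom C q = Dom C ?m" using q(2) g m by simp
  have pb': "is_pullback C \<psi> tr (Dom C ?m) ?m q"
  proof (rule pullbackI)
    fix u v assume uv: "u \<in> Arr C" "v \<in> Arr C" "Dom C v = Dom C u" "Cod C u = Dom C \<psi>" "Cod C v = Dom C tr"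
      "\<psi> \<cdot> u = tr \<cdot> v"
    have "\<psi> \<cdot> u \<sqsubseteq> tr" unfolding uv(6) by (rule sub_leI) (use uv tr_arr in simp_all)
    then have "u \<sqsubseteq> ?m" using le uv(1,4) g(2) by simp
    then obtain h where h: "h \<in> Arr C" "Dom C h = Dom C u" "Cod C h = Dom C ?m" "?m \<cdot> h = u"
      using sub_leE[OF _ m(1)] by metis
    have "q \<cdot> h = v" by (rule to_terminal_unique) (use h q dq uv in simp_all)
    with h show "\<exists>h\<in>Hom C (Dom C u) (Dom C ?m). ?m \<cdot> h = u \<and> q \<cdot> h = v" by (intro bexI[of _ h]) simp_all
  next
    fix h k assume "h \<in> Arr C" "k \<in> Arr C" "Dom C h = Dom C k" "Cod C h = Dom C ?m" "Cod C k = Dom C ?m"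
      "?m \<cdot> h = ?m \<cdot> k"
    then show "h = k" using mono_cancel[OF mono, of h k] by blast
  qed (use g m q dq tr_arr in simp_all)
  have "\<exists>!\<chi>. \<chi> \<in> Hom C (Cod C ?m) \<Omega> \<and> (\<exists>b. is_pullback C \<chi> tr (Dom C ?m) ?m b)"
    using classifier mono unfolding is_subobject_classifier_def by blast
  moreover have "\<phi> \<in> Hom C (Cod C ?m) \<Omega>" "\<psi> \<in> Hom C (Cod C ?m) \<Omega>" using assms(1,2) m(2) by simp_all
  ultimately show ?thesis using pb pb' by blast
qed

text \<open>\<open>E\<close> is the membership relation, the inverse image of truth along the
  evaluation of the exponential of \<Omega>. The last two clauses are comprehension for families
  over \<open>Z\<close> and extensionality; phrased on elements they replace the exponential from
  here on.\<close>

lemma ex_power_object: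
  assumes A: "A \<in> Obj C"
  obtains Y E where "Y \<in> Obj C" "is_mono C E" "Cod C E = prod_obj C Y A"
    "\<And>Z V. Z \<in> Obj C \<Longrightarrow> is_mono C V \<Longrightarrow> Cod C V = prod_obj C Z A \<Longrightarrow> \<exists>v \<in> Hom C Z Y.
      \<forall>W. \<forall>z \<in> Hom C W Z. \<forall>a \<in> Hom C W A. pairing C (v \<cdot> z) a \<sqsubseteq> E \<longleftrightarrow> pairing C z a \<sqsubseteq> V"
    "\<And>Z u v. u \<in> Hom C Z Y \<Longrightarrow> v \<in> Hom C Z Y \<Longrightarrow>
      (\<And>W z a. z \<in> Hom C W Z \<Longrightarrow> a \<in> Hom C W A \<Longrightarrow>
        pairing C (u \<cdot> z) a \<sqsubseteq> E \<longleftrightarrow> pairing C (v \<cdot> z) a \<sqsubseteq> E) \<Longrightarrow> u = v"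
proof -
  obtain Y ev where ex: "is_exponential C A \<Omega> Y ev" using exponentials[OF A tr_arr(3)] by blast
  have Y: "Y \<in> Obj C" and ev: "ev \<in> Arr C" "Dom C ev = prod_obj C Y A" "Cod C ev = \<Omega>"
    using ex unfolding is_exponential_def by simp_all
  let ?E = "inverse_image C ev tr"
  have E: "is_mono C ?E" "Cod C ?E = prod_obj C Y A"
    using inverse_image_mono[OF ev(1) tr_mono] ev tr_arr by simp_all
  have Ele: "pairing C y a \<sqsubseteq> ?E \<longleftrightarrow> ev \<cdot> pairing C y a \<sqsubseteq> tr" if "y \<in> Hom C W Y" "a \<in> Hom C W A" for W y a
    using inverse_image_le[OF ev(1) tr_arr(1), of "pairing C y a"] ev tr_arr that by simp
  have tp: "ev \<cdot> pairing C (h \<cdot> pr1 C Z A) (pr2 C Z A) \<cdot> pairing C z a = ev \<cdot> pairing C (h \<cdot> z) a"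
    if "h \<in> Hom C Z Y" "z \<in> Hom C W Z" "a \<in> Hom C W A" for h Z W z a
  proof -
    have Z: "Z \<in> Obj C" using that(1) by auto
    have "(h \<cdot> pr1 C Z A) \<cdot> pairing C z a = h \<cdot> pr1 C Z A \<cdot> pairing C z a"
      by (rule comp_assoc) (use that Z A in simp_all)
    then show ?thesis using that Z A by simp
  qed
  have univ: "\<exists>!h. h \<in> Hom C Z Y \<and> ev \<cdot> pairing C (h \<cdot> pr1 C Z A) (pr2 C Z A) = f"
    if "Z \<in> Obj C" "f \<in> Hom C (prod_obj C Z A) \<Omega>" for Z f
    using ex that unfolding is_exponential_def by blast
  show ?thesis
  proof (rule that[OF Y E])
    fix Z V assume Z: "Z \<in> Obj C" and V: "is_mono C V" "Cod C V = prod_obj C Z A"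
    obtain \<chi> where c: "\<chi> \<in> Hom C (Cod C V) \<Omega>"
      "\<And>x. x \<in> Arr C \<Longrightarrow> Cod C x = Cod C V \<Longrightarrow> \<chi> \<cdot> x \<sqsubseteq> tr \<longleftrightarrow> x \<sqsubseteq> V"
      by (rule classify[OF V(1)]) blast
    obtain v where v: "v \<in> Hom C Z Y" "ev \<cdot> pairing C (v \<cdot> pr1 C Z A) (pr2 C Z A) = \<chi>"
      using univ[OF Z, of \<chi>] c(1) V(2) by metis
    have "pairing C (v \<cdot> z) a \<sqsubseteq> ?E \<longleftrightarrow> pairing C z a \<sqsubseteq> V" if za: "z \<in> Hom C W Z" "a \<in> Hom C W A" for W z a
    proof -
      have "\<chi> \<cdot> pairing C z a = ev \<cdot> pairing C (v \<cdot> pr1 C Z A) (pr2 C Z A) \<cdot> pairing C z a"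
        by (rule comp_assoc_subst[OF v(2), symmetric]) (use za v(1) Z A Y ev in simp_all)
      then have "\<chi> \<cdot> pairing C z a = ev \<cdot> pairing C (v \<cdot> z) a" using tp[OF v(1) za] by simp
      moreover have "pairing C (v \<cdot> z) a \<sqsubseteq> ?E \<longleftrightarrow> ev \<cdot> pairing C (v \<cdot> z) a \<sqsubseteq> tr"
        by (rule Ele) (use za v(1) in simp_all)
      moreover have "\<chi> \<cdot> pairing C z a \<sqsubseteq> tr \<longleftrightarrow> pairing C z a \<sqsubseteq> V"
        by (rule c(2)) (use za V(2) in simp_all)
      ultimately show ?thesis by simp
    qed
    then show "\<exists>v \<in> Hom C Z Y. \<forall>W. \<forall>z \<in> Hom C W Z. \<forall>a \<in> Hom C W A.
        pairing C (v \<cdot> z) a \<sqsubseteq> ?E \<longleftrightarrow> pairing C z a \<sqsubseteq> V"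
      using v(1) by blast
  next
    fix Z u v assume uv: "u \<in> Hom C Z Y" "v \<in> Hom C Z Y"
      and eq: "\<And>W z a. z \<in> Hom C W Z \<Longrightarrow> a \<in> Hom C W A \<Longrightarrow>
        pairing C (u \<cdot> z) a \<sqsubseteq> ?E \<longleftrightarrow> pairing C (v \<cdot> z) a \<sqsubseteq> ?E"
    have Z: "Z \<in> Obj C" using uv(1) by auto
    let ?t = "\<lambda>h. ev \<cdot> pairing C (h \<cdot> pr1 C Z A) (pr2 C Z A)"
    have t: "?t h \<in> Hom C (prod_obj C Z A) \<Omega>" if "h \<in> Hom C Z Y" for h
      using that Z A Y ev by simp
    have t': "?t h \<cdot> pairing C z a = ev \<cdot> pairing C (h \<cdot> z) a"
      if "h \<in> Hom C Z Y" "z \<in> Hom C W Z" "a \<in> Hom C W A" for W z a h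
    proof -
      have "?t h \<cdot> pairing C z a = ev \<cdot> pairing C (h \<cdot> pr1 C Z A) (pr2 C Z A) \<cdot> pairing C z a"
        by (rule comp_assoc) (use that Z A Y ev in simp_all)
      then show ?thesis using tp[OF that] by simp
    qed
    have "?t u = ?t v"
    proof (rule omega_ext[OF t[OF uv(1)] t[OF uv(2)]])
      fix x assume x: "x \<in> Arr C" "Cod C x = prod_obj C Z A"
      obtain z a where za: "z \<in> Arr C" "a \<in> Arr C" "Dom C z = Dom C x" "Dom C a = Dom C x"
        "Cod C z = Z" "Cod C a = A" and xeq: "x = pairing C z a"
        by (rule pairing_cases[OF x Z A])
      have za': "z \<in> Hom C (Dom C z) Z" "a \<in> Hom C (Dom C z) A" using za by simp_all
      have uz: "u \<cdot> z \<in> Hom C (Dom C z) Y" "v \<cdot> z \<in> Hom C (Dom C z) Y" using za' uv by simp_all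
      show "?t u \<cdot> x \<sqsubseteq> tr \<longleftrightarrow> ?t v \<cdot> x \<sqsubseteq> tr"
        unfolding xeq t'[OF uv(1) za'] t'[OF uv(2) za']
        using Ele[OF uz(1) za'(2)] Ele[OF uz(2) za'(2)] eq[OF za'] by blast
    qed
    then show "u = v" using univ[OF Z t[OF uv(2)]] uv by metis
  qed
qed

text \<open>The subobject \<open>m\<close> is \<open>\<forall>\<^sub>g b\<close>. It consists of the points \<open>x\<close> whose fibre \<open>{y. g y = x}\<close> equals
  \<open>{y. g y = x \<and> y \<in> b}\<close>, i.e. it is the equalizer of the names of the graph of \<open>g\<close> and of its
  restriction to \<open>b\<close>.\<close>

lemma ex_forall:
  assumes g: "g \<in> Arr C" and b: "is_mono C b" "Cod C b = Dom C g"
  obtains m where "is_mono C m" "Cod C m = Cod C g"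
    "\<And>h. h \<in> Arr C \<Longrightarrow> Cod C h = Cod C g \<Longrightarrow> h \<sqsubseteq> m \<longleftrightarrow>
      (\<forall>w y. w \<in> Arr C \<longrightarrow> Cod C w = Dom C h \<longrightarrow> y \<in> Hom C (Dom C w) (Dom C g) \<longrightarrow> h \<cdot> w = g \<cdot> y \<longrightarrow> y \<sqsubseteq> b)"
proof -
  let ?X = "Cod C g" and ?Y = "Dom C g"
  have X: "?X \<in> Obj C" and Y: "?Y \<in> Obj C" using g by simp_all
  obtain P E where P: "P \<in> Obj C" and E: "is_mono C E" "Cod C E = prod_obj C P ?Y"
    and nam: "\<And>Z V. Z \<in> Obj C \<Longrightarrow> is_mono C V \<Longrightarrow> Cod C V = prod_obj C Z ?Y \<Longrightarrow> \<exists>v \<in> Hom C Z P.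
      \<forall>W. \<forall>z \<in> Hom C W Z. \<forall>a \<in> Hom C W ?Y. pairing C (v \<cdot> z) a \<sqsubseteq> E \<longleftrightarrow> pairing C z a \<sqsubseteq> V"
    and ext: "\<And>Z u v. u \<in> Hom C Z P \<Longrightarrow> v \<in> Hom C Z P \<Longrightarrow>
      (\<And>W z a. z \<in> Hom C W Z \<Longrightarrow> a \<in> Hom C W ?Y \<Longrightarrow>
        pairing C (u \<cdot> z) a \<sqsubseteq> E \<longleftrightarrow> pairing C (v \<cdot> z) a \<sqsubseteq> E) \<Longrightarrow> u = v"
    by (rule ex_power_object[OF Y]) blast
  \<comment> \<open>The graph of \<open>g\<close> with the point of the codomain first, so that it
    is a family of subobjects of \<open>?Y\<close> indexed by \<open>?X\<close>: the family of
    fibres.\<close>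
  let ?V = "pairing C g (Id C ?Y)"
  have V: "?V \<in> Arr C" "Dom C ?V = ?Y" "Cod C ?V = prod_obj C ?X ?Y" using g Y by simp_all
  have Vk: "?V \<cdot> k = pairing C (g \<cdot> k) k" if "k \<in> Arr C" "Cod C k = ?Y" for k using that g Y by simp
  have "pr2 C ?X ?Y \<cdot> ?V = Id C ?Y" using g X Y by simp
  then have "is_mono C (pr2 C ?X ?Y \<cdot> ?V)" using Y by simp
  then have Vm: "is_mono C ?V" by (rule mono_left_cancel) (use V X Y in simp_all)
  have bA: "b \<in> Arr C" using b by simp
  have Vbm: "is_mono C (?V \<cdot> b)" by (rule mono_comp[OF Vm b(1)]) (use b(2) V in simp)
  have Vb: "?V \<cdot> b \<in> Arr C" "Cod C (?V \<cdot> b) = prod_obj C ?X ?Y" "Dom C (?V \<cdot> b) = Dom C b"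
    using comp_arr[of b ?V] V b(2) bA by simp_all
  have leV: "pairing C x y \<sqsubseteq> ?V \<longleftrightarrow> x = g \<cdot> y" if xy: "x \<in> Hom C W ?X" "y \<in> Hom C W ?Y" for W x y
  proof
    assume "pairing C x y \<sqsubseteq> ?V"
    then obtain k where k: "k \<in> Arr C" "Dom C k = Dom C (pairing C x y)" "Cod C k = Dom C ?V" "?V \<cdot> k = pairing C x y"
      using sub_leE[OF _ V(1)] by metis
    have k': "Cod C k = ?Y" "Dom C k = W" using k(2,3) V(2) xy by simp_all
    have "pairing C (g \<cdot> k) k = pairing C x y" using Vk[OF k(1) k'(1)] k(4) by simp
    moreover have "pairing C (g \<cdot> k) k = pairing C x y \<longleftrightarrow> g \<cdot> k = x \<and> k = y"
      by (rule pairing_inject) (use k(1) k' xy g in simp_all)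
    ultimately show "x = g \<cdot> y" by blast
  next
    assume "x = g \<cdot> y"
    then have "pairing C x y = ?V \<cdot> y" using Vk[of y] xy by simp
    then show "pairing C x y \<sqsubseteq> ?V" using sub_leI[of y ?V] xy V by simp
  qed
  have leVb: "pairing C x y \<sqsubseteq> ?V \<cdot> b \<longleftrightarrow> x = g \<cdot> y \<and> y \<sqsubseteq> b" if xy: "x \<in> Hom C W ?X" "y \<in> Hom C W ?Y" for W x y
  proof
    assume le: "pairing C x y \<sqsubseteq> ?V \<cdot> b"
    have "?V \<cdot> b \<sqsubseteq> ?V" by (rule sub_leI[OF bA _ V(1)]) (use b(2) V in simp)
    then have "x = g \<cdot> y" using leV[OF xy] sub_le_trans[OF le] V(1) by blast
    obtain k where k: "k \<in> Arr C" "Dom C k = Dom C (pairing C x y)" "Cod C k = Dom C (?V \<cdot> b)"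
      "(?V \<cdot> b) \<cdot> k = pairing C x y"
      using sub_leE[OF le Vb(1)] by metis
    have k': "Cod C k = Dom C b" "Dom C k = W" using k(2,3) Vb(3) xy by simp_all
    have bk: "b \<cdot> k \<in> Arr C" "Cod C (b \<cdot> k) = ?Y" "Dom C (b \<cdot> k) = W" using bA k(1) k' b(2) by simp_all
    have "(?V \<cdot> b) \<cdot> k = ?V \<cdot> b \<cdot> k" by (rule comp_assoc) (use bA k(1) k' b(2) V in simp_all)
    then have "pairing C (g \<cdot> b \<cdot> k) (b \<cdot> k) = pairing C x y" using Vk[OF bk(1,2)] k(4) by simp
    moreover have "pairing C (g \<cdot> b \<cdot> k) (b \<cdot> k) = pairing C x y \<longleftrightarrow> g \<cdot> b \<cdot> k = x \<and> b \<cdot> k = y"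
      by (rule pairing_inject) (use bk xy g in simp_all)
    ultimately have "b \<cdot> k = y" by blast
    then have "y \<sqsubseteq> b" using sub_leI[of k b] k(1) k' bA by simp
    with \<open>x = g \<cdot> y\<close> show "x = g \<cdot> y \<and> y \<sqsubseteq> b" by blast
  next
    assume *: "x = g \<cdot> y \<and> y \<sqsubseteq> b"
    then obtain k where k: "k \<in> Arr C" "Dom C k = Dom C y" "Cod C k = Dom C b" "b \<cdot> k = y"
      using sub_leE[OF _ bA] by metis
    have "(?V \<cdot> b) \<cdot> k = ?V \<cdot> b \<cdot> k" by (rule comp_assoc) (use bA k(1,3) b(2) V in simp_all)
    also have "\<dots> = pairing C x y" using Vk[of y] xy k(4) * by simp
    finally show "pairing C x y \<sqsubseteq> ?V \<cdot> b" using sub_leI[of k "?V \<cdot> b"] k(1,3) Vb by simp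
  qed
  obtain v1 where v1: "v1 \<in> Hom C ?X P"
    "\<And>W z a. z \<in> Hom C W ?X \<Longrightarrow> a \<in> Hom C W ?Y \<Longrightarrow> pairing C (v1 \<cdot> z) a \<sqsubseteq> E \<longleftrightarrow> pairing C z a \<sqsubseteq> ?V"
    using nam[OF X Vm V(3)] by blast
  obtain v2 where v2: "v2 \<in> Hom C ?X P"
    "\<And>W z a. z \<in> Hom C W ?X \<Longrightarrow> a \<in> Hom C W ?Y \<Longrightarrow> pairing C (v2 \<cdot> z) a \<sqsubseteq> E \<longleftrightarrow> pairing C z a \<sqsubseteq> ?V \<cdot> b"
    using nam[OF X Vbm Vb(2)] by blast
  have v: "v1 \<in> Arr C" "v2 \<in> Arr C" "Dom C v1 = ?X" "Dom C v2 = ?X" "Cod C v1 = P" "Cod C v2 = P"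
    using v1(1) v2(1) by simp_all
  obtain m where m: "is_mono C m" "Cod C m = Dom C v1"
    "\<And>x. x \<sqsubseteq> m \<longleftrightarrow> x \<in> Arr C \<and> Cod C x = Dom C v1 \<and> v1 \<cdot> x = v2 \<cdot> x"
    by (rule ex_equalizer[of v1 v2]) (use v in simp_all)
  show ?thesis
  proof (rule that[OF m(1)])
    show "Cod C m = ?X" using m(2) v by simp
    fix h assume h: "h \<in> Arr C" "Cod C h = ?X"
    have hm: "h \<sqsubseteq> m \<longleftrightarrow> v1 \<cdot> h = v2 \<cdot> h" using m(3)[of h] h v by simp
    show "h \<sqsubseteq> m \<longleftrightarrow>
      (\<forall>w y. w \<in> Arr C \<longrightarrow> Cod C w = Dom C h \<longrightarrow> y \<in> Hom C (Dom C w) ?Y \<longrightarrow> h \<cdot> w = g \<cdot> y \<longrightarrow> y \<sqsubseteq> b)"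
      unfolding hm
    proof (intro iffI allI impI)
      fix w y assume eq: "v1 \<cdot> h = v2 \<cdot> h" and w: "w \<in> Arr C" "Cod C w = Dom C h"
        and y: "y \<in> Hom C (Dom C w) ?Y" and hw: "h \<cdot> w = g \<cdot> y"
      have hwH: "h \<cdot> w \<in> Hom C (Dom C w) ?X" using h w by simp
      have "v1 \<cdot> h \<cdot> w = v2 \<cdot> h \<cdot> w" by (rule square_comp[OF eq]) (use h w v in simp_all)
      then have "pairing C (h \<cdot> w) y \<sqsubseteq> ?V \<cdot> b"
        using v1(2)[OF hwH y] v2(2)[OF hwH y] leV[OF hwH y] hw by simp
      then show "y \<sqsubseteq> b" using leVb[OF hwH y] by blast
    next
      assume all: "\<forall>w y. w \<in> Arr C \<longrightarrow> Cod C w = Dom C h \<longrightarrow> y \<in> Hom C (Dom C w) ?Y \<longrightarrow> h \<cdot> w = g \<cdot> y \<longrightarrow> y \<sqsubseteq> b"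
      \<comment> \<open>By extensionality of names: a point of the fibre over an element of
        \<open>h\<close> lies in \<open>b\<close> by hypothesis, so the graph and its restriction
        have the same fibres there.\<close>
      show "v1 \<cdot> h = v2 \<cdot> h"
      proof (rule ext)
        show "v1 \<cdot> h \<in> Hom C (Dom C h) P" "v2 \<cdot> h \<in> Hom C (Dom C h) P" using h v by simp_all
        fix W z a assume z: "z \<in> Hom C W (Dom C h)" and a: "a \<in> Hom C W ?Y"
        have hz: "h \<cdot> z \<in> Hom C W ?X" using h z by simp
        have "(v1 \<cdot> h) \<cdot> z = v1 \<cdot> h \<cdot> z" "(v2 \<cdot> h) \<cdot> z = v2 \<cdot> h \<cdot> z" using h z v by simp_all
        moreover have "h \<cdot> z = g \<cdot> a \<longrightarrow> a \<sqsubseteq> b"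
        proof -
          have "z \<in> Arr C" "Cod C z = Dom C h" "a \<in> Hom C (Dom C z) ?Y" using z a by simp_all
          then show ?thesis using all by blast
        qed
        ultimately show "pairing C ((v1 \<cdot> h) \<cdot> z) a \<sqsubseteq> E \<longleftrightarrow> pairing C ((v2 \<cdot> h) \<cdot> z) a \<sqsubseteq> E"
          using v1(2)[OF hz a] v2(2)[OF hz a] leV[OF hz a] leVb[OF hz a] by auto
      qed
    qed
  qed
qed


section \<open>Consequences of universal quantification for suprema and strong epimorphisms\<close>

lemma chain_sups_stable_inverse_image:
  assumes A: "is_chain C X A" and sup: "is_chain_sup C X A s" and g: "g \<in> Arr C" "Cod C g = X"
  shows "is_chain_sup C (Dom C g) (\<lambda>i. inverse_image C g (A i)) (inverse_image C g s)"
  unfolding is_chain_sup_def is_supremum_def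
proof (intro conjI ballI impI)
  note Ad = chainD[OF A] and s = chain_supD[OF sup]
  have iA: "is_mono C (inverse_image C g (A i))" "Cod C (inverse_image C g (A i)) = Dom C g"
    "\<And>x. x \<sqsubseteq> inverse_image C g (A i) \<longleftrightarrow> x \<in> Arr C \<and> Cod C x = Dom C g \<and> g \<cdot> x \<sqsubseteq> A i" for i
    using inverse_image_mono[OF g(1) Ad(1)] inverse_image_le[OF g(1) Ad(2)] g(2) Ad(3) by simp_all
  have is': "is_mono C (inverse_image C g s)" "Cod C (inverse_image C g s) = Dom C g"
    "\<And>x. x \<sqsubseteq> inverse_image C g s \<longleftrightarrow> x \<in> Arr C \<and> Cod C x = Dom C g \<and> g \<cdot> x \<sqsubseteq> s"
    using inverse_image_mono[OF g(1) s(1)] inverse_image_le[OF g(1) s(2)] g(2) s(3) by simp_all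
  show "inverse_image C g s \<in> Subobjects C (Dom C g)" using is' by simp
  fix a assume "a \<in> range (\<lambda>i. inverse_image C g (A i))"
  then obtain i where a: "a = inverse_image C g (A i)" by blast
  have "a \<sqsubseteq> inverse_image C g (A i)" unfolding a using iA(1) by simp
  then have aA: "a \<in> Arr C" "Cod C a = Dom C g" "g \<cdot> a \<sqsubseteq> A i" unfolding iA(3) by blast+
  show "a \<sqsubseteq> inverse_image C g s" unfolding is'(3) using aA sub_le_trans[OF aA(3) s(4) s(2)] by blast
next
  note Ad = chainD[OF A] and s = chain_supD[OF sup]
  fix u assume u: "u \<in> Subobjects C (Dom C g)" "\<forall>a\<in>range (\<lambda>i. inverse_image C g (A i)). a \<sqsubseteq> u"
  have um: "is_mono C u" "Cod C u = Dom C g" and uA: "u \<in> Arr C" using u(1) by simp_all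
  \<comment> \<open>\<open>m\<close> quantifies \<open>u\<close> along \<open>g\<close>: a subobject
    lies in \<open>m\<close> exactly when its inverse image lies in \<open>u\<close>. This
    adjunction is applied to each stage and then read backwards for the supremum.\<close>
  obtain m where m: "is_mono C m" "Cod C m = Cod C g"
    "\<And>h. h \<in> Arr C \<Longrightarrow> Cod C h = Cod C g \<Longrightarrow> h \<sqsubseteq> m \<longleftrightarrow>
      (\<forall>w y. w \<in> Arr C \<longrightarrow> Cod C w = Dom C h \<longrightarrow> y \<in> Hom C (Dom C w) (Dom C g) \<longrightarrow> h \<cdot> w = g \<cdot> y \<longrightarrow> y \<sqsubseteq> u)"
    by (rule ex_forall[OF g(1) um]) blast
  have "A i \<sqsubseteq> m" for i
  proof -
    have "y \<sqsubseteq> u" if w: "w \<in> Arr C" "Cod C w = Dom C (A i)" and y: "y \<in> Hom C (Dom C w) (Dom C g)"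
      and eq: "A i \<cdot> w = g \<cdot> y" for w y
    proof -
      have "g \<cdot> y \<sqsubseteq> A i" unfolding eq[symmetric] by (rule sub_leI[OF w Ad(2)])
      then have "y \<sqsubseteq> inverse_image C g (A i)"
        using inverse_image_le[OF g(1) Ad(2)] g(2) Ad(3) y by simp
      then show ?thesis by (rule sub_le_trans) (use u(2) uA in auto)
    qed
    then show ?thesis using m(3)[OF Ad(2)] Ad(3) g(2) by blast
  qed
  then have sm: "s \<sqsubseteq> m" using chain_sup_least[OF sup m(1)] m(2) g(2) by simp
  have pb: "is_pullback C g s (Dom C (pb1 C g s)) (pb1 C g s) (pb2 C g s)"
    by (rule pb_pullback) (use g s in simp_all)
  note P = pullbackD[OF pb]
  have sg: "Cod C s = Cod C g" using s(3) g(2) by simp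
  have "pb2 C g s \<in> Arr C" "Cod C (pb2 C g s) = Dom C s" "pb1 C g s \<in> Hom C (Dom C (pb2 C g s)) (Dom C g)"
    "s \<cdot> pb2 C g s = g \<cdot> pb1 C g s" using P by simp_all
  then show "inverse_image C g s \<sqsubseteq> u"
    unfolding inverse_image_def using m(3)[OF s(2) sg] sm by blast
qed

lemma topos_stable_split_epi: "chain_sups_stable_split_epi C"
  unfolding chain_sups_stable_split_epi_def is_split_epi_def
  using chain_sups_stable_inverse_image by blast

text \<open>Intersection with \<open>U\<close> is inverse image along \<open>U\<close> followed by
  composition with \<open>U\<close>. Inverse images preserve the supremum, and composition with
  \<open>U\<close> is left adjoint to the inverse image.\<close>

lemma topos_stable_meet: "chain_sups_stable_meet C"
  unfolding chain_sups_stable_meet_def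
proof (intro ballI allI impI)
  fix X A s U assume "U \<in> Subobjects C X" and *: "is_chain C X A \<and> is_chain_sup C X A s"
  then have A: "is_chain C X A" and sup: "is_chain_sup C X A s"
    and U: "is_mono C U" "Cod C U = X" "U \<in> Arr C" by simp_all
  note Ad = chainD[OF A] and s = chain_supD[OF sup]
  have le: "x \<sqsubseteq> sub_meet C r U \<longleftrightarrow> x \<sqsubseteq> r \<and> x \<sqsubseteq> U" if "is_mono C r" "Cod C r = X" for x r
    using sub_meet_le[of r U] that U by simp
  have inv: "k \<sqsubseteq> inverse_image C U r \<longleftrightarrow> k \<in> Arr C \<and> Cod C k = Dom C U \<and> U \<cdot> k \<sqsubseteq> r"
    if "is_mono C r" "Cod C r = X" for k r
    using inverse_image_le[of U r] that U by simp
  have mono: "is_mono C (sub_meet C r U)" "Cod C (sub_meet C r U) = X"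
    "is_mono C (inverse_image C U r)" "Cod C (inverse_image C U r) = Dom C U"
    if "is_mono C r" "Cod C r = X" for r
    using sub_meet_mono[OF that(1) U(1)] inverse_image_mono[OF U(3) that(1)] that(2) U(2) by simp_all
  show "is_chain_sup C X (\<lambda>i. sub_meet C (A i) U) (sub_meet C s U)"
    unfolding is_chain_sup_def is_supremum_def
  proof (intro conjI ballI impI)
    show "sub_meet C s U \<in> Subobjects C X" using mono[OF s(1,3)] by simp
    fix a assume "a \<in> range (\<lambda>i. sub_meet C (A i) U)"
    then obtain i where a: "a = sub_meet C (A i) U" by blast
    have "a \<sqsubseteq> sub_meet C (A i) U" unfolding a using mono(1)[OF Ad(1,3)] by simp
    then show "a \<sqsubseteq> sub_meet C s U"
      unfolding le[OF s(1,3)] le[OF Ad(1,3)] using sub_le_trans[OF _ s(4) s(2)] by blast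
  next
    fix u assume u: "u \<in> Subobjects C X" "\<forall>a\<in>range (\<lambda>i. sub_meet C (A i) U). a \<sqsubseteq> u"
    have um: "is_mono C u" "Cod C u = X" and uA: "u \<in> Arr C" using u(1) by simp_all
    have "inverse_image C U (A i) \<sqsubseteq> inverse_image C U u" for i
    proof -
      let ?k = "inverse_image C U (A i)"
      have "?k \<sqsubseteq> ?k" using mono(3)[OF Ad(1,3)] by simp
      then have k: "?k \<in> Arr C" "Cod C ?k = Dom C U" "U \<cdot> ?k \<sqsubseteq> A i" unfolding inv[OF Ad(1,3)] by blast+
      have "U \<cdot> ?k \<sqsubseteq> sub_meet C (A i) U"
        unfolding le[OF Ad(1,3)] using k(3) sub_leI[OF k(1,2) U(3)] by blast
      then have "U \<cdot> ?k \<sqsubseteq> u" by (rule sub_le_trans) (use u(2) uA in auto)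
      then show ?thesis unfolding inv[OF um] using k by blast
    qed
    then have su: "inverse_image C U s \<sqsubseteq> inverse_image C U u"
      using chain_sup_least[OF chain_sups_stable_inverse_image[OF A sup U(3,2)] mono(3,4)[OF um]] by blast
    let ?t = "sub_meet C s U"
    have "?t \<sqsubseteq> ?t" using mono(1)[OF s(1,3)] by simp
    then have t: "?t \<sqsubseteq> s" "?t \<sqsubseteq> U" unfolding le[OF s(1,3)] by blast+
    obtain k where k: "k \<in> Arr C" "Cod C k = Dom C U" "U \<cdot> k = ?t" using sub_leE[OF t(2) U(3)] by metis
    then have "k \<sqsubseteq> inverse_image C U s" unfolding inv[OF s(1,3)] using t(1) by simp
    from sub_le_trans[OF this su monoD[OF mono(3)[OF um]]] show "?t \<sqsubseteq> u" unfolding inv[OF um] using k(3) by simp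
  qed
qed

text \<open>Given \<open>u \<cdot> p \<sqsubseteq> m\<close>, the inverse image \<open>?V\<close> of
  \<open>m\<close> along \<open>u\<close> contains \<open>p\<close>. Its universal quantification
  \<open>n\<close> along \<open>f\<close> contains \<open>e\<close>, because matching elements of
  \<open>e\<close> and \<open>f\<close> lift to the pullback. Strength of \<open>e\<close> makes
  \<open>n\<close> everything, and evaluating \<open>n\<close> at \<open>f\<close> shows that
  \<open>?V\<close> is everything.\<close>

lemma strong_pullback:
  assumes e: "strong e" and pb: "is_pullback C f e P p q"
  shows "strong p"
proof (rule strongI)
  note Pd = pullbackD[OF pb]
  show "p \<in> Arr C" by fact
  fix u m assume m: "is_mono C m" and u: "u \<in> Arr C" "Dom C u = Cod C p" and le: "u \<cdot> p \<sqsubseteq> m"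
  have mA: "m \<in> Arr C" using m by simp
  have um: "Cod C u = Cod C m" using sub_leD[OF le mA] comp_arr(3)[OF Pd(4) u(1)] u(2) by simp
  let ?V = "inverse_image C u m"
  have V: "is_mono C ?V" "Cod C ?V = Dom C f" "\<And>x. x \<sqsubseteq> ?V \<longleftrightarrow> x \<in> Arr C \<and> Cod C x = Dom C u \<and> u \<cdot> x \<sqsubseteq> m"
    using inverse_image_mono[OF u(1) m um] inverse_image_le[OF u(1) mA um] u(2) Pd(8) by simp_all
  have VA: "?V \<in> Arr C" using V by simp
  obtain n where n: "is_mono C n" "Cod C n = Cod C f"
    "\<And>h. h \<in> Arr C \<Longrightarrow> Cod C h = Cod C f \<Longrightarrow> h \<sqsubseteq> n \<longleftrightarrow>
      (\<forall>w y. w \<in> Arr C \<longrightarrow> Cod C w = Dom C h \<longrightarrow> y \<in> Hom C (Dom C w) (Dom C f) \<longrightarrow> h \<cdot> w = f \<cdot> y \<longrightarrow> y \<sqsubseteq> ?V)"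
    by (rule ex_forall[OF Pd(1) V(1,2)]) blast
  have pV: "p \<sqsubseteq> ?V" unfolding V(3) using Pd(4) u(2) le by simp
  have "e \<sqsubseteq> n"
  proof -
    have "y \<sqsubseteq> ?V" if w: "w \<in> Arr C" "Cod C w = Dom C e" and y: "y \<in> Hom C (Dom C w) (Dom C f)"
      and eq: "e \<cdot> w = f \<cdot> y" for w y
    proof -
      have y': "y \<in> Arr C" "Cod C y = Dom C f" "Dom C y = Dom C w" using y by simp_all
      obtain h where h: "h \<in> Arr C" "Dom C h = Dom C y" "Cod C h = P" "p \<cdot> h = y" "q \<cdot> h = w"
        by (rule pullback_lift[OF pb y'(1) w(1) y'(3) y'(2) w(2) eq[symmetric]])
      then show ?thesis using sub_le_comp[OF pV VA h(1)] Pd(6) by simp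
    qed
    then show ?thesis using n(3)[OF Pd(2)] Pd(3) by simp
  qed
  moreover have X: "Cod C f \<in> Obj C" using Pd(1) by simp
  ultimately have "Id C (Cod C f) \<cdot> e \<sqsubseteq> n" using Pd(2,3) by simp
  then have "Id C (Cod C f) \<sqsubseteq> n"
    by (rule strongD[OF e n(1), rotated -1]) (use X Pd(3) in simp_all)
  moreover have "Id C (Cod C f) \<in> Arr C" "Cod C (Id C (Cod C f)) = Cod C f" "Dom C (Id C (Cod C f)) = Cod C f"
    using X by simp_all
  moreover have "Id C (Cod C f) \<cdot> f = f \<cdot> Id C (Dom C f)" "Id C (Dom C f) \<in> Hom C (Dom C f) (Dom C f)"
    using Pd(1) by simp_all
  ultimately have "Id C (Dom C f) \<sqsubseteq> ?V" using n(3)[of "Id C (Cod C f)"] Pd(1) by metis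
  then have "u \<cdot> Id C (Dom C f) \<sqsubseteq> m" unfolding V(3) by blast
  then show "u \<sqsubseteq> m" using u Pd(8) by simp
qed

text \<open>The image consists of the points lying in every subobject through which \<open>f\<close> factors, where the
  quantifier ranges over the power object of the codomain.\<close>

lemma ex_least_image:
  assumes f: "f \<in> Arr C"
  obtains m where "is_mono C m" "Cod C m = Cod C f" "f \<sqsubseteq> m" "\<And>n. is_mono C n \<Longrightarrow> f \<sqsubseteq> n \<Longrightarrow> m \<sqsubseteq> n"
proof -
  let ?A = "Dom C f" and ?B = "Cod C f"
  have A: "?A \<in> Obj C" and B: "?B \<in> Obj C" using f by simp_all
  obtain P E where P: "P \<in> Obj C" and E: "is_mono C E" "Cod C E = prod_obj C P ?B"
    and nam: "\<And>Z V. Z \<in> Obj C \<Longrightarrow> is_mono C V \<Longrightarrow> Cod C V = prod_obj C Z ?B \<Longrightarrow> \<exists>v \<in> Hom C Z P.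
      \<forall>W. \<forall>z \<in> Hom C W Z. \<forall>a \<in> Hom C W ?B. pairing C (v \<cdot> z) a \<sqsubseteq> E \<longleftrightarrow> pairing C z a \<sqsubseteq> V"
    by (rule ex_power_object[OF B]) blast
  have EA: "E \<in> Arr C" using E by simp
  \<comment> \<open>\<open>N\<close> classifies the subobjects of the codomain through which \<open>f\<close> factors.\<close>
  let ?g = "pairing C (pr1 C P ?A) (f \<cdot> pr2 C P ?A)"
  have g: "?g \<in> Arr C" "Cod C ?g = Cod C E" "Dom C ?g = prod_obj C P ?A" using f A P E(2) by simp_all
  let ?Q = "inverse_image C ?g E"
  have Q: "is_mono C ?Q" "Cod C ?Q = Dom C (pr1 C P ?A)"
    using inverse_image_mono[OF g(1) E(1) g(2)] g(3) A P by simp_all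
  have Qle: "pairing C z a \<sqsubseteq> ?Q \<longleftrightarrow> pairing C z (f \<cdot> a) \<sqsubseteq> E" if "z \<in> Hom C W P" "a \<in> Hom C W ?A" for W z a
    using inverse_image_le[OF g(1) EA g(2), of "pairing C z a"] that g(3) f A P by simp
  have p1: "pr1 C P ?A \<in> Arr C" "Cod C (pr1 C P ?A) = P" "Dom C (pr1 C P ?A) = prod_obj C P ?A" using A P by simp_all
  obtain N where N: "is_mono C N" "Cod C N = Cod C (pr1 C P ?A)"
    "\<And>h. h \<in> Arr C \<Longrightarrow> Cod C h = Cod C (pr1 C P ?A) \<Longrightarrow> h \<sqsubseteq> N \<longleftrightarrow>
      (\<forall>w y. w \<in> Arr C \<longrightarrow> Cod C w = Dom C h \<longrightarrow> y \<in> Hom C (Dom C w) (Dom C (pr1 C P ?A)) \<longrightarrow>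
        h \<cdot> w = pr1 C P ?A \<cdot> y \<longrightarrow> y \<sqsubseteq> ?Q)"
    by (rule ex_forall[OF p1(1) Q]) blast
  have NA: "N \<in> Arr C" "Cod C N = P" using N p1 by simp_all
  let ?D = "Dom C N"
  have D: "?D \<in> Obj C" using NA by simp
  \<comment> \<open>\<open>?Q'\<close> relates a point to the admissible subobjects containing it;
    quantifying over the latter yields the points common to all of them.\<close>
  let ?g' = "pairing C (N \<cdot> pr2 C ?B ?D) (pr1 C ?B ?D)"
  have g': "?g' \<in> Arr C" "Cod C ?g' = Cod C E" "Dom C ?g' = prod_obj C ?B ?D" using B D NA E(2) by simp_all
  let ?Q' = "inverse_image C ?g' E"
  have Q': "is_mono C ?Q'" "Cod C ?Q' = Dom C (pr1 C ?B ?D)"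
    using inverse_image_mono[OF g'(1) E(1) g'(2)] g'(3) B D by simp_all
  have Q'le: "pairing C b n \<sqsubseteq> ?Q' \<longleftrightarrow> pairing C (N \<cdot> n) b \<sqsubseteq> E" if "b \<in> Hom C W ?B" "n \<in> Hom C W ?D" for W b n
    using inverse_image_le[OF g'(1) EA g'(2), of "pairing C b n"] that g'(3) B D NA by simp
  have p1': "pr1 C ?B ?D \<in> Arr C" "Cod C (pr1 C ?B ?D) = ?B" "Dom C (pr1 C ?B ?D) = prod_obj C ?B ?D"
    using B D by simp_all
  obtain m where m: "is_mono C m" "Cod C m = Cod C (pr1 C ?B ?D)"
    "\<And>h. h \<in> Arr C \<Longrightarrow> Cod C h = Cod C (pr1 C ?B ?D) \<Longrightarrow> h \<sqsubseteq> m \<longleftrightarrow>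
      (\<forall>w y. w \<in> Arr C \<longrightarrow> Cod C w = Dom C h \<longrightarrow> y \<in> Hom C (Dom C w) (Dom C (pr1 C ?B ?D)) \<longrightarrow>
        h \<cdot> w = pr1 C ?B ?D \<cdot> y \<longrightarrow> y \<sqsubseteq> ?Q')"
    by (rule ex_forall[OF p1'(1) Q']) blast
  have mA: "m \<in> Arr C" "Cod C m = ?B" using m p1' by simp_all
  show ?thesis
  proof (rule that[OF m(1) mA(2)])
    have "y \<sqsubseteq> ?Q'" if w: "w \<in> Arr C" "Cod C w = ?A" and y: "y \<in> Hom C (Dom C w) (prod_obj C ?B ?D)"
      and eq: "f \<cdot> w = pr1 C ?B ?D \<cdot> y" for w y
    proof -
      have y': "y \<in> Arr C" "Cod C y = prod_obj C ?B ?D" "Dom C y = Dom C w" using y by simp_all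
      obtain b n where bn: "b \<in> Arr C" "n \<in> Arr C" "Dom C b = Dom C y" "Dom C n = Dom C y"
        "Cod C b = ?B" "Cod C n = ?D" and yeq: "y = pairing C b n"
        by (rule pairing_cases[OF y'(1,2) B D])
      have bn': "b \<in> Hom C (Dom C w) ?B" "n \<in> Hom C (Dom C w) ?D" using bn y'(3) by simp_all
      have "pr1 C ?B ?D \<cdot> pairing C b n = b" using bn by simp
      then have fb: "f \<cdot> w = b" using eq yeq by simp
      have Nn: "N \<cdot> n \<in> Hom C (Dom C w) P" using bn' NA by simp
      have "N \<cdot> n \<sqsubseteq> N" by (rule sub_leI) (use bn' NA in simp_all)
      moreover have "N \<cdot> n \<in> Arr C" "Cod C (N \<cdot> n) = Cod C (pr1 C P ?A)" "Dom C (N \<cdot> n) = Dom C w" using Nn p1 by simp_all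
      moreover have "Id C (Dom C w) \<in> Arr C" "Cod C (Id C (Dom C w)) = Dom C w" "Dom C (Id C (Dom C w)) = Dom C w"
        using w by simp_all
      moreover have "pairing C (N \<cdot> n) w \<in> Hom C (Dom C w) (Dom C (pr1 C P ?A))" using Nn w p1 by simp
      moreover have "(N \<cdot> n) \<cdot> Id C (Dom C w) = pr1 C P ?A \<cdot> pairing C (N \<cdot> n) w" using Nn w by simp
      ultimately have "pairing C (N \<cdot> n) w \<sqsubseteq> ?Q" using N(3)[of "N \<cdot> n"] by metis
      moreover have "w \<in> Hom C (Dom C w) ?A" using w by simp
      ultimately have "pairing C (N \<cdot> n) (f \<cdot> w) \<sqsubseteq> E" using Qle[OF Nn] by blast
      then show ?thesis using Q'le[OF bn'] unfolding yeq fb by blast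
    qed
    then show "f \<sqsubseteq> m" using m(3)[OF f] p1' by simp
  next
    fix n assume n: "is_mono C n" and fn: "f \<sqsubseteq> n"
    have nA: "n \<in> Arr C" using n by simp
    have nB: "Cod C n = ?B" using sub_leD[OF fn nA] by simp
    \<comment> \<open>\<open>n\<close> is named by a constant family. It is indexed by
      \<open>?B\<close> because the name will be evaluated at \<open>m\<close>, an element of
      \<open>?B\<close>.\<close>
    let ?V = "inverse_image C (pr2 C ?B ?B) n"
    have p2: "pr2 C ?B ?B \<in> Arr C" "Cod C (pr2 C ?B ?B) = Cod C n" "Dom C (pr2 C ?B ?B) = prod_obj C ?B ?B"
      using B nB by simp_all
    have V: "is_mono C ?V" "Cod C ?V = prod_obj C ?B ?B"
      using inverse_image_mono[OF p2(1) n p2(2)] p2(3) by simp_all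
    have Vle: "pairing C z b \<sqsubseteq> ?V \<longleftrightarrow> b \<sqsubseteq> n" if "z \<in> Hom C W ?B" "b \<in> Hom C W ?B" for W z b
      using inverse_image_le[OF p2(1) nA p2(2), of "pairing C z b"] that p2(3) by simp
    obtain v where v: "v \<in> Hom C ?B P"
      "\<And>W z b. z \<in> Hom C W ?B \<Longrightarrow> b \<in> Hom C W ?B \<Longrightarrow> pairing C (v \<cdot> z) b \<sqsubseteq> E \<longleftrightarrow> pairing C z b \<sqsubseteq> ?V"
      using nam[OF B V] by blast
    have vA: "v \<in> Arr C" "Dom C v = ?B" "Cod C v = P" using v(1) by simp_all
    have "y \<sqsubseteq> ?Q" if w: "w \<in> Arr C" "Cod C w = ?B" and y: "y \<in> Hom C (Dom C w) (prod_obj C P ?A)"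
      and eq: "v \<cdot> w = pr1 C P ?A \<cdot> y" for w y
    proof -
      have y': "y \<in> Arr C" "Cod C y = prod_obj C P ?A" "Dom C y = Dom C w" using y by simp_all
      obtain c a where ca: "c \<in> Arr C" "a \<in> Arr C" "Dom C c = Dom C y" "Dom C a = Dom C y"
        "Cod C c = P" "Cod C a = ?A" and yeq: "y = pairing C c a"
        by (rule pairing_cases[OF y'(1,2) P A])
      have ca': "c \<in> Hom C (Dom C w) P" "a \<in> Hom C (Dom C w) ?A" "f \<cdot> a \<in> Hom C (Dom C w) ?B"
        using ca y'(3) f by simp_all
      have "pr1 C P ?A \<cdot> pairing C c a = c" using ca by simp
      then have c: "v \<cdot> w = c" using eq yeq by simp
      have wB: "w \<in> Hom C (Dom C w) ?B" using w by simp
      have "f \<cdot> a \<sqsubseteq> n" by (rule sub_le_comp[OF fn nA]) (use ca' in simp_all)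
      then have "pairing C (v \<cdot> w) (f \<cdot> a) \<sqsubseteq> E" using v(2)[OF wB ca'(3)] Vle[OF wB ca'(3)] by blast
      then show ?thesis using Qle[OF ca'(1,2)] unfolding yeq c by blast
    qed
    then have "v \<sqsubseteq> N" using N(3)[OF vA(1)] vA p1 by simp
    then obtain k where k: "k \<in> Arr C" "Dom C k = Dom C v" "Cod C k = ?D" "N \<cdot> k = v"
      using sub_leE[OF _ NA(1)] by metis
    \<comment> \<open>The quantifier that defines \<open>m\<close> is instantiated at the name of
      \<open>n\<close> itself.\<close>
    let ?y = "pairing C m (k \<cdot> m)"
    have km: "m \<in> Hom C (Dom C m) ?B" "k \<cdot> m \<in> Hom C (Dom C m) ?D" using k vA mA by simp_all
    have mm: "m \<sqsubseteq> m" "Cod C m = Cod C (pr1 C ?B ?D)" using mA p1' by simp_all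
    have y: "?y \<in> Hom C (Dom C (Id C (Dom C m))) (Dom C (pr1 C ?B ?D))" "Id C (Dom C m) \<in> Arr C"
      "Cod C (Id C (Dom C m)) = Dom C m" "m \<cdot> Id C (Dom C m) = pr1 C ?B ?D \<cdot> ?y" using km p1' mA by simp_all
    have "?y \<sqsubseteq> ?Q'" using m(3)[OF mA(1) mm(2)] mm(1) y by blast
    then have "pairing C (N \<cdot> k \<cdot> m) m \<sqsubseteq> E" using Q'le[OF km] by blast
    moreover have "N \<cdot> k \<cdot> m = v \<cdot> m" by (rule comp_assoc_subst[OF k(4)]) (use k vA mA NA in simp_all)
    ultimately show "m \<sqsubseteq> n" using v(2)[OF km(1) km(1)] Vle[OF km(1) km(1)] by simp
  qed
qed

text \<open>Minimality of the image makes the second factor strong: if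
  \<open>u \<cdot> e \<sqsubseteq> n\<close>, then \<open>f\<close> factors through
  \<open>m \<cdot> ?j\<close>, where \<open>?j\<close> is the inverse image of \<open>n\<close>
  along \<open>u\<close>; hence \<open>m\<close> is below \<open>m \<cdot> ?j\<close> and
  \<open>?j\<close> is everything.\<close>

lemma strong_factorization:
  assumes f: "f \<in> Arr C"
  obtains m e where "is_mono C m" "strong e" "Cod C e = Dom C m" "m \<cdot> e = f"
proof -
  obtain m where m: "is_mono C m" "Cod C m = Cod C f" "f \<sqsubseteq> m" and least: "\<And>n. is_mono C n \<Longrightarrow> f \<sqsubseteq> n \<Longrightarrow> m \<sqsubseteq> n"
    by (rule ex_least_image[OF f]) blast
  have mA: "m \<in> Arr C" using m by simp
  obtain e where e: "e \<in> Arr C" "Dom C e = Dom C f" "Cod C e = Dom C m" "m \<cdot> e = f"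
    using sub_leE[OF m(3) mA] by metis
  have "strong e"
  proof (rule strongI[OF e(1)])
    fix u n assume n: "is_mono C n" and u: "u \<in> Arr C" "Dom C u = Cod C e" and le: "u \<cdot> e \<sqsubseteq> n"
    have nA: "n \<in> Arr C" using n by simp
    have un: "Cod C u = Cod C n" using sub_leD[OF le nA] comp_arr(3)[OF e(1) u(1)] u(2) by simp
    let ?j = "inverse_image C u n"
    have j: "is_mono C ?j" "Cod C ?j = Dom C u"
      "\<And>x. x \<sqsubseteq> ?j \<longleftrightarrow> x \<in> Arr C \<and> Cod C x = Dom C u \<and> u \<cdot> x \<sqsubseteq> n"
      using inverse_image_mono[OF u(1) n un] inverse_image_le[OF u(1) nA un] by simp_all
    have jA: "?j \<in> Arr C" "Cod C ?j = Dom C m" using j u(2) e(3) by simp_all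
    have "e \<sqsubseteq> ?j" unfolding j(3) using e(1) u(2) le by simp
    then obtain k where k: "k \<in> Arr C" "Dom C k = Dom C e" "Cod C k = Dom C ?j" "?j \<cdot> k = e"
      using sub_leE[OF _ jA(1)] by metis
    have mj: "is_mono C (m \<cdot> ?j)" by (rule mono_comp[OF m(1) j(1) jA(2)])
    have "(m \<cdot> ?j) \<cdot> k = m \<cdot> ?j \<cdot> k" by (rule comp_assoc) (use k jA mA in simp_all)
    then have "(m \<cdot> ?j) \<cdot> k = f" using k(4) e(4) by simp
    moreover have "(m \<cdot> ?j) \<cdot> k \<sqsubseteq> m \<cdot> ?j" by (rule sub_leI) (use k jA mA in simp_all)
    ultimately have "m \<sqsubseteq> m \<cdot> ?j" using least[OF mj] by simp
    then obtain l where l: "l \<in> Arr C" "Dom C l = Dom C m" "Cod C l = Dom C (m \<cdot> ?j)" "(m \<cdot> ?j) \<cdot> l = m"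
      using sub_leE[OF _ monoD[OF mj]] by metis
    have dl: "Cod C l = Dom C ?j" using l(3) jA mA by simp
    have jl: "?j \<cdot> l \<in> Arr C" "Dom C (?j \<cdot> l) = Dom C m" "Cod C (?j \<cdot> l) = Dom C m" using l(1,2) dl jA by simp_all
    have "m \<cdot> ?j \<cdot> l = m \<cdot> Id C (Dom C m)"
      using l(4) comp_assoc[OF l(1) jA(1) mA dl jA(2)] mA by simp
    then have "?j \<cdot> l = Id C (Dom C m)"
      by (rule mono_cancel[OF m(1)]) (use jl mA in simp_all)
    then have "Id C (Dom C m) \<sqsubseteq> ?j" using sub_leI[OF l(1) dl jA(1)] by simp
    then have "u \<cdot> Id C (Dom C m) \<sqsubseteq> n" unfolding j(3) by blast
    then show "u \<sqsubseteq> n" using u e(3) by simp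
  qed
  then show ?thesis using that m(1) e(3,4) by blast
qed

lemma strong_cover_lift:
  assumes "strong e" "u \<in> Arr C" "Cod C u = Cod C e"
  obtains w a where "strong w" "Cod C w = Dom C u" "a \<in> Hom C (Dom C w) (Dom C e)" "u \<cdot> w = e \<cdot> a"
proof -
  obtain P p q where P: "is_pullback C u e P p q" by (rule ex_pullback[of u e]) (use assms in simp_all)
  show ?thesis
    by (rule that[OF strong_pullback[OF assms(1) P], of q]) (use pullbackD[OF P] in simp_all)
qed

text \<open>If \<open>k\<close> coequalizes the kernel pair of \<open>e\<close>, then the image of \<open>(e, k)\<close> is the graph of the induced arrow:
  its first projection is monic and a strong epimorphism factors through it.\<close>

lemma strong_regular_epi:
  assumes e: "strong e"
  shows "is_regular_epi C e"
proof -
  have eA: "e \<in> Arr C" using e by simp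
  obtain P p q where P: "is_pullback C e e P p q" by (rule ex_pullback[OF eA eA refl])
  note Pd = pullbackD[OF P]
  have "is_coequalizer C p q e"
  proof (rule coequalizerI)
    show "p \<in> Arr C" "q \<in> Hom C (Dom C p) (Cod C p)" "e \<in> Arr C" "Dom C e = Cod C p" "e \<cdot> p = e \<cdot> q"
      using Pd by simp_all
  next
    fix u v assume "u \<in> Arr C" "v \<in> Arr C" "Dom C u = Cod C e" "Dom C v = Cod C e" "u \<cdot> e = v \<cdot> e"
    then show "u = v" by (rule strong_cancel[OF e])
  next
    fix k assume k: "k \<in> Arr C" "Dom C k = Dom C e" and kpq: "k \<cdot> p = k \<cdot> q"
    let ?B = "Cod C e" and ?K = "Cod C k"
    have BK: "?B \<in> Obj C" "?K \<in> Obj C" using eA k by simp_all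
    let ?h = "pairing C e k"
    have h: "?h \<in> Arr C" "Dom C ?h = Dom C e" "Cod C ?h = prod_obj C ?B ?K" using eA k by simp_all
    obtain m d where m: "is_mono C m" and d: "strong d" and md: "Cod C d = Dom C m" "m \<cdot> d = ?h"
      by (rule strong_factorization[OF h(1)])
    have mA: "m \<in> Arr C" and dA: "d \<in> Arr C" using m d by simp_all
    have mc: "Cod C m = prod_obj C ?B ?K" "Dom C d = Dom C e"
      using comp_arr(2,3)[OF dA mA md(1)] md(2) h by simp_all
    let ?r = "pr1 C ?B ?K \<cdot> m" and ?t = "pr2 C ?B ?K \<cdot> m"
    have r: "?r \<in> Arr C" "Dom C ?r = Dom C m" "Cod C ?r = ?B" using mA mc BK by simp_all
    have t: "?t \<in> Arr C" "Dom C ?t = Dom C m" "Cod C ?t = ?K" using mA mc BK by simp_all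
    have rd: "?r \<cdot> d = e"
    proof -
      have "?r \<cdot> d = pr1 C ?B ?K \<cdot> m \<cdot> d" by (rule comp_assoc) (use mA dA md(1) mc BK in simp_all)
      then show ?thesis using md(2) eA k by simp
    qed
    have td: "?t \<cdot> d = k"
    proof -
      have "?t \<cdot> d = pr2 C ?B ?K \<cdot> m \<cdot> d" by (rule comp_assoc) (use mA dA md(1) mc BK in simp_all)
      then show ?thesis using md(2) eA k by simp
    qed
    have rm: "is_mono C ?r"
      unfolding is_mono_def
    proof (intro conjI allI ballI impI)
      show "?r \<in> Arr C" by fact
      fix Z u v assume u: "u \<in> Hom C Z (Dom C ?r)" and v: "v \<in> Hom C Z (Dom C ?r)" and eq: "?r \<cdot> u = ?r \<cdot> v"
      have u': "u \<in> Arr C" "Dom C u = Z" "Cod C u = Dom C m" and v': "v \<in> Arr C" "Dom C v = Z" "Cod C v = Dom C m"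
        using u v r(2) by simp_all
      \<comment> \<open>Two elements of the graph with the same first coordinate are lifted through
        \<open>d\<close> over one cover. The lifts have equal images under \<open>e\<close>, hence
        come from the kernel pair, hence have equal images under \<open>k\<close>; so the elements
        agree.\<close>
      obtain w1 a1 where w1: "strong w1" "Cod C w1 = Dom C u" "a1 \<in> Hom C (Dom C w1) (Dom C d)" "u \<cdot> w1 = d \<cdot> a1"
        by (rule strong_cover_lift[OF d u'(1)]) (use u'(3) md(1) in simp_all)
      have w1A: "w1 \<in> Arr C" using w1(1) by simp
      have vw1: "v \<cdot> w1 \<in> Arr C" "Cod C (v \<cdot> w1) = Cod C d" "Dom C (v \<cdot> w1) = Dom C w1"
        using v' w1A w1(2) u' md(1) by simp_all
      obtain w2 a2 where w2: "strong w2" "Cod C w2 = Dom C (v \<cdot> w1)" "a2 \<in> Hom C (Dom C w2) (Dom C d)"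
        "(v \<cdot> w1) \<cdot> w2 = d \<cdot> a2"
        by (rule strong_cover_lift[OF d vw1(1,2)])
      have w2A: "w2 \<in> Arr C" "Cod C w2 = Dom C w1" using w2(1,2) vw1(3) by simp_all
      let ?w = "w1 \<cdot> w2" and ?a1 = "a1 \<cdot> w2"
      have w: "strong ?w" by (rule strong_comp[OF w1(1) w2(1) w2A(2)])
      have wA: "?w \<in> Arr C" "Cod C ?w = Z" "Dom C ?w = Dom C w2" using w1A w2A w1(2) u' by simp_all
      have a1: "?a1 \<in> Arr C" "Dom C ?a1 = Dom C w2" "Cod C ?a1 = Dom C e" using w1(3) w2A mc by simp_all
      have a2: "a2 \<in> Arr C" "Dom C a2 = Dom C w2" "Cod C a2 = Dom C e" using w2(3) mc by simp_all
      have uw: "u \<cdot> ?w = d \<cdot> ?a1"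
        by (rule square_comp[OF w1(4)]) (use w1A w2A w1(2,3) u' dA md(1) in simp_all)
      have vw: "v \<cdot> ?w = d \<cdot> a2" using w2(4) v' w1A w2A w1(2) u' by simp
      have "?r \<cdot> u \<cdot> ?w = ?r \<cdot> v \<cdot> ?w" by (rule square_comp[OF eq]) (use wA u' v' r in simp_all)
      then have "?r \<cdot> d \<cdot> ?a1 = ?r \<cdot> d \<cdot> a2" unfolding uw vw .
      moreover have rde: "?r \<cdot> d \<cdot> a = e \<cdot> a" and tdk: "?t \<cdot> d \<cdot> a = k \<cdot> a"
        if "a \<in> Arr C" "Cod C a = Dom C e" for a
        using comp_assoc_subst[OF rd that(1) dA r(1)] comp_assoc_subst[OF td that(1) dA t(1)]
          that(2) mc(2) md(1) r(2) t(2) by metis+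
      ultimately have ea: "e \<cdot> ?a1 = e \<cdot> a2" using rde[OF a1(1,3)] rde[OF a2(1,3)] by metis
      have "Dom C ?a1 = Dom C a2" using a1(2) a2(2) by simp
      from pullback_lift[OF P a1(1) a2(1) this a1(3) a2(3) ea]
      obtain l where l: "l \<in> Arr C" "Cod C l = P" "p \<cdot> l = ?a1" "q \<cdot> l = a2" by metis
      have "k \<cdot> p \<cdot> l = k \<cdot> q \<cdot> l" by (rule square_comp[OF kpq]) (use l(1,2) k Pd in simp_all)
      then have ka: "k \<cdot> ?a1 = k \<cdot> a2" unfolding l(3,4) .
      have "u \<cdot> ?w = v \<cdot> ?w"
        unfolding uw vw
      proof (rule mono_cancel[OF m])
        have md': "m \<cdot> d \<cdot> a = pairing C (e \<cdot> a) (k \<cdot> a)" if "a \<in> Arr C" "Cod C a = Dom C e" for a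
          using comp_assoc_subst[OF md(2) that(1) dA mA] that mc(2) md(1) eA k by simp
        show "m \<cdot> d \<cdot> ?a1 = m \<cdot> d \<cdot> a2" using md'[OF a1(1,3)] md'[OF a2(1,3)] ea ka by metis
        show "d \<cdot> ?a1 \<in> Arr C" "d \<cdot> a2 \<in> Arr C" "Dom C (d \<cdot> ?a1) = Dom C (d \<cdot> a2)"
          "Cod C (d \<cdot> ?a1) = Dom C m" "Cod C (d \<cdot> a2) = Dom C m"
          using comp_arr[OF a1(1) dA] comp_arr[OF a2(1) dA] a1(2,3) a2(2,3) mc(2) md(1) by simp_all
      qed
      then show "u = v" by (rule strong_cancel[OF w, rotated -1]) (use u' v' wA in simp_all)
    qed
    \<comment> \<open>A monomorphism through which the strong \<open>e\<close> factors has a section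
      \<open>s\<close>; followed by the second projection it gives the induced arrow
      \<open>?t \<cdot> s\<close>.\<close>
    have "e \<sqsubseteq> ?r" using sub_leI[OF dA _ r(1)] md(1) r(2) rd by simp
    then have "Id C ?B \<cdot> e \<sqsubseteq> ?r" using eA by simp
    then have "Id C ?B \<sqsubseteq> ?r" by (rule strongD[OF e rm, rotated -1]) (use BK in simp_all)
    then obtain s where s: "s \<in> Arr C" "Dom C s = Dom C (Id C ?B)" "Cod C s = Dom C ?r" "?r \<cdot> s = Id C ?B"
      using sub_leE[OF _ r(1)] by metis
    have s': "Dom C s = ?B" "Cod C s = Dom C m" using s(2,3) BK r(2) by simp_all
    have se: "s \<cdot> e \<in> Arr C" "Dom C (s \<cdot> e) = Dom C e" "Cod C (s \<cdot> e) = Dom C m" using s(1) s' eA by simp_all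
    have "?r \<cdot> s \<cdot> e = ?r \<cdot> d"
      using comp_assoc_subst[OF s(4) eA s(1) r(1)] s' r(2) rd eA by simp
    then have "s \<cdot> e = d" by (rule mono_cancel[OF rm]) (use se dA mc md(1) r(2) in simp_all)
    moreover have "(?t \<cdot> s) \<cdot> e = ?t \<cdot> s \<cdot> e" by (rule comp_assoc) (use s(1) s' t eA in simp_all)
    ultimately have "(?t \<cdot> s) \<cdot> e = k" using td by simp
    moreover have "?t \<cdot> s \<in> Hom C ?B ?K" using comp_arr[OF s(1) t(1)] s' t by simp
    ultimately show "\<exists>l\<in>Hom C ?B ?K. l \<cdot> e = k" by blast
  qed
  then show ?thesis unfolding is_regular_epi_def by blast
qed

lemma topos_regular: "regular_category C"
  unfolding regular_category_def
proof (intro conjI ballI allI impI)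
  show "finitely_complete C" by (rule finitely_complete)
  show "\<exists>m e. is_mono C m \<and> is_regular_epi C e \<and> Cod C e = Dom C m \<and> m \<cdot> e = f" if "f \<in> Arr C" for f
    using strong_factorization[OF that] strong_regular_epi by metis
  show "is_regular_epi C p" if "is_regular_epi C e \<and> is_pullback C f e P p q" for f e P p q
    using that regular_epi_strong strong_pullback strong_regular_epi by blast
qed

end

theorem proposition5p1:
  fixes E :: "('o, 'a) cat" and Th :: "'f alg_theory"
  assumes "category E" and "is_alg_theory Th"
  shows
    "(finitely_complete E \<and> has_chain_sups E \<and>
        chain_sups_stable_split_epi E \<and> chain_sups_stable_meet E \<longrightarrow>
        has_chain_sups (Alg Th E) \<and>
        chain_sups_stable_meet (Alg Th E) \<and>
        preserves_chain_sups (Alg Th E) E U_obj U_arr \<and>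
        reflects_chain_sups (Alg Th E) E U_obj U_arr \<and>
        (regular_category E \<longrightarrow>
          alternating_join_formula E (Preorders E) \<and>
          alternating_join_formula E (Equivalences E) \<and>
          regular_category (Alg Th E) \<and>
          alternating_join_formula (Alg Th E) (Preorders (Alg Th E)) \<and>
          alternating_join_formula (Alg Th E) (Equivalences (Alg Th E)))) \<and>
     (elementary_topos E \<and> has_chain_sups E \<longrightarrow>
        finitely_complete E \<and> regular_category E \<and>
        chain_sups_stable_split_epi E \<and> chain_sups_stable_meet E \<and>
        alternating_join_formula E (Preorders E) \<and>
        alternating_join_formula E (Equivalences E) \<and>
        alternating_join_formula (Alg Th E) (Preorders (Alg Th E)) \<and>
        alternating_join_formula (Alg Th E) (Equivalences (Alg Th E)))"
proof -
  have main: "has_chain_sups (Alg Th E) \<and> chain_sups_stable_meet (Alg Th E) \<and>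
      preserves_chain_sups (Alg Th E) E U_obj U_arr \<and> reflects_chain_sups (Alg Th E) E U_obj U_arr \<and>
      (regular_category E \<longrightarrow>
        alternating_join_formula E (Preorders E) \<and> alternating_join_formula E (Equivalences E) \<and>
        regular_category (Alg Th E) \<and>
        alternating_join_formula (Alg Th E) (Preorders (Alg Th E)) \<and>
        alternating_join_formula (Alg Th E) (Equivalences (Alg Th E)))"
    if fc: "finitely_complete E" and st: "has_chain_sups E" "chain_sups_stable_split_epi E" "chain_sups_stable_meet E"
  proof -
    have E: "complete_category E"
      using complete_category.intro[OF assms(1) complete_category_axioms.intro[OF fc]] .
    interpret algebras E Th
      using algebras.intro[OF E algebras_axioms.intro[OF assms(2)]] .
    have stA: "has_chain_sups (Alg Th E)" "chain_sups_stable_split_epi (Alg Th E)" "chain_sups_stable_meet (Alg Th E)"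
      using alg_has_chain_sups[OF st] alg_stable[OF st] by blast+
    have pres: "preserves_chain_sups (Alg Th E) E U_obj U_arr"
      unfolding preserves_chain_sups_def U_obj_def
      using alg_chain_base alg_preserves_chain_sup[OF st] by blast
    have refl: "reflects_chain_sups (Alg Th E) E U_obj U_arr"
      unfolding reflects_chain_sups_def U_obj_def using alg_reflects_chain_sup by blast
    have reg: "alternating_join_formula E (Preorders E) \<and> alternating_join_formula E (Equivalences E) \<and>
        regular_category (Alg Th E) \<and>
        alternating_join_formula (Alg Th E) (Preorders (Alg Th E)) \<and>
        alternating_join_formula (Alg Th E) (Equivalences (Alg Th E))"
      if "regular_category E"
    proof -
      have R: "regular_complete E" using regular_complete.intro[OF E regular_complete_axioms.intro[OF that]] .
      have "regular_algebras E Th" using regular_algebras.intro[OF R algebras_axioms] .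
      then have regA: "regular_category (Alg Th E)" by (rule regular_algebras.alg_regular)
      have "regular_complete (Alg Th E)"
        using regular_complete.intro[OF complete_category.intro[OF alg_category
          complete_category_axioms.intro[OF alg_finitely_complete]] regular_complete_axioms.intro[OF regA]] .
      then show ?thesis
        using regular_complete.join_formula_Preorders_Equivalences[OF R st]
          regular_complete.join_formula_Preorders_Equivalences[OF _ stA] regA by blast
    qed
    show ?thesis using stA pres refl reg by blast
  qed
  \<comment> \<open>For a topos the remaining hypotheses of \<open>main\<close> are derived here;
    the existence of suprema of chains is the one that stays an assumption.\<close>
  have "finitely_complete E \<and> regular_category E \<and>
      chain_sups_stable_split_epi E \<and> chain_sups_stable_meet E"
    if T: "elementary_topos E"
  proof -
    have fc: "finitely_complete E" using T unfolding elementary_topos_def by blast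
    obtain \<Omega> tr where tr: "is_subobject_classifier E \<Omega> tr" using T unfolding elementary_topos_def by blast
    have "\<exists>Y ev. is_exponential E A B Y ev" if "A \<in> Obj E" "B \<in> Obj E" for A B
      using T that unfolding elementary_topos_def by blast
    then interpret topos E \<Omega> tr
      using topos.intro[OF complete_category.intro[OF assms(1) complete_category_axioms.intro[OF fc]]
        topos_axioms.intro[OF tr]] by blast
    show ?thesis using fc topos_regular topos_stable_split_epi topos_stable_meet by blast
  qed
  with main show ?thesis by blast
qed

end
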